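(* Let $\lambda_1,\lambda_2\in\mathbb{R}$ satisfy $0<|\lambda_1|<1<|\lambda_2|$, let $\Lambda:=\mathrm{diag}(\lambda_1,\lambda_2)$ and $\alpha\in(0,1]$. Suppose that $F:\mathbb{R}^2\to\mathbb{R}^2$ is a $C^{1,\alpha}$ diffeomorphism such that $F(O)=O$ and $DF(O)=\Lambda$, where $O$ is the origin. Put $\sigma:=\log|\lambda_2|/\log|\lambda_1|<0$ and $$\beta=\begin{cases}-\sigma(1-\sigma)^{-1}\alpha, & \text{if } |\lambda_1\lambda_2|\le 1,\\ (1-\sigma)^{-1}\alpha, & \text{if } |\lambda_1\lambda_2|>1.\end{cases}$$ Then there exist a neighborhood $U$ of $O$ and a $C^{1,\beta}$ diffeomorphism $\Phi:U\to\mathbb{R}^2$ (onto its image) such that $\Phi\circ F=\Lambda\circ\Phi$ near $O$.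
   Context: For $\gamma\in(0,1]$, a mapping $G$ is $C^{1,\gamma}$ if it is $C^1$ and $\sup_{x\ne y}\|DG(x)-DG(y)\|/\|x-y\|^{\gamma}<\infty$ on its domain. In the paper $U$ is a sufficiently small closed disk centered at $O$. *)

theory Defs
  imports "HOL-Analysis.Analysis"
begin

text \<open>
  Derivatives are taken within the domain \<^term>\<open>S\<close>.  On the domains that matter (the whole
  plane, closed disks, and diffeomorphic images of these) they are uniquely determined, also at
  boundary points.  The norm on derivatives is the operator norm of bounded linear maps.
\<close>

definition C1_on :: "'a::real_normed_vector set \<Rightarrow> ('a \<Rightarrow> 'b::real_normed_vector) \<Rightarrow> bool"
  where "C1_on S G \<longleftrightarrow>
    (\<exists>G' :: 'a \<Rightarrow> 'a \<Rightarrow>\<^sub>L 'b.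
       (\<forall>x\<in>S. (G has_derivative blinfun_apply (G' x)) (at x within S)) \<and>
       continuous_on S G')"

definition C1_holder_on ::
    "real \<Rightarrow> 'a::real_normed_vector set \<Rightarrow> ('a \<Rightarrow> 'b::real_normed_vector) \<Rightarrow> bool"
  where "C1_holder_on \<gamma> S G \<longleftrightarrow>
    (\<exists>G' :: 'a \<Rightarrow> 'a \<Rightarrow>\<^sub>L 'b.
       (\<forall>x\<in>S. (G has_derivative blinfun_apply (G' x)) (at x within S)) \<and>
       continuous_on S G' \<and>
       (\<exists>C. \<forall>x\<in>S. \<forall>y\<in>S. x \<noteq> y \<longrightarrow> norm (G' x - G' y) / norm (x - y) powr \<gamma> \<le> C))"

text \<open>A diffeomorphism of \<^term>\<open>S\<close> onto its image \<^term>\<open>G ` S\<close>.\<close>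

definition C1_diffeo_on :: "'a::real_normed_vector set \<Rightarrow> ('a \<Rightarrow> 'b::real_normed_vector) \<Rightarrow> bool"
  where "C1_diffeo_on S G \<longleftrightarrow>
    inj_on G S \<and> C1_on S G \<and> C1_on (G ` S) (inv_into S G)"

definition diag2 :: "real \<Rightarrow> real \<Rightarrow> real^2^2"
  where "diag2 a b = vector [vector [a, 0], vector [0, b]]"

end

(*
  By the symmetry that exchanges F with its inverse and the two axes, it suffices to find a C^{1,gamma}
  function phi with phi o F = lambda1 phi near O and D phi(O) = (1, 0), where
  gamma = alpha ln|lambda2| / (ln|lambda2| - ln|lambda1|).  Write H for the inverse of F, so that
  A = 1/lambda1 is expanding and B = 1/lambda2 is contracting.  After the C^{1,alpha} invariant curve
  tangent to the first axis has been straightened, H linearized on it, and H cut off to a global map near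
  diag(A, B), phi is the limit of A^{-n} fst o H^n.

  The gradient of the n-th iterate is exp(S_n) (1, b_n).  The slopes b_n converge to an
  alpha-Hoelder invariant field.  The factor S_n is a sum along the orbit of alpha-Hoelder functions that
  vanish on the first axis.  Hence the k-th summands for two points at distance d differ by at most a
  constant times min((|A|^k d)^alpha, |B|^(k alpha)), and the sum of these minima is of order d^gamma.
  No exponential rate is lost, because the sum of |DH - diag(A, B)| along an orbit is bounded
  by means of a bounded potential.
*)
theory Submission imports Defs begin

section \<open>Maps with Hoelder continuous derivative\<close>

text \<open>Two obstacles shape the argument. Bounding the iterates of \<open>H\<close> by powers of
  |A| + \<epsilon> and |B| + \<epsilon> would only give exponents below gamma, so the rates |A| and
  |B| have to be exact up to a constant factor. And the slope field is only \<alpha>-Hoelder, so the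
  logarithms of the length factors cannot be compared by differentiating them; they are estimated
  through the distance of two orbits and through the distance of each orbit to the first axis.
  Straightening and linearizing on the axis serve the second estimate: they make the first column of
  \<open>DH\<close> constant there, and only this column enters the length factor.

  The slope field is used twice. For F with its axes exchanged, the points whose expanding
  coordinate stays bounded form a graph whose derivative is minus the limit field; this is the
  invariant curve. For the straightened inverse, the field is the direction of the gradient of phi.
  The two coordinates of the linearization have different exponents, and \<beta> is the smaller one;
  which one that is depends on |lambda1 lambda2|.\<close>

lemma holder_imp_continuous_on:
  assumes "0 < \<gamma>"
    and hol: "\<And>x y. x \<in> S \<Longrightarrow> y \<in> S \<Longrightarrow> norm (F x - F y) \<le> C * norm (x - y) powr \<gamma>"
  shows "continuous_on S F"
  unfolding continuous_on_def
proof
  fix x assume x: "x \<in> S"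
  have lim: "((\<lambda>y. C * norm (y - x) powr \<gamma>) \<longlongrightarrow> C * 0) (at x within S)"
    by (intro tendsto_mult_left tendsto_zero_powrI[where b=\<gamma>] tendsto_const \<open>0 < \<gamma>\<close>)
      (auto intro!: tendsto_eq_intros)
  have ev: "\<forall>\<^sub>F y in at x within S. norm (F y - F x) \<le> C * norm (y - x) powr \<gamma>"
    unfolding eventually_at_filter using hol[OF _ x] by (intro always_eventually allI impI)
  have "((\<lambda>y. F y - F x) \<longlongrightarrow> 0) (at x within S)"
    using Lim_null_comparison[OF ev] lim by simp
  then show "(F \<longlongrightarrow> F x) (at x within S)" by (rule LIM_zero_cancel)
qed

lemma C1_holder_onI:
  assumes "0 < \<gamma>"
    and der: "\<And>x. x \<in> S \<Longrightarrow> (G has_derivative blinfun_apply (G' x)) (at x within S)"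
    and hol: "\<And>x y. x \<in> S \<Longrightarrow> y \<in> S \<Longrightarrow> norm (G' x - G' y) \<le> C * norm (x - y) powr \<gamma>"
  shows "C1_holder_on \<gamma> S G"
  unfolding C1_holder_on_def
proof (intro exI[of _ G'] conjI ballI)
  show "continuous_on S G'" using assms(1) hol by (rule holder_imp_continuous_on)
  have "norm (G' x - G' y) / norm (x - y) powr \<gamma> \<le> C" if "x \<in> S" "y \<in> S" "x \<noteq> y" for x y
    using hol[OF that(1,2)] that(3) by (simp add: divide_le_eq)
  then show "\<exists>C. \<forall>x\<in>S. \<forall>y\<in>S. x \<noteq> y \<longrightarrow> norm (G' x - G' y) / norm (x - y) powr \<gamma> \<le> C"
    by blast
qed (use der in auto)

lemma C1_holder_onE:
  assumes "C1_holder_on \<gamma> S G"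
  obtains G' C where "0 \<le> C"
    "\<forall>x\<in>S. (G has_derivative blinfun_apply (G' x)) (at x within S)"
    "continuous_on S G'"
    "\<forall>x\<in>S. \<forall>y\<in>S. norm (G' x - G' y) \<le> C * norm (x - y) powr \<gamma>"
proof -
  obtain G' C where *: "\<forall>x\<in>S. (G has_derivative blinfun_apply (G' x)) (at x within S)"
    "continuous_on S G'"
    "\<forall>x\<in>S. \<forall>y\<in>S. x \<noteq> y \<longrightarrow> norm (G' x - G' y) / norm (x - y) powr \<gamma> \<le> C"
    using assms unfolding C1_holder_on_def by blast
  have "norm (G' x - G' y) \<le> max C 0 * norm (x - y) powr \<gamma>" if "x \<in> S" "y \<in> S" for x y
  proof (cases "x = y")
    case False
    then have "norm (G' x - G' y) \<le> C * norm (x - y) powr \<gamma>"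
      using * that by (simp add: divide_le_eq)
    also have "\<dots> \<le> max C 0 * norm (x - y) powr \<gamma>"
      by (intro mult_right_mono) auto
    finally show ?thesis .
  qed auto
  with * show ?thesis
    by (intro that[of "max C 0" G']) auto
qed

lemma C1_holder_on_imp_C1_on: "C1_holder_on \<gamma> S G \<Longrightarrow> C1_on S G"
  unfolding C1_on_def C1_holder_on_def by (elim exE conjE) (intro exI conjI)

lemma C1_holder_on_subset:
  assumes "C1_holder_on \<gamma> S G" "T \<subseteq> S"
  shows "C1_holder_on \<gamma> T G"
proof -
  obtain G' C where G': "\<forall>x\<in>S. (G has_derivative blinfun_apply (G' x)) (at x within S)"
    "continuous_on S G'"
    "\<forall>x\<in>S. \<forall>y\<in>S. x \<noteq> y \<longrightarrow> norm (G' x - G' y) / norm (x - y) powr \<gamma> \<le> C"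
    using assms(1) unfolding C1_holder_on_def by blast
  have "(G has_derivative blinfun_apply (G' x)) (at x within T)" if "x \<in> T" for x
    using G'(1) assms(2) that by (intro has_derivative_subset[OF _ assms(2)]) auto
  moreover have "continuous_on T G'"
    using G'(2) assms(2) by (rule continuous_on_subset)
  ultimately show ?thesis
    unfolding C1_holder_on_def using G'(3) assms(2)
    by (intro exI[of _ G'] conjI exI[of _ C]) (simp_all add: subset_iff)
qed

lemma C1_holder_on_imp_continuous_on:
  assumes "C1_holder_on \<gamma> S G"
  shows "continuous_on S G"
proof -
  obtain G' where "\<forall>x\<in>S. (G has_derivative blinfun_apply (G' x)) (at x within S)"
    using assms unfolding C1_holder_on_def by blast
  then show ?thesis
    unfolding continuous_on_eq_continuous_within using has_derivative_continuous by (intro ballI) (drule bspec; blast)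
qed

lemma powr_le_powr_bounded:
  fixes d D :: real
  assumes "0 \<le> d" "d \<le> D" "0 < \<gamma>" "\<gamma> \<le> \<alpha>"
  shows "d powr \<alpha> \<le> D powr (\<alpha> - \<gamma>) * d powr \<gamma>"
proof -
  have "d powr \<alpha> = d powr (\<alpha> - \<gamma>) * d powr \<gamma>"
    by (simp flip: powr_add)
  also have "\<dots> \<le> D powr (\<alpha> - \<gamma>) * d powr \<gamma>"
    using assms by (intro mult_right_mono powr_mono2) auto
  finally show ?thesis .
qed

lemma bounded_norm_diffE:
  assumes "bounded S"
  obtains D where "0 < D" "\<forall>x\<in>S. \<forall>y\<in>S. norm (x - y) \<le> D"
proof -
  obtain b where b: "0 < b" "\<And>x. x \<in> S \<Longrightarrow> norm x \<le> b"
    using assms bounded_pos by metis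
  have "norm (x - y) \<le> b + b" if "x \<in> S" "y \<in> S" for x y
    using norm_triangle_ineq4[of x y] b(2)[OF that(1)] b(2)[OF that(2)] by linarith
  then show ?thesis using b(1) by (intro that[of "b + b"]) auto
qed

text \<open>For \<gamma> < \<alpha> the power d powr \<alpha> is at most a multiple of d powr
  \<gamma> only for bounded d, whence the bounded domain. The coordinate changes and coordinate
  functions, which have different exponents, are brought to a common one this way.\<close>

lemma C1_holder_on_exponent_mono:
  assumes f: "C1_holder_on \<alpha> S f" and "bounded S" "0 < \<gamma>" "\<gamma> \<le> \<alpha>"
  shows "C1_holder_on \<gamma> S f"
proof -
  obtain f' C where f': "0 \<le> C"
    "\<forall>x\<in>S. (f has_derivative blinfun_apply (f' x)) (at x within S)"
    "continuous_on S f'"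
    "\<forall>x\<in>S. \<forall>y\<in>S. norm (f' x - f' y) \<le> C * norm (x - y) powr \<alpha>"
    using f by (rule C1_holder_onE) (rule that)
  note f' = f'[rule_format]
  obtain D where "0 < D" and D: "\<forall>x\<in>S. \<forall>y\<in>S. norm (x - y) \<le> D"
    using \<open>bounded S\<close> by (rule bounded_norm_diffE) (rule that)
  note D = D[rule_format]
  show ?thesis
  proof (rule C1_holder_onI[OF \<open>0 < \<gamma>\<close>])
    show "x \<in> S \<Longrightarrow> (f has_derivative blinfun_apply (f' x)) (at x within S)" for x
      by (rule f'(2))
  next
    fix x y assume xy: "x \<in> S" "y \<in> S"
    have "norm (f' x - f' y) \<le> C * (D powr (\<alpha> - \<gamma>) * norm (x - y) powr \<gamma>)"
      using f'(4)[OF xy] powr_le_powr_bounded[OF norm_ge_zero D[OF xy] assms(3,4)] f'(1)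
      by (meson mult_left_mono order_trans)
    then show "norm (f' x - f' y) \<le> (C * D powr (\<alpha> - \<gamma>)) * norm (x - y) powr \<gamma>"
      by (simp add: mult.assoc)
  qed
qed

lemma holder_bounded:
  fixes F :: "'a::real_normed_vector \<Rightarrow> 'b::real_normed_vector"
  assumes "bounded S" "0 < \<gamma>"
    and hol: "\<And>x y. x \<in> S \<Longrightarrow> y \<in> S \<Longrightarrow> norm (F x - F y) \<le> C * norm (x - y) powr \<gamma>"
  obtains M where "0 < M" "\<forall>x\<in>S. norm (F x) \<le> M"
proof (cases "S = {}")
  case False
  then obtain a where a: "a \<in> S" using ex_in_conv by metis
  obtain D where "0 < D" and D: "\<forall>x\<in>S. \<forall>y\<in>S. norm (x - y) \<le> D"
    using \<open>bounded S\<close> by (rule bounded_norm_diffE) (rule that)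
  note D = D[rule_format]
  have "norm (F x) \<le> norm (F a) + \<bar>C\<bar> * D powr \<gamma> + 1" if "x \<in> S" for x
  proof -
    have "norm (F x) \<le> norm (F a) + norm (F x - F a)"
      by (metis add.commute diff_add_cancel norm_triangle_ineq)
    moreover have "norm (F x - F a) \<le> \<bar>C\<bar> * D powr \<gamma>"
    proof (rule order_trans[OF hol[OF that a]])
      show "C * norm (x - a) powr \<gamma> \<le> \<bar>C\<bar> * D powr \<gamma>"
        using D[OF that a] \<open>0 < \<gamma>\<close> by (intro mult_mono powr_mono2) auto
    qed
    ultimately show ?thesis by simp
  qed
  moreover have "0 < norm (F a) + \<bar>C\<bar> * D powr \<gamma> + 1"
    by (simp add: add_nonneg_pos)
  ultimately show ?thesis using that by blast
qed (use that[of 1] in auto)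

lemma blinfun_derivative_lipschitz:
  assumes "convex S"
    and "\<And>x. x \<in> S \<Longrightarrow> (f has_derivative blinfun_apply (f' x)) (at x within S)"
    and "\<And>x. x \<in> S \<Longrightarrow> norm (f' x) \<le> M"
    and "x \<in> S" "y \<in> S"
  shows "norm (f x - f y) \<le> M * norm (x - y)"
  using assms differentiable_bound[of S f "\<lambda>x. blinfun_apply (f' x)" M]
  by (simp add: norm_blinfun.rep_eq)

text \<open>On a bounded convex set \<open>f\<close> has bounded derivative and is Lipschitz, so
  inserting \<open>f\<close> into \<open>g'\<close> keeps the exponent. Boundedness of both
  derivatives then handles the product in the chain rule.\<close>

lemma C1_holder_on_compose:
  assumes f: "C1_holder_on \<gamma> S f" and g: "C1_holder_on \<gamma> T g" and fST: "\<And>x. x \<in> S \<Longrightarrow> f x \<in> T"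
    and S: "convex S" "bounded S" and "0 < \<gamma>"
  shows "C1_holder_on \<gamma> S (\<lambda>x. g (f x))"
proof -
  obtain f' C where f': "0 \<le> C"
    "\<forall>x\<in>S. (f has_derivative blinfun_apply (f' x)) (at x within S)"
    "continuous_on S f'"
    "\<forall>x\<in>S. \<forall>y\<in>S. norm (f' x - f' y) \<le> C * norm (x - y) powr \<gamma>"
    using f by (rule C1_holder_onE) (rule that)
  note f' = f'[rule_format]
  obtain g' D where g': "0 \<le> D"
    "\<forall>x\<in>T. (g has_derivative blinfun_apply (g' x)) (at x within T)"
    "continuous_on T g'"
    "\<forall>x\<in>T. \<forall>y\<in>T. norm (g' x - g' y) \<le> D * norm (x - y) powr \<gamma>"
    using g by (rule C1_holder_onE) (rule that)
  note g' = g'[rule_format]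
  obtain M where M: "0 < M" "\<forall>x\<in>S. norm (f' x) \<le> M"
    by (rule holder_bounded[OF S(2) \<open>0 < \<gamma>\<close> f'(4)])
  note M = M[rule_format]
  have lip: "norm (f x - f y) \<le> M * norm (x - y)" if "x \<in> S" "y \<in> S" for x y
    using blinfun_derivative_lipschitz[OF S(1) f'(2) M(2)] that by blast
  have hol: "norm (g' (f x) - g' (f y)) \<le> (D * M powr \<gamma>) * norm (x - y) powr \<gamma>"
    if "x \<in> S" "y \<in> S" for x y
  proof -
    have "norm (g' (f x) - g' (f y)) \<le> D * norm (f x - f y) powr \<gamma>"
      using g'(4) fST that by blast
    also have "\<dots> \<le> D * (M * norm (x - y)) powr \<gamma>"
      using lip[OF that] g'(1) \<open>0 < \<gamma>\<close> by (intro mult_left_mono powr_mono2) auto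
    also have "\<dots> = (D * M powr \<gamma>) * norm (x - y) powr \<gamma>"
      using M(1) by (simp add: powr_mult)
    finally show ?thesis .
  qed
  obtain N where N: "0 < N" "\<forall>x\<in>S. norm (g' (f x)) \<le> N"
    by (rule holder_bounded[OF S(2) \<open>0 < \<gamma>\<close> hol])
  note N = N[rule_format]
  show ?thesis
  proof (rule C1_holder_onI[OF \<open>0 < \<gamma>\<close>])
    fix x assume x: "x \<in> S"
    have "(g has_derivative blinfun_apply (g' (f x))) (at (f x) within f ` S)"
      using g'(2)[OF fST[OF x]] fST by (auto intro: has_derivative_subset)
    from has_derivative_in_compose[OF f'(2)[OF x] this]
    show "((\<lambda>x. g (f x)) has_derivative blinfun_apply (g' (f x) o\<^sub>L f' x)) (at x within S)"
      by (simp add: blinfun_compose.rep_eq o_def)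
  next
    fix x y assume xy: "x \<in> S" "y \<in> S"
    have "(g' (f x) o\<^sub>L f' x) - (g' (f y) o\<^sub>L f' y)
        = ((g' (f x) - g' (f y)) o\<^sub>L f' x) + (g' (f y) o\<^sub>L (f' x - f' y))"
      by (rule blinfun_eqI) (simp add: blinfun.diff_left blinfun.diff_right blinfun.add_left)
    then have "norm ((g' (f x) o\<^sub>L f' x) - (g' (f y) o\<^sub>L f' y))
        \<le> norm (g' (f x) - g' (f y)) * norm (f' x) + norm (g' (f y)) * norm (f' x - f' y)"
      by (metis add_mono norm_blinfun_compose norm_triangle_le)
    also have "\<dots> \<le> ((D * M powr \<gamma>) * norm (x - y) powr \<gamma>) * M + N * (C * norm (x - y) powr \<gamma>)"
      using hol[OF xy] M(2)[OF xy(1)] N(2)[OF xy(2)] f'(4)[OF xy] g'(1) N(1)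
      by (intro add_mono mult_mono) auto
    finally show "norm ((g' (f x) o\<^sub>L f' x) - (g' (f y) o\<^sub>L f' y))
        \<le> (D * M powr \<gamma> * M + N * C) * norm (x - y) powr \<gamma>"
      by (simp add: algebra_simps)
  qed
qed

lemma C1_holder_on_linear:
  assumes "bounded_linear f" "0 < \<gamma>"
  shows "C1_holder_on \<gamma> S f"
proof (rule C1_holder_onI[OF \<open>0 < \<gamma>\<close>, where G'="\<lambda>_. Blinfun f" and C=0])
  show "(f has_derivative blinfun_apply (Blinfun f)) (at x within S)" for x
    using assms(1) by (simp add: bounded_linear_Blinfun_apply bounded_linear_imp_has_derivative)
qed auto

lemma C1_holder_on_Pair:
  assumes f: "C1_holder_on \<gamma> S f" and g: "C1_holder_on \<gamma> S g" and "0 < \<gamma>"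
  shows "C1_holder_on \<gamma> S (\<lambda>x. (f x, g x))"
proof -
  obtain f' C where f': "0 \<le> C"
    "\<forall>x\<in>S. (f has_derivative blinfun_apply (f' x)) (at x within S)"
    "continuous_on S f'"
    "\<forall>x\<in>S. \<forall>y\<in>S. norm (f' x - f' y) \<le> C * norm (x - y) powr \<gamma>"
    using f by (rule C1_holder_onE) (rule that)
  note f' = f'[rule_format]
  obtain g' D where g': "0 \<le> D"
    "\<forall>x\<in>S. (g has_derivative blinfun_apply (g' x)) (at x within S)"
    "continuous_on S g'"
    "\<forall>x\<in>S. \<forall>y\<in>S. norm (g' x - g' y) \<le> D * norm (x - y) powr \<gamma>"
    using g by (rule C1_holder_onE) (rule that)
  note g' = g'[rule_format]
  define P where "P x = Blinfun (\<lambda>v. (f' x v, g' x v))" for x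
  have P: "blinfun_apply (P x) = (\<lambda>v. (f' x v, g' x v))" for x
    unfolding P_def by (intro bounded_linear_Blinfun_apply bounded_linear_Pair blinfun.bounded_linear_right)
  show ?thesis
  proof (rule C1_holder_onI[OF \<open>0 < \<gamma>\<close>])
    show "((\<lambda>x. (f x, g x)) has_derivative blinfun_apply (P x)) (at x within S)" if "x \<in> S" for x
      unfolding P by (intro has_derivative_Pair f' g' that)
    fix x y assume xy: "x \<in> S" "y \<in> S"
    have "norm (P x - P y) \<le> norm (f' x - f' y) + norm (g' x - g' y)"
    proof (rule norm_blinfun_bound)
      fix v
      have "norm ((P x - P y) v) \<le> norm ((f' x - f' y) v) + norm ((g' x - g' y) v)"
        by (simp add: P blinfun.bilinear_simps norm_Pair_le)
      also have "\<dots> \<le> norm (f' x - f' y) * norm v + norm (g' x - g' y) * norm v"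
        by (intro add_mono norm_blinfun)
      finally show "norm ((P x - P y) v) \<le> (norm (f' x - f' y) + norm (g' x - g' y)) * norm v"
        by (simp add: algebra_simps)
    qed auto
    also have "\<dots> \<le> (C + D) * norm (x - y) powr \<gamma>"
      using f'(4)[OF xy] g'(4)[OF xy] by (simp add: algebra_simps)
    finally show "norm (P x - P y) \<le> (C + D) * norm (x - y) powr \<gamma>" .
  qed
qed

lemma C1_holder_on_linear_compose:
  assumes "bounded_linear g" "C1_holder_on \<gamma> S f" "convex S" "bounded S" "0 < \<gamma>"
  shows "C1_holder_on \<gamma> S (\<lambda>x. g (f x))"
  using C1_holder_on_compose[OF assms(2) C1_holder_on_linear[OF assms(1,5), of UNIV]] assms by simp

lemma C1_holder_on_diff:
  assumes "C1_holder_on \<gamma> S f" "C1_holder_on \<gamma> S g" "convex S" "bounded S" "0 < \<gamma>"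
  shows "C1_holder_on \<gamma> S (\<lambda>x. f x - g x)"
  using C1_holder_on_linear_compose[OF _ C1_holder_on_Pair[OF assms(1,2,5)] assms(3-5),
      of "\<lambda>p. fst p - snd p"]
  by (simp add: bounded_linear_sub bounded_linear_fst bounded_linear_snd)

text \<open>The derivative family in \<open>C1_holder_on\<close> is an existential witness. At an
  interior point it is forced, so a derivative known at \<open>a\<close> can be identified with
  it.\<close>

lemma C1_holder_onE_at:
  assumes "C1_holder_on \<gamma> S f" "(f has_derivative D) (at a)" "a \<in> interior S"
  obtains f' C where "0 \<le> C"
    "\<forall>x\<in>S. (f has_derivative blinfun_apply (f' x)) (at x within S)"
    "continuous_on S f'"
    "\<forall>x\<in>S. \<forall>y\<in>S. norm (f' x - f' y) \<le> C * norm (x - y) powr \<gamma>"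
    "blinfun_apply (f' a) = D"
proof -
  obtain f' C where f': "0 \<le> C"
    "\<forall>x\<in>S. (f has_derivative blinfun_apply (f' x)) (at x within S)"
    "continuous_on S f'"
    "\<forall>x\<in>S. \<forall>y\<in>S. norm (f' x - f' y) \<le> C * norm (x - y) powr \<gamma>"
    using assms(1) by (rule C1_holder_onE) (rule that)
  note f' = f'[rule_format]
  have "(f has_derivative blinfun_apply (f' a)) (at a)"
    using f'(2)[of a] assms(3) interior_subset[of S] at_within_interior[OF assms(3)] by auto
  then have "blinfun_apply (f' a) = D"
    using assms(2) has_derivative_unique by blast
  then show ?thesis using f' by (intro that[of C f']) auto
qed

text \<open>The lower bound makes \<open>D\<close> injective, hence invertible in finite dimension;
  applied to values of the inverse it bounds the inverse by the same \<open>c\<close>.\<close>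

lemma linear_lower_bound_inverse:
  fixes D :: "'a::euclidean_space \<Rightarrow>\<^sub>L 'a"
  assumes "0 < c" and low: "\<And>v. norm v \<le> c * norm (D v)"
  obtains E :: "'a \<Rightarrow>\<^sub>L 'a" where "E o\<^sub>L D = id_blinfun" "D o\<^sub>L E = id_blinfun" "norm E \<le> c"
proof -
  have lin: "linear (blinfun_apply D)"
    by (simp add: blinfun.bounded_linear_right bounded_linear.linear)
  have inj: "inj (blinfun_apply D)"
  proof (rule injI)
    fix x y assume "D x = D y"
    then have "norm (x - y) \<le> 0" using low[of "x - y"] by (simp add: blinfun.diff_right)
    then show "x = y" by simp
  qed
  obtain g where g: "linear g" "g \<circ> blinfun_apply D = id"
    using linear_injective_left_inverse[OF lin inj] by blast
  have g2: "blinfun_apply D \<circ> g = id"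
    using linear_inverse_left[OF lin g(1)] g(2) by blast
  have blg: "blinfun_apply (Blinfun g) = g"
    using g(1) by (simp add: bounded_linear_Blinfun_apply linear_conv_bounded_linear)
  show ?thesis
  proof (rule that[of "Blinfun g"])
    show "Blinfun g o\<^sub>L D = id_blinfun" "D o\<^sub>L Blinfun g = id_blinfun"
      using g(2) g2 by (auto intro!: blinfun_eqI simp: blg pointfree_idE)
    show "norm (Blinfun g) \<le> c"
    proof (rule norm_blinfun_bound)
      show "norm (Blinfun g v) \<le> c * norm v" for v
        using low[of "g v"] g2 by (simp add: blg pointfree_idE)
    qed (use \<open>0 < c\<close> in auto)
  qed
qed

section \<open>The inverse function theorem in the class C^{1,gamma}\<close>

text \<open>Where \<open>f'\<close> stays close to its value at 0, \<open>f\<close> is bi-Lipschitz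
  and its derivatives have uniformly bounded inverses. The inverse map is differentiated directly
  within the whole image of the closed ball, boundary points included;
  \<open>inverse_function_theorem\<close> contributes the neighbourhood of 0 inside that
  image.\<close>

theorem C1_holder_inverse:
  fixes f :: "'a::euclidean_space \<Rightarrow> 'a"
  assumes "0 < r" "0 < \<gamma>" and f: "C1_holder_on \<gamma> (cball 0 r) f" and f0: "f 0 = 0"
    and D: "(f has_derivative D) (at 0)" and E: "bounded_linear E" and ED: "\<And>v. E (D v) = v"
  obtains s t where "0 < s" "s \<le> r" "inj_on f (cball 0 s)"
    "C1_holder_on \<gamma> (f ` cball 0 s) (inv_into (cball 0 s) f)"
    "0 < t" "cball 0 t \<subseteq> f ` cball 0 s"
    "(inv_into (cball 0 s) f has_derivative E) (at 0)"
proof -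
  have "0 \<in> interior (cball 0 r :: 'a set)" using \<open>0 < r\<close> by simp
  then obtain f' C where f': "0 \<le> C"
    "\<forall>x\<in>cball 0 r. (f has_derivative blinfun_apply (f' x)) (at x within cball 0 r)"
    "continuous_on (cball 0 r) f'"
    "\<forall>x\<in>cball 0 r. \<forall>y\<in>cball 0 r. norm (f' x - f' y) \<le> C * norm (x - y) powr \<gamma>"
    "blinfun_apply (f' 0) = D"
    using C1_holder_onE_at[OF f D] by metis
  note f' = f'[rule_format]
  obtain N where N: "0 < N" "\<And>v. norm v \<le> N * norm (D v)"
  proof -
    obtain K where "0 < K" "\<And>x. norm (E x) \<le> norm x * K"
      using bounded_linear.pos_bounded[OF E] by blast
    then show ?thesis using that[of K] ED by (metis mult.commute)
  qed
  \<comment> \<open>Chosen so that \<open>N * e = 1/2\<close>: a perturbation of norm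
    \<open>e\<close> costs half of the lower bound for \<open>D\<close> and leaves the constant
    \<open>2 * N\<close>.\<close>
  define e where "e = 1 / (2 * N)"
  have e: "0 < e" unfolding e_def using N(1) by simp
  obtain s0 where s0: "0 < s0" "\<And>x. norm x \<le> r \<Longrightarrow> norm x < s0 \<Longrightarrow> norm (f' x - f' 0) \<le> e"
  proof -
    have "(0::'a) \<in> cball 0 r" using \<open>0 < r\<close> by simp
    from f'(3)[unfolded continuous_on_iff, rule_format, OF this e]
    obtain d where "d > 0" "\<forall>x'\<in>cball 0 r. dist x' 0 < d \<longrightarrow> dist (f' x') (f' 0) < e" by blast
    then show ?thesis using that[of d] by (auto simp: dist_norm less_imp_le)
  qed
  define s where "s = min r (s0 / 2)"
  have s: "0 < s" "s \<le> r" "s < s0" using s0(1) \<open>0 < r\<close> by (auto simp: s_def)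
  define U where "U = cball (0::'a) s"
  have Ur: "x \<in> U \<Longrightarrow> x \<in> cball 0 r" for x using s by (auto simp: U_def)
  have near: "norm (f' x - f' 0) \<le> e" if "x \<in> U" for x
    using s0(2)[of x] s that by (auto simp: U_def)
  have der: "(f has_derivative blinfun_apply (f' x)) (at x within U)" if "x \<in> U" for x
    using Ur by (intro has_derivative_subset[OF f'(2)[OF Ur[OF that]]]) blast
  have low: "norm v \<le> (2 * N) * norm (f' x v)" if "x \<in> U" for x v
  proof -
    have "norm (f' 0 v) \<le> norm (f' x v) + norm ((f' x - f' 0) v)"
      by (metis blinfun.diff_left norm_triangle_sub norm_minus_commute)
    also have "norm ((f' x - f' 0) v) \<le> e * norm v"
      using near[OF that] norm_blinfun[of "f' x - f' 0" v] mult_right_mono[OF _ norm_ge_zero]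
      by (meson order_trans)
    finally have "N * norm (D v) \<le> N * (norm (f' x v) + e * norm v)"
      using N(1) f'(5) by (simp add: mult_left_mono)
    then have "norm v \<le> N * norm (f' x v) + N * e * norm v"
      using N(2)[of v] by (simp add: algebra_simps)
    moreover have "N * e = 1/2" unfolding e_def using N(1) by simp
    ultimately show ?thesis by simp
  qed
  have lower: "norm (x - y) \<le> 2 * N * norm (f x - f y)" if "x \<in> U" "y \<in> U" for x y
  proof -
    have "norm ((f x - D x) - (f y - D y)) \<le> e * norm (x - y)"
    proof (rule blinfun_derivative_lipschitz[of U _ "\<lambda>x. f' x - f' 0"])
      show "((\<lambda>x. f x - D x) has_derivative blinfun_apply (f' x - f' 0)) (at x within U)"
        if "x \<in> U" for x
        unfolding blinfun.diff_left minus_blinfun.rep_eq f'(5)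
        by (intro has_derivative_diff der that bounded_linear_imp_has_derivative
            has_derivative_bounded_linear[OF D])
    qed (use that near in \<open>auto simp: U_def\<close>)
    moreover have "D x - D y = D (x - y)"
      using has_derivative_bounded_linear[OF D] by (simp add: bounded_linear.linear linear_diff)
    ultimately have "norm (D (x - y)) \<le> norm (f x - f y) + e * norm (x - y)"
      using norm_triangle_ineq4[of "f x - f y" "(f x - D x) - (f y - D y)"] by (simp add: algebra_simps)
    then have "N * norm (D (x - y)) \<le> N * (norm (f x - f y) + e * norm (x - y))"
      using N(1) by (simp add: mult_left_mono)
    moreover have "N * e = 1/2" unfolding e_def using N(1) by simp
    ultimately show ?thesis using N(2)[of "x - y"] by (simp add: distrib_left mult.assoc[symmetric])
  qed
  have inj: "inj_on f U"
  proof (rule inj_onI)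
    fix x y assume "x \<in> U" "y \<in> U" "f x = f y"
    then have "norm (x - y) \<le> 0" using lower[of x y] by simp
    then show "x = y" by simp
  qed
  define g where "g = inv_into U f"
  have gf: "g (f x) = x" if "x \<in> U" for x using that inj by (simp add: g_def)
  have "\<exists>X. X o\<^sub>L f' x = id_blinfun \<and> f' x o\<^sub>L X = id_blinfun \<and> norm X \<le> 2 * N" if "x \<in> U" for x
    using linear_lower_bound_inverse[of "2 * N" "f' x"] low[OF that] N(1) by auto
  then obtain X where X: "\<And>x. x \<in> U \<Longrightarrow> X x o\<^sub>L f' x = id_blinfun"
    "\<And>x. x \<in> U \<Longrightarrow> f' x o\<^sub>L X x = id_blinfun" "\<And>x. x \<in> U \<Longrightarrow> norm (X x) \<le> 2 * N"
    by metis
  have X1: "X x (f' x v) = v" if "x \<in> U" for x v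
    using X(1)[OF that] by (metis blinfun_apply_blinfun_compose blinfun_apply_id_blinfun id_apply)
  have gder: "(g has_derivative blinfun_apply (X (g y))) (at y within f ` U)" if y: "y \<in> f ` U" for y
  proof -
    obtain x where x: "x \<in> U" "y = f x" using y by blast
    show ?thesis
      unfolding has_derivative_within_alt
    proof (intro conjI allI impI)
      show "bounded_linear (blinfun_apply (X (g y)))" by (rule blinfun.bounded_linear_right)
      fix \<epsilon> :: real assume "0 < \<epsilon>"
      then have "0 < \<epsilon> / (2 * N * (2 * N))" using N(1) by simp
      with der[OF x(1)] obtain d where d: "0 < d"
        "\<And>w. w \<in> U \<Longrightarrow> norm (w - x) < d \<Longrightarrow>
          norm (f w - f x - f' x (w - x)) \<le> \<epsilon> / (2 * N * (2 * N)) * norm (w - x)"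
        unfolding has_derivative_within_alt by meson
      have "norm (g z - g y - X (g y) (z - y)) \<le> \<epsilon> * norm (z - y)"
        if z: "z \<in> f ` U" "norm (z - y) < d / (2 * N)" for z
      proof -
        obtain w where w: "w \<in> U" "z = f w" using z by blast
        have l: "norm (w - x) \<le> 2 * N * norm (z - y)" using lower[OF w(1) x(1)] w x by simp
        also have "\<dots> < d" using z(2) N(1) by (simp add: field_simps)
        finally have wd: "norm (w - x) < d" .
        \<comment> \<open>The remainder of \<open>g\<close> at \<open>y\<close> is the image under
          \<open>- X x\<close> of the remainder of \<open>f\<close> at \<open>x\<close>.\<close>
        have "g z - g y - X (g y) (z - y) = - X x (f w - f x - f' x (w - x))"
          using w x by (simp add: gf blinfun.diff_right X1)
        then have "norm (g z - g y - X (g y) (z - y)) \<le> norm (X x) * norm (f w - f x - f' x (w - x))"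
          using norm_blinfun[of "X x" "f w - f x - f' x (w - x)"] by simp
        also have "\<dots> \<le> (2 * N) * (\<epsilon> / (2 * N * (2 * N)) * norm (w - x))"
          using X(3)[OF x(1)] d(2)[OF w(1) wd] N(1) by (intro mult_mono) auto
        also have "\<dots> \<le> (2 * N) * (\<epsilon> / (2 * N * (2 * N)) * (2 * N * norm (z - y)))"
          using l N(1) \<open>0 < \<epsilon>\<close> by (intro mult_left_mono) auto
        also have "\<dots> = \<epsilon> * norm (z - y)" using N(1) by (simp add: field_simps)
        finally show ?thesis .
      qed
      then show "\<exists>d>0. \<forall>z\<in>f ` U. norm (z - y) < d \<longrightarrow> norm (g z - g y - X (g y) (z - y)) \<le> \<epsilon> * norm (z - y)"
        using d(1) N(1) by (intro exI[of _ "d / (2 * N)"]) auto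
    qed
  qed
  have ghol: "C1_holder_on \<gamma> (f ` U) g"
  proof (rule C1_holder_onI[OF \<open>0 < \<gamma>\<close> gder])
    fix y z assume yz: "y \<in> f ` U" "z \<in> f ` U"
    then obtain x w where x: "x \<in> U" "y = f x" and w: "w \<in> U" "z = f w" by blast
    \<comment> \<open>Resolvent identity: it carries the Hoelder bound of \<open>f'\<close> over to
      the inverse derivatives.\<close>
    have "X x - X w = X x o\<^sub>L (f' w - f' x) o\<^sub>L X w"
    proof (rule blinfun_eqI)
      fix v
      have "f' w (X w v) = v" using X(2)[OF w(1)]
        by (metis blinfun_apply_blinfun_compose blinfun_apply_id_blinfun id_apply)
      then show "(X x - X w) v = (X x o\<^sub>L (f' w - f' x) o\<^sub>L X w) v"
        by (simp add: blinfun.diff_left blinfun.diff_right X1 x w)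
    qed
    then have "norm (X x - X w) \<le> norm (X x) * norm (f' w - f' x) * norm (X w)"
      using norm_blinfun_compose[of "X x o\<^sub>L (f' w - f' x)" "X w"] norm_blinfun_compose[of "X x" "f' w - f' x"]
      by (smt (verit) mult_right_mono norm_ge_zero)
    also have "\<dots> \<le> (2 * N) * (C * norm (w - x) powr \<gamma>) * (2 * N)"
      using X(3) x w f'(4)[OF Ur Ur, OF w(1) x(1)] N(1) f'(1)
      by (intro mult_mono mult_nonneg_nonneg) auto
    also have "\<dots> \<le> (2 * N) * (C * (2 * N * norm (y - z)) powr \<gamma>) * (2 * N)"
    proof -
      have "norm (w - x) \<le> 2 * N * norm (y - z)" using lower[OF x(1) w(1)] x w
        by (simp add: norm_minus_commute)
      then show ?thesis using N(1) f'(1) \<open>0 < \<gamma>\<close>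
        by (intro mult_left_mono mult_right_mono powr_mono2) auto
    qed
    also have "\<dots> = (4 * N^2 * C * (2 * N) powr \<gamma>) * norm (y - z) powr \<gamma>"
      using N(1) by (simp add: powr_mult power2_eq_square)
    finally show "norm (X (g y) - X (g z)) \<le> (4 * N^2 * C * (2 * N) powr \<gamma>) * norm (y - z) powr \<gamma>"
      using x w by (simp add: gf)
  qed
  obtain E' where E': "E' o\<^sub>L f' 0 = id_blinfun"
  proof
    show "Blinfun E o\<^sub>L f' 0 = id_blinfun"
      by (rule blinfun_eqI) (simp add: bounded_linear_Blinfun_apply[OF E] f'(5) ED)
  qed
  have der_in: "(f has_derivative blinfun_apply (f' x)) (at x)" if "x \<in> ball 0 s" for x
    using der[of x] that at_within_interior[of x U] by (auto simp: U_def)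
  have cont_in: "continuous_on (ball 0 s) f'"
    using f'(3) s by (rule_tac continuous_on_subset) auto
  obtain V U' g0 where V: "open V" "0 \<in> V" "U' \<subseteq> ball 0 s" "homeomorphism U' V f g0"
    using inverse_function_theorem[OF open_ball der_in cont_in _ E'] s(1) f0 by (metis centre_in_ball)
  have VU: "V \<subseteq> f ` U"
    using V(3,4) unfolding homeomorphism_def U_def by (metis ball_subset_cball image_mono order_trans)
  obtain t where t: "0 < t" "cball 0 t \<subseteq> V" using V(1,2) open_contains_cball by blast
  have "0 \<in> interior (f ` U)" using V(1,2) VU interior_maximal by blast
  then have "(g has_derivative blinfun_apply (X (g 0))) (at 0)"
    using gder[of 0] interior_subset at_within_interior by (metis subsetD)
  moreover have "g 0 = 0" using gf[of 0] f0 s(1) by (simp add: U_def)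
  moreover have "blinfun_apply (X 0) = E"
  proof
    fix v
    have "v = D (X 0 v)" using X(2)[of 0] s(1) f'(5)
      by (metis U_def blinfun_apply_blinfun_compose blinfun_apply_id_blinfun centre_in_cball id_apply less_imp_le)
    then show "X 0 v = E v" by (metis ED)
  qed
  ultimately show ?thesis
    using that[of s t] s t VU inj ghol by (auto simp: U_def g_def)
qed

lemma has_field_derivative_holder_remainder:
  fixes h :: "real \<Rightarrow> real"
  assumes "0 < \<alpha>" and rem: "\<And>z. \<bar>h z - h y - d * (z - y)\<bar> \<le> K * \<bar>z - y\<bar> powr \<alpha> * \<bar>z - y\<bar>"
  shows "(h has_field_derivative d) (at y)"
  unfolding has_field_derivative_iff
proof (rule LIM_zero_cancel, rule Lim_null_comparison)
  show "\<forall>\<^sub>F z in at y. norm ((h z - h y) / (z - y) - d) \<le> K * \<bar>z - y\<bar> powr \<alpha>"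
  proof (unfold eventually_at_filter, intro always_eventually allI impI)
    fix z assume z: "z \<noteq> y"
    then have "(h z - h y) / (z - y) - d = (h z - h y - d * (z - y)) / (z - y)"
      by (simp add: diff_divide_distrib)
    then have "\<bar>(h z - h y) / (z - y) - d\<bar> \<le> (K * \<bar>z - y\<bar> powr \<alpha> * \<bar>z - y\<bar>) / \<bar>z - y\<bar>"
      using divide_right_mono[OF rem[of z], of "\<bar>z - y\<bar>"] by simp
    then show "norm ((h z - h y) / (z - y) - d) \<le> K * \<bar>z - y\<bar> powr \<alpha>"
      using z by simp
  qed
  have "((\<lambda>z. K * \<bar>z - y\<bar> powr \<alpha>) \<longlongrightarrow> K * 0) (at y)"
    by (intro tendsto_mult_left tendsto_zero_powrI[where b=\<alpha>] tendsto_const assms(1))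
      (auto intro!: tendsto_eq_intros)
  then show "((\<lambda>z. K * \<bar>z - y\<bar> powr \<alpha>) \<longlongrightarrow> 0) (at y)" by simp
qed

section \<open>Iterated pull-back of the expanding coordinate\<close>

text \<open>The increments are dominated by a geometric series. The explicit rate is kept because it
  makes the convergence of slopes and of logarithms uniform in the base point.\<close>

lemma geometric_increments_limit:
  fixes f :: "nat \<Rightarrow> real"
  assumes inc: "\<And>n. \<bar>f (Suc n) - f n\<bar> \<le> M * \<theta> ^ n" and \<theta>: "0 \<le> \<theta>" "\<theta> < 1"
  obtains l where "f \<longlonglongrightarrow> l" "\<And>n. \<bar>f n - l\<bar> \<le> M / (1 - \<theta>) * \<theta> ^ n"
proof -
  have M: "0 \<le> M" using inc[of 0] by simp
  have fin: "\<bar>f (n + k) - f n\<bar> \<le> M / (1 - \<theta>) * \<theta> ^ n * (1 - \<theta> ^ k)" for n k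
  proof (induction k)
    case (Suc k)
    have "\<bar>f (n + Suc k) - f n\<bar> \<le> \<bar>f (Suc (n + k)) - f (n + k)\<bar> + \<bar>f (n + k) - f n\<bar>" by simp
    also have "\<dots> \<le> M * \<theta> ^ (n + k) + M / (1 - \<theta>) * \<theta> ^ n * (1 - \<theta> ^ k)"
      using inc[of "n + k"] Suc by linarith
    also have "\<dots> = M / (1 - \<theta>) * \<theta> ^ n * (1 - \<theta> ^ Suc k)"
      using \<theta> by (simp add: field_simps power_add)
    finally show ?case .
  qed simp
  have "summable (\<lambda>n. f (Suc n) - f n)"
    by (rule summable_comparison_test'[where g="\<lambda>n. M * \<theta> ^ n" and N=0])
      (use inc \<theta> in \<open>auto intro!: summable_mult summable_geometric\<close>)
  then have "(\<lambda>n. \<Sum>i<n. f (Suc i) - f i) \<longlonglongrightarrow> (\<Sum>i. f (Suc i) - f i)"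
    by (rule summable_LIMSEQ)
  then have "(\<lambda>n. (f n - f 0) + f 0) \<longlonglongrightarrow> (\<Sum>i. f (Suc i) - f i) + f 0"
    unfolding sum_lessThan_telescope by (intro tendsto_add tendsto_const)
  then obtain l where l: "f \<longlonglongrightarrow> l" by auto
  have "\<bar>f n - l\<bar> \<le> M / (1 - \<theta>) * \<theta> ^ n" for n
  proof (rule LIMSEQ_le_const2)
    show "(\<lambda>k. \<bar>f n - f (k + n)\<bar>) \<longlonglongrightarrow> \<bar>f n - l\<bar>"
      by (intro tendsto_intros LIMSEQ_ignore_initial_segment l)
    have "\<bar>f n - f (k + n)\<bar> \<le> M / (1 - \<theta>) * \<theta> ^ n" for k
    proof -
      have "\<bar>f n - f (k + n)\<bar> \<le> M / (1 - \<theta>) * \<theta> ^ n * (1 - \<theta> ^ k)"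
        using fin[of n k] by (simp add: add.commute abs_minus_commute)
      also have "\<dots> \<le> M / (1 - \<theta>) * \<theta> ^ n * 1"
        using M \<theta> by (intro mult_left_mono) auto
      finally show ?thesis by simp
    qed
    then show "\<exists>N. \<forall>k\<ge>N. \<bar>f n - f (k + n)\<bar> \<le> M / (1 - \<theta>) * \<theta> ^ n" by blast
  qed
  with l show ?thesis by (rule that)
qed

section \<open>Planar maps near a hyperbolic diagonal matrix\<close>

type_synonym plane = "real \<times> real"

definition diag_blinfun :: "real \<Rightarrow> real \<Rightarrow> plane \<Rightarrow>\<^sub>L plane" where
  "diag_blinfun a b = Blinfun (\<lambda>v. (a * fst v, b * snd v))"

lemma diag_blinfun_apply [simp]: "diag_blinfun a b v = (a * fst v, b * snd v)"
  unfolding diag_blinfun_def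
  by (subst bounded_linear_Blinfun_apply)
    (auto intro!: bounded_linear_Pair bounded_linear_const_mult bounded_linear_fst bounded_linear_snd)

lemma norm_diag_blinfun_le: "\<bar>b\<bar> \<le> \<bar>a\<bar> \<Longrightarrow> norm (diag_blinfun a b) \<le> \<bar>a\<bar>"
proof (rule norm_blinfun_bound)
  fix v :: plane assume ba: "\<bar>b\<bar> \<le> \<bar>a\<bar>"
  have "norm (diag_blinfun a b v) = sqrt ((a * fst v)\<^sup>2 + (b * snd v)\<^sup>2)"
    by (simp add: norm_Pair)
  also have "\<dots> \<le> sqrt (a\<^sup>2 * ((fst v)\<^sup>2 + (snd v)\<^sup>2))"
    using ba by (auto simp: power_mult_distrib distrib_left abs_le_square_iff intro!: mult_right_mono)
  also have "\<dots> = \<bar>a\<bar> * norm v"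
    by (simp add: real_sqrt_mult norm_prod_def)
  finally show "norm (diag_blinfun a b v) \<le> \<bar>a\<bar> * norm v" .
qed simp

lemma abs_fst_le_norm: "\<bar>fst (p :: plane)\<bar> \<le> norm p"
  and abs_snd_le_norm: "\<bar>snd (p :: plane)\<bar> \<le> norm p"
  by (metis norm_fst_le prod.collapse real_norm_def) (metis norm_snd_le prod.collapse real_norm_def)

lemma norm_le_abs_fst_snd: "norm (p :: plane) \<le> \<bar>fst p\<bar> + \<bar>snd p\<bar>"
  by (metis norm_Pair_le prod.collapse real_norm_def)

text \<open>The bounds on \<epsilon> keep slopes in [-1, 1] (numerators at most 1, denominators at
  least 1) and the denominators divided by \<open>A\<close> at least 1/2. In the last condition on
  \<theta> the left side bounds the determinant of \<open>H'\<close> and the squared term bounds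
  products of denominators from below, so slopes contract by \<theta>. The condition
  \<open>\<theta> * (\<bar>A\<bar> + \<epsilon>) < 1\<close> lets this contraction beat the growth
  of distances under \<open>H\<close>.\<close>

locale planar_hyperbolic =
  fixes A B \<alpha> \<epsilon> C \<theta> :: real
    and H :: "plane \<Rightarrow> plane"
    and H' :: "plane \<Rightarrow> plane \<Rightarrow>\<^sub>L plane"
  assumes A: "1 < \<bar>A\<bar>" and B: "0 < \<bar>B\<bar>" "\<bar>B\<bar> < 1" and alpha: "0 < \<alpha>" "\<alpha> \<le> 1"
    and eps: "0 < \<epsilon>" "4 * \<epsilon> \<le> \<bar>A\<bar> - 1" "\<bar>B\<bar> + 4 * \<epsilon> \<le> 1"
    and theta: "0 < \<theta>" "\<theta> * (\<bar>A\<bar> + \<epsilon>) < 1"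
      "(\<bar>A\<bar> + \<epsilon>) * (\<bar>B\<bar> + \<epsilon>) + \<epsilon>\<^sup>2 \<le> \<theta> * (\<bar>A\<bar> - 2 * \<epsilon>)\<^sup>2"
    and C: "0 \<le> C"
    and der: "\<And>p. (H has_derivative blinfun_apply (H' p)) (at p)"
    and near: "\<And>p. norm (H' p - diag_blinfun A B) \<le> \<epsilon>"
    and hol: "\<And>p q. norm (H' p - H' q) \<le> C * norm (p - q) powr \<alpha>"
    and zero: "H 0 = 0" "H' 0 = diag_blinfun A B"
begin

definition "p11 p = fst (H' p (1, 0))"
definition "p12 p = fst (H' p (0, 1))"
definition "p21 p = snd (H' p (1, 0))"
definition "p22 p = snd (H' p (0, 1))"

lemma H'_apply: "H' p v = (p11 p * fst v + p12 p * snd v, p21 p * fst v + p22 p * snd v)"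
proof -
  have "v = fst v *\<^sub>R (1, 0) + snd v *\<^sub>R (0, 1)" by (simp add: prod_eq_iff)
  then have "H' p v = fst v *\<^sub>R H' p (1, 0) + snd v *\<^sub>R H' p (0, 1)"
    by (metis blinfun.add_right blinfun.scaleR_right)
  then show ?thesis by (simp add: prod_eq_iff p11_def p12_def p21_def p22_def)
qed

lemma entries_le_norm:
  fixes X :: "plane \<Rightarrow>\<^sub>L plane"
  shows "\<bar>fst (X (1, 0))\<bar> \<le> norm X" "\<bar>fst (X (0, 1))\<bar> \<le> norm X"
    "\<bar>snd (X (1, 0))\<bar> \<le> norm X" "\<bar>snd (X (0, 1))\<bar> \<le> norm X"
proof -
  have 1: "norm (X (1, 0)) \<le> norm X" "norm (X (0, 1)) \<le> norm X"
    using norm_blinfun[of X "(1, 0)"] norm_blinfun[of X "(0, 1)"] by (simp_all add: norm_Pair)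
  show "\<bar>fst (X (1, 0))\<bar> \<le> norm X" "\<bar>fst (X (0, 1))\<bar> \<le> norm X"
    "\<bar>snd (X (1, 0))\<bar> \<le> norm X" "\<bar>snd (X (0, 1))\<bar> \<le> norm X"
    by (rule order_trans[OF abs_fst_le_norm 1(1)] order_trans[OF abs_fst_le_norm 1(2)]
        order_trans[OF abs_snd_le_norm 1(1)] order_trans[OF abs_snd_le_norm 1(2)])+
qed

lemma partials_near_norm:
  "\<bar>p11 p - A\<bar> \<le> norm (H' p - diag_blinfun A B)" "\<bar>p12 p\<bar> \<le> norm (H' p - diag_blinfun A B)"
  "\<bar>p21 p\<bar> \<le> norm (H' p - diag_blinfun A B)" "\<bar>p22 p - B\<bar> \<le> norm (H' p - diag_blinfun A B)"
  using entries_le_norm[of "H' p - diag_blinfun A B"]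
  by (simp_all add: p11_def p12_def p21_def p22_def blinfun.diff_left)

lemma partials_near: "\<bar>p11 p - A\<bar> \<le> \<epsilon>" "\<bar>p12 p\<bar> \<le> \<epsilon>" "\<bar>p21 p\<bar> \<le> \<epsilon>" "\<bar>p22 p - B\<bar> \<le> \<epsilon>"
  using partials_near_norm[of p] near[of p] by linarith+

lemma partials_holder:
  "\<bar>p11 p - p11 q\<bar> \<le> C * norm (p - q) powr \<alpha>" "\<bar>p12 p - p12 q\<bar> \<le> C * norm (p - q) powr \<alpha>"
  "\<bar>p21 p - p21 q\<bar> \<le> C * norm (p - q) powr \<alpha>" "\<bar>p22 p - p22 q\<bar> \<le> C * norm (p - q) powr \<alpha>"
  using entries_le_norm[of "H' p - H' q"] hol[of p q]
  by (simp_all add: p11_def p12_def p21_def p22_def blinfun.diff_left)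

lemma norm_H'_le: "norm (H' p) \<le> \<bar>A\<bar> + \<epsilon>"
  using norm_triangle_sub[of "H' p" "diag_blinfun A B"] near[of p] norm_diag_blinfun_le[of B A] A B
  by linarith

lemma H_lipschitz: "norm (H p - H q) \<le> (\<bar>A\<bar> + \<epsilon>) * norm (p - q)"
  using blinfun_derivative_lipschitz[of UNIV H H'] der norm_H'_le by simp

lemma theta_less_1: "\<theta> < 1"
  using theta A eps(1) by (smt (verit) mult_le_cancel_left1)

subsection \<open>The invariant slope field\<close>

text \<open>The row vector (1, \<beta>) times the matrix of \<open>H' p\<close> is
  \<open>slope_den p \<beta>\<close> times (1, \<open>slope p \<beta>\<close>). Thus
  \<open>slope p\<close> is the projective action of the derivative on gradients, a Moebius map of
  the slope.\<close>

definition "slope_num p \<beta> = p12 p + \<beta> * p22 p"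
definition "slope_den p \<beta> = p11 p + \<beta> * p21 p"
definition "slope p \<beta> = slope_num p \<beta> / slope_den p \<beta>"

lemma slope_num_le: "\<bar>\<beta>\<bar> \<le> 1 \<Longrightarrow> \<bar>slope_num p \<beta>\<bar> \<le> 1"
proof -
  assume b: "\<bar>\<beta>\<bar> \<le> 1"
  have "\<bar>\<beta> * p22 p\<bar> \<le> 1 * (\<bar>B\<bar> + \<epsilon>)"
    unfolding abs_mult using b partials_near(4)[of p] by (intro mult_mono) auto
  then show ?thesis unfolding slope_num_def using partials_near(2)[of p] eps by (smt (verit))
qed

lemma slope_den_near: "\<bar>\<beta>\<bar> \<le> 1 \<Longrightarrow> \<bar>slope_den p \<beta> - A\<bar> \<le> 2 * \<epsilon>"
proof -
  assume b: "\<bar>\<beta>\<bar> \<le> 1"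
  have "\<bar>\<beta> * p21 p\<bar> \<le> 1 * \<epsilon>"
    unfolding abs_mult using b partials_near(3)[of p] by (intro mult_mono) auto
  then show ?thesis unfolding slope_den_def using partials_near(1)[of p] by linarith
qed

lemma slope_den_ge: "\<bar>\<beta>\<bar> \<le> 1 \<Longrightarrow> \<bar>A\<bar> - 2 * \<epsilon> \<le> \<bar>slope_den p \<beta>\<bar>"
  using slope_den_near[of \<beta> p] by linarith

lemma slope_den_ge_1: "\<bar>\<beta>\<bar> \<le> 1 \<Longrightarrow> 1 \<le> \<bar>slope_den p \<beta>\<bar>"
  using slope_den_ge[of \<beta> p] eps by linarith

lemma slope_le: "\<bar>\<beta>\<bar> \<le> 1 \<Longrightarrow> \<bar>slope p \<beta>\<bar> \<le> 1"
  unfolding slope_def abs_divide using slope_num_le[of \<beta> p] slope_den_ge_1[of \<beta> p]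
  by (simp add: divide_le_eq)

text \<open>A difference quotient of a Moebius map is its determinant divided by the product of the
  two denominators, which the last condition on \<theta> controls.\<close>

lemma slope_contraction:
  assumes b: "\<bar>\<beta>\<bar> \<le> 1" "\<bar>\<beta>'\<bar> \<le> 1"
  shows "\<bar>slope p \<beta> - slope p \<beta>'\<bar> \<le> \<theta> * \<bar>\<beta> - \<beta>'\<bar>"
proof -
  define a where "a = \<bar>A\<bar> - 2 * \<epsilon>"
  have a: "1 \<le> a" unfolding a_def using eps by linarith
  have d: "a \<le> \<bar>slope_den p \<beta>\<bar>" "a \<le> \<bar>slope_den p \<beta>'\<bar>"
    using slope_den_ge b unfolding a_def by auto
  then have nz: "slope_den p \<beta> \<noteq> 0" "slope_den p \<beta>' \<noteq> 0" using a by auto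
  have "slope p \<beta> - slope p \<beta>'
      = (\<beta> - \<beta>') * (p11 p * p22 p - p12 p * p21 p) / (slope_den p \<beta> * slope_den p \<beta>')"
    using nz unfolding slope_def
    by (simp add: divide_simps) (simp add: slope_num_def slope_den_def algebra_simps)
  moreover have "\<bar>p11 p * p22 p - p12 p * p21 p\<bar> \<le> \<theta> * a\<^sup>2"
  proof -
    have "\<bar>p11 p * p22 p\<bar> \<le> (\<bar>A\<bar> + \<epsilon>) * (\<bar>B\<bar> + \<epsilon>)"
      unfolding abs_mult using partials_near(1,4)[of p] eps by (intro mult_mono) auto
    moreover have "\<bar>p12 p * p21 p\<bar> \<le> \<epsilon> * \<epsilon>"
      unfolding abs_mult using partials_near(2,3)[of p] eps by (intro mult_mono) auto
    ultimately show ?thesis using theta(3) unfolding a_def power2_eq_square by linarith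
  qed
  moreover have "a\<^sup>2 \<le> \<bar>slope_den p \<beta> * slope_den p \<beta>'\<bar>"
    unfolding abs_mult power2_eq_square using d a by (intro mult_mono) auto
  ultimately have "\<bar>slope p \<beta> - slope p \<beta>'\<bar> \<le> (\<bar>\<beta> - \<beta>'\<bar> * (\<theta> * a\<^sup>2)) / a\<^sup>2"
    using a theta(1) by (simp only: abs_divide abs_mult[of "\<beta> - \<beta>'"])
      (intro frac_le mult_left_mono mult_nonneg_nonneg; simp)
  then show ?thesis using a by (simp add: mult.commute)
qed

lemma slope_holder:
  assumes b: "\<bar>\<beta>\<bar> \<le> 1"
  shows "\<bar>slope p \<beta> - slope q \<beta>\<bar> \<le> 4 * C * norm (p - q) powr \<alpha>"
proof -
  define d where "d = C * norm (p - q) powr \<alpha>"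
  have d: "0 \<le> d" unfolding d_def using C by simp
  have pr: "\<bar>\<beta> * x\<bar> \<le> d" if "\<bar>x\<bar> \<le> d" for x
    unfolding abs_mult using mult_mono[OF b that] by auto
  have n: "\<bar>slope_num p \<beta> - slope_num q \<beta>\<bar> \<le> 2 * d"
    using partials_holder(2)[of p q] pr[OF partials_holder(4)[of p q, folded d_def]]
    unfolding slope_num_def d_def[symmetric] by (simp add: right_diff_distrib abs_le_iff)
  have e: "\<bar>slope_den p \<beta> - slope_den q \<beta>\<bar> \<le> 2 * d"
    using partials_holder(1)[of p q] pr[OF partials_holder(3)[of p q, folded d_def]]
    unfolding slope_den_def d_def[symmetric] by (simp add: right_diff_distrib abs_le_iff)
  have den: "1 \<le> \<bar>slope_den p \<beta>\<bar>" "1 \<le> \<bar>slope_den q \<beta>\<bar>" using slope_den_ge_1[OF b] by auto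
  then have "slope p \<beta> - slope q \<beta> = (slope_num p \<beta> - slope_num q \<beta>) / slope_den p \<beta>
      + slope_num q \<beta> * (slope_den q \<beta> - slope_den p \<beta>) / (slope_den p \<beta> * slope_den q \<beta>)"
    unfolding slope_def by (auto simp: divide_simps) (auto simp: algebra_simps)
  moreover have "\<bar>(slope_num p \<beta> - slope_num q \<beta>) / slope_den p \<beta>\<bar> \<le> (2 * d) / 1"
    unfolding abs_divide using n den d by (intro frac_le) auto
  moreover have "\<bar>slope_num q \<beta> * (slope_den q \<beta> - slope_den p \<beta>) / (slope_den p \<beta> * slope_den q \<beta>)\<bar>
      \<le> (1 * (2 * d)) / (1 * 1)"
    unfolding abs_divide abs_mult using n den d e slope_num_le[OF b, of q]
    by (intro frac_le mult_mono) auto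
  ultimately show ?thesis unfolding d_def by linarith
qed

text \<open>Slope of the gradient of the first coordinate of the n-th iterate, starting from (1, 0).
  The recursion peels off the first application of \<open>H\<close>, as the chain rule does for
  pull-backs.\<close>

fun b :: "nat \<Rightarrow> plane \<Rightarrow> real" where
  "b 0 p = 0"
| "b (Suc n) p = slope p (b n (H p))"

lemma b_le: "\<bar>b n p\<bar> \<le> 1"
  by (induction n arbitrary: p) (auto simp: slope_le)

text \<open>The solution of K = \<theta> (|A| + \<epsilon>) K + 4 C, the recursion that the Hoelder
  constants of the slopes satisfy.\<close>

definition "Kb = 4 * C / (1 - \<theta> * (\<bar>A\<bar> + \<epsilon>))"

lemma Kb_nonneg: "0 \<le> Kb"
  unfolding Kb_def using C theta by simp

text \<open>As |A| + \<epsilon> \<ge> 1 and \<alpha> \<le> 1, the exponent on the expansion factor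
  is dropped; the condition on \<theta> is strong enough to afford this.\<close>

lemma norm_H_powr: "norm (H p - H q) powr \<alpha> \<le> (\<bar>A\<bar> + \<epsilon>) * norm (p - q) powr \<alpha>"
proof -
  have "norm (H p - H q) powr \<alpha> \<le> ((\<bar>A\<bar> + \<epsilon>) * norm (p - q)) powr \<alpha>"
    using H_lipschitz alpha by (intro powr_mono2) auto
  also have "\<dots> = (\<bar>A\<bar> + \<epsilon>) powr \<alpha> * norm (p - q) powr \<alpha>"
    using eps by (simp add: powr_mult)
  also have "\<dots> \<le> (\<bar>A\<bar> + \<epsilon>) powr 1 * norm (p - q) powr \<alpha>"
    using A eps alpha by (intro mult_right_mono powr_mono) auto
  finally show ?thesis using A eps by simp
qed

text \<open>One pull-back expands distances of base points by at most |A| + \<epsilon>, contracts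
  slopes by \<theta> and adds an error 4 C. The constant \<open>Kb\<close> reproduces itself under
  this, so the full exponent \<alpha> holds uniformly in \<open>n\<close>.\<close>

lemma b_holder: "\<bar>b n p - b n q\<bar> \<le> Kb * norm (p - q) powr \<alpha>"
proof (induction n arbitrary: p q)
  case 0 then show ?case using Kb_nonneg by simp
next
  case (Suc n)
  define d where "d = norm (p - q) powr \<alpha>"
  have "\<bar>b (Suc n) p - b (Suc n) q\<bar>
      \<le> \<bar>slope p (b n (H p)) - slope p (b n (H q))\<bar> + \<bar>slope p (b n (H q)) - slope q (b n (H q))\<bar>"
    by simp
  also have "\<dots> \<le> \<theta> * \<bar>b n (H p) - b n (H q)\<bar> + 4 * C * d"
    unfolding d_def by (intro add_mono slope_contraction slope_holder b_le)
  also have "\<dots> \<le> \<theta> * (Kb * ((\<bar>A\<bar> + \<epsilon>) * d)) + 4 * C * d"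
  proof -
    have "\<bar>b n (H p) - b n (H q)\<bar> \<le> Kb * ((\<bar>A\<bar> + \<epsilon>) * d)"
      unfolding d_def using Suc norm_H_powr Kb_nonneg by (meson mult_left_mono order_trans)
    then show ?thesis using theta(1) by (simp add: mult_left_mono)
  qed
  also have "\<dots> = Kb * d"
  proof -
    have "4 * C = Kb * (1 - \<theta> * (\<bar>A\<bar> + \<epsilon>))" unfolding Kb_def using theta(2) by simp
    then have "4 * C * d = Kb * (1 - \<theta> * (\<bar>A\<bar> + \<epsilon>)) * d" by simp
    then show ?thesis by (simp add: algebra_simps)
  qed
  finally show ?case unfolding d_def .
qed

lemma b_increment: "\<bar>b (Suc n) p - b n p\<bar> \<le> \<theta> ^ n"
proof (induction n arbitrary: p)
  case 0 show ?case using b_le[of 1 p] by simp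
next
  case (Suc n)
  have "\<bar>b (Suc (Suc n)) p - b (Suc n) p\<bar> \<le> \<theta> * \<bar>b (Suc n) (H p) - b n (H p)\<bar>"
    by (simp only: b.simps(2)[of "Suc n"] b.simps(2)[of n p]) (intro slope_contraction b_le)
  also have "\<dots> \<le> \<theta> * \<theta> ^ n" using Suc theta(1) by (intro mult_left_mono) auto
  finally show ?case by simp
qed

definition "blim p = lim (\<lambda>n. b n p)"

lemma b_tendsto: "(\<lambda>n. b n p) \<longlonglongrightarrow> blim p"
  and b_blim: "\<bar>b n p - blim p\<bar> \<le> 1 / (1 - \<theta>) * \<theta> ^ n"
proof -
  obtain l where l: "(\<lambda>n. b n p) \<longlonglongrightarrow> l" "\<And>n. \<bar>b n p - l\<bar> \<le> 1 / (1 - \<theta>) * \<theta> ^ n"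
    using geometric_increments_limit[of "\<lambda>n. b n p" 1 \<theta>] b_increment theta(1) theta_less_1 by auto
  then show "(\<lambda>n. b n p) \<longlonglongrightarrow> blim p" "\<bar>b n p - blim p\<bar> \<le> 1 / (1 - \<theta>) * \<theta> ^ n"
    unfolding blim_def using limI[OF l(1)] by auto
qed

lemma blim_le: "\<bar>blim p\<bar> \<le> 1"
  using LIMSEQ_le_const2[OF tendsto_rabs[OF b_tendsto]] b_le by blast

lemma blim_holder: "\<bar>blim p - blim q\<bar> \<le> Kb * norm (p - q) powr \<alpha>"
proof (rule LIMSEQ_le_const2)
  show "(\<lambda>n. \<bar>b n p - b n q\<bar>) \<longlonglongrightarrow> \<bar>blim p - blim q\<bar>"
    by (intro tendsto_intros b_tendsto)
qed (use b_holder in auto)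

lemma b_zero: "b n 0 = 0"
  by (induction n) (auto simp: zero slope_def slope_num_def p12_def)

lemma blim_zero: "blim 0 = 0"
  unfolding blim_def by (simp add: b_zero)

section \<open>Normalized iterates and their gradients\<close>

text \<open>The first component of the gradient of \<open>\<phi> n\<close>, whose direction is (1,
  \<open>b n p\<close>). Dividing by \<open>A\<close> at each step makes it 1 for the linear
  model.\<close>

fun a :: "nat \<Rightarrow> plane \<Rightarrow> real" where
  "a 0 p = 1"
| "a (Suc n) p = a n (H p) * (slope_den p (b n (H p)) / A)"

fun \<phi> :: "nat \<Rightarrow> plane \<Rightarrow> real" where
  "\<phi> 0 p = fst p"
| "\<phi> (Suc n) p = \<phi> n (H p) / A"

lemma phi_eq: "\<phi> n p = fst ((H ^^ n) p) / A ^ n"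
  by (induction n arbitrary: p) (auto simp: funpow_swap1)

lemma phi_derivative: "(\<phi> n has_derivative (\<lambda>v. a n p * (fst v + b n p * snd v))) (at p)"
proof (induction n arbitrary: p)
  case 0 then show ?case
    by (simp add: has_derivative_fst[OF has_derivative_ident])
next
  case (Suc n)
  have "((\<lambda>p. \<phi> n (H p)) has_derivative
      (\<lambda>v. a n (H p) * (fst (H' p v) + b n (H p) * snd (H' p v)))) (at p)"
    using has_derivative_compose[OF der Suc] .
  then have "((\<lambda>p. \<phi> n (H p) / A) has_derivative
      (\<lambda>v. a n (H p) * (fst (H' p v) + b n (H p) * snd (H' p v)) / A)) (at p)"
    unfolding divide_inverse by (rule has_derivative_mult_left)
  moreover have "a n (H p) * (fst (H' p v) + b n (H p) * snd (H' p v)) / A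
      = a (Suc n) p * (fst v + b (Suc n) p * snd v)" for v
  proof -
    have "slope_den p (b n (H p)) \<noteq> 0" using slope_den_ge_1[OF b_le[of n "H p"], of p] by auto
    then have "b (Suc n) p * slope_den p (b n (H p)) = slope_num p (b n (H p))"
      by (simp add: slope_def)
    then have "slope_den p (b n (H p)) * (fst v + b (Suc n) p * snd v)
        = slope_den p (b n (H p)) * fst v + slope_num p (b n (H p)) * snd v"
      by (simp only: distrib_left mult.assoc[symmetric] mult.commute[of "slope_den p (b n (H p))" "b (Suc n) p"])
    also have "\<dots> = fst (H' p v) + b n (H p) * snd (H' p v)"
      by (simp add: H'_apply slope_num_def slope_den_def algebra_simps)
    finally have "slope_den p (b n (H p)) * (fst v + b (Suc n) p * snd v)
        = fst (H' p v) + b n (H p) * snd (H' p v)" .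
    then show ?thesis by (simp del: b.simps)
  qed
  ultimately show ?case by (simp del: b.simps a.simps)
qed

text \<open>With the normalization by \<open>A ^ n\<close> removed, the gradient of the first
  coordinate of the n-th iterate grows at least like (|A| - 2 \<epsilon>)^n, a rate above 1. This is
  the expansion on which the invariant graph rests.\<close>

lemma a_lower: "((\<bar>A\<bar> - 2 * \<epsilon>) / \<bar>A\<bar>) ^ n \<le> \<bar>a n p\<bar>"
proof (induction n arbitrary: p)
  case (Suc n)
  have "(\<bar>A\<bar> - 2 * \<epsilon>) / \<bar>A\<bar> \<le> \<bar>slope_den p (b n (H p)) / A\<bar>"
    unfolding abs_divide using slope_den_ge[OF b_le] by (intro divide_right_mono) auto
  then have "((\<bar>A\<bar> - 2 * \<epsilon>) / \<bar>A\<bar>) ^ n * ((\<bar>A\<bar> - 2 * \<epsilon>) / \<bar>A\<bar>)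
      \<le> \<bar>a n (H p)\<bar> * \<bar>slope_den p (b n (H p)) / A\<bar>"
    using Suc eps by (intro mult_mono) auto
  then show ?case by (simp add: abs_mult mult.commute)
qed simp

end

section \<open>The invariant graph transverse to the expanding direction\<close>

text \<open>The bound holds for maps that are linear outside a bounded set. It keeps every
  \<open>\<phi> n\<close> within a fixed distance of \<open>fst\<close>, which makes an intermediate
  value argument possible.\<close>

locale planar_hyperbolic_bounded = planar_hyperbolic +
  fixes M :: real
  assumes bdd: "\<And>p. \<bar>fst (H p) - A * fst p\<bar> \<le> M"
begin

text \<open>The stable manifold of the origin, described by boundedness of the expanding coordinate
  alone; its invariance under \<open>H\<close> in both directions is then immediate.\<close>

definition "W = {p. \<exists>K. \<forall>n. \<bar>fst ((H ^^ n) p)\<bar> \<le> K}"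

lemma W_iff: "H p \<in> W \<longleftrightarrow> p \<in> W"
proof
  assume "H p \<in> W"
  then obtain K where K: "\<And>n. \<bar>fst ((H ^^ n) (H p))\<bar> \<le> K" unfolding W_def by blast
  have "\<bar>fst ((H ^^ n) p)\<bar> \<le> max K \<bar>fst p\<bar>" for n
    using K[of "n - 1"] by (cases n) (auto simp: funpow_swap1 max_def)
  then show "p \<in> W" unfolding W_def by blast
next
  assume "p \<in> W"
  then obtain K where K: "\<And>n. \<bar>fst ((H ^^ n) p)\<bar> \<le> K" unfolding W_def by blast
  have "\<bar>fst ((H ^^ n) (H p))\<bar> \<le> K" for n
    using K[of "Suc n"] by (simp add: funpow_swap1)
  then show "H p \<in> W" unfolding W_def by blast
qed

lemma zero_in_W: "0 \<in> W"
proof -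
  have "(H ^^ n) 0 = 0" for n by (induction n) (auto simp: zero)
  then show ?thesis unfolding W_def by auto
qed

text \<open>Mean value theorem on the segment from \<open>p\<close> to \<open>q\<close>. The point
  \<open>\<xi>\<close> varies with \<open>n\<close>, so only its distance to \<open>p\<close> is
  retained; the Hoelder bound turns this into a comparison of \<open>b n \<xi>\<close> with
  \<open>b n p\<close>.\<close>

lemma segment_increment:
  obtains \<xi> where "\<phi> n q - \<phi> n p = a n \<xi> * (fst (q - p) + b n \<xi> * snd (q - p))"
    "norm (\<xi> - p) \<le> norm (q - p)"
proof -
  define g where "g t = \<phi> n (p + t *\<^sub>R (q - p))" for t
  have "(g has_derivative (\<lambda>s. a n (p + t *\<^sub>R (q - p)) *
      (fst (s *\<^sub>R (q - p)) + b n (p + t *\<^sub>R (q - p)) * snd (s *\<^sub>R (q - p))))) (at t within {0..1})" for t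
    unfolding g_def
    by (rule has_derivative_compose[OF _ phi_derivative])
      (auto intro!: derivative_eq_intros)
  from mvt_very_simple[of 0 1 g, OF _ this] obtain t where t: "t \<in> {0..1}"
    "g 1 - g 0 = a n (p + t *\<^sub>R (q - p)) * (fst (q - p) + b n (p + t *\<^sub>R (q - p)) * snd (q - p))"
    by auto
  have "norm ((p + t *\<^sub>R (q - p)) - p) \<le> norm (q - p)"
    using t(1) by (simp add: mult_left_le_one_le)
  with t(2) show ?thesis by (intro that[of "p + t *\<^sub>R (q - p)"]) (auto simp: g_def)
qed

text \<open>Both orbits have bounded first coordinate, so \<open>\<phi> n q - \<phi> n p\<close> is
  of order |A|^(-n), while \<open>a n \<xi>\<close> is at least ((|A| - 2 \<epsilon>) / |A|)^n in
  absolute value. Hence (1, \<open>b n \<xi>\<close>) nearly annihilates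
  \<open>q - p\<close>.\<close>

lemma W_segment:
  assumes "p \<in> W" "q \<in> W"
  shows "\<exists>K. \<forall>n. \<exists>\<xi>. norm (\<xi> - p) \<le> norm (q - p) \<and>
     \<bar>fst (q - p) + b n \<xi> * snd (q - p)\<bar> \<le> K * (1 / (\<bar>A\<bar> - 2 * \<epsilon>)) ^ n"
proof -
  obtain K1 K2 where K: "\<And>n. \<bar>fst ((H ^^ n) p)\<bar> \<le> K1" "\<And>n. \<bar>fst ((H ^^ n) q)\<bar> \<le> K2"
    using assms unfolding W_def by blast
  have "\<exists>\<xi>. norm (\<xi> - p) \<le> norm (q - p) \<and>
     \<bar>fst (q - p) + b n \<xi> * snd (q - p)\<bar> \<le> (K1 + K2) * (1 / (\<bar>A\<bar> - 2 * \<epsilon>)) ^ n" for n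
  proof -
    obtain \<xi> where \<xi>: "\<phi> n q - \<phi> n p = a n \<xi> * (fst (q - p) + b n \<xi> * snd (q - p))"
      "norm (\<xi> - p) \<le> norm (q - p)" by (rule segment_increment)
    define z where "z = \<bar>fst (q - p) + b n \<xi> * snd (q - p)\<bar>"
    have "((\<bar>A\<bar> - 2 * \<epsilon>) / \<bar>A\<bar>) ^ n * z \<le> \<bar>a n \<xi>\<bar> * z"
      using a_lower unfolding z_def by (intro mult_right_mono) auto
    also have "\<dots> = \<bar>\<phi> n q - \<phi> n p\<bar>" unfolding z_def \<xi>(1) abs_mult ..
    also have "\<dots> \<le> \<bar>\<phi> n q\<bar> + \<bar>\<phi> n p\<bar>" by simp
    also have "\<dots> \<le> K2 / \<bar>A\<bar> ^ n + K1 / \<bar>A\<bar> ^ n"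
      unfolding phi_eq abs_divide power_abs[symmetric] using K A
      by (intro add_mono divide_right_mono) auto
    finally have fin: "((\<bar>A\<bar> - 2 * \<epsilon>) / \<bar>A\<bar>) ^ n * z \<le> K2 / \<bar>A\<bar> ^ n + K1 / \<bar>A\<bar> ^ n" .
    have "z \<le> (K1 + K2) * (1 / (\<bar>A\<bar> - 2 * \<epsilon>)) ^ n"
    proof -
      have pos: "0 < \<bar>A\<bar> ^ n" "0 < (\<bar>A\<bar> - 2 * \<epsilon>) ^ n" using A eps by simp_all
      from fin have "(\<bar>A\<bar> - 2 * \<epsilon>) ^ n * z / \<bar>A\<bar> ^ n \<le> (K1 + K2) / \<bar>A\<bar> ^ n"
        by (simp add: power_divide add_divide_distrib add.commute)
      then have "(\<bar>A\<bar> - 2 * \<epsilon>) ^ n * z \<le> K1 + K2"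
        using pos(1) by (simp only: divide_le_cancel)
      then show ?thesis
        using pos(2) by (simp add: power_divide pos_le_divide_eq mult.commute)
    qed
    then show ?thesis using \<xi>(2) unfolding z_def by blast
  qed
  then show ?thesis by blast
qed

lemma geometric_null: "(\<lambda>n. K * (1 / (\<bar>A\<bar> - 2 * \<epsilon>)) ^ n) \<longlonglongrightarrow> 0"
  using eps by (intro tendsto_mult_right_zero LIMSEQ_realpow_zero) (auto simp: divide_simps)

text \<open>Up to an error tending to 0, \<open>q - p\<close> is annihilated by row vectors (1,
  \<beta>) with |\<beta>| \<le> 1. In particular two points of \<open>W\<close> at the same height
  coincide.\<close>

lemma W_lipschitz: "p \<in> W \<Longrightarrow> q \<in> W \<Longrightarrow> \<bar>fst (q - p)\<bar> \<le> \<bar>snd (q - p)\<bar>"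
proof -
  assume "p \<in> W" "q \<in> W"
  then obtain K where K: "\<And>n. \<exists>\<xi>. norm (\<xi> - p) \<le> norm (q - p) \<and>
     \<bar>fst (q - p) + b n \<xi> * snd (q - p)\<bar> \<le> K * (1 / (\<bar>A\<bar> - 2 * \<epsilon>)) ^ n"
    using W_segment by blast
  have "\<bar>fst (q - p)\<bar> \<le> K * (1 / (\<bar>A\<bar> - 2 * \<epsilon>)) ^ n + \<bar>snd (q - p)\<bar>" for n
  proof -
    obtain \<xi> where "\<bar>fst (q - p) + b n \<xi> * snd (q - p)\<bar> \<le> K * (1 / (\<bar>A\<bar> - 2 * \<epsilon>)) ^ n"
      using K by blast
    moreover have "\<bar>b n \<xi> * snd (q - p)\<bar> \<le> 1 * \<bar>snd (q - p)\<bar>"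
      unfolding abs_mult using b_le by (intro mult_right_mono) auto
    ultimately show ?thesis by linarith
  qed
  then have "\<bar>fst (q - p)\<bar> \<le> 0 + \<bar>snd (q - p)\<bar>"
    by (intro LIMSEQ_le_const[OF tendsto_add[OF geometric_null tendsto_const]]) blast
  then show ?thesis by simp
qed

text \<open>The slope at \<open>\<xi>\<close> differs from \<open>blim p\<close> by a Hoelder term
  in the distance and a geometric term in \<open>n\<close>. As \<open>n\<close> grows, a first-order
  expansion of \<open>W\<close> at \<open>p\<close> with derivative \<open>- blim p\<close>
  remains.\<close>

lemma W_slope:
  assumes "p \<in> W" "q \<in> W"
  shows "\<bar>fst (q - p) + blim p * snd (q - p)\<bar> \<le> Kb * norm (q - p) powr \<alpha> * \<bar>snd (q - p)\<bar>"
proof -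
  obtain K where K: "\<And>n. \<exists>\<xi>. norm (\<xi> - p) \<le> norm (q - p) \<and>
     \<bar>fst (q - p) + b n \<xi> * snd (q - p)\<bar> \<le> K * (1 / (\<bar>A\<bar> - 2 * \<epsilon>)) ^ n"
    using W_segment[OF assms] by blast
  define y where "y = snd (q - p)"
  have "\<bar>fst (q - p) + blim p * y\<bar> \<le> K * (1 / (\<bar>A\<bar> - 2 * \<epsilon>)) ^ n
    + (Kb * norm (q - p) powr \<alpha> + 1 / (1 - \<theta>) * \<theta> ^ n) * \<bar>y\<bar>" for n
  proof -
    obtain \<xi> where \<xi>: "norm (\<xi> - p) \<le> norm (q - p)"
      "\<bar>fst (q - p) + b n \<xi> * y\<bar> \<le> K * (1 / (\<bar>A\<bar> - 2 * \<epsilon>)) ^ n"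
      using K unfolding y_def by blast
    have "\<bar>b n \<xi> - b n p\<bar> \<le> Kb * norm (q - p) powr \<alpha>"
      using b_holder[of n \<xi> p] Kb_nonneg \<xi>(1) alpha
      by (meson mult_left_mono norm_ge_zero order_trans powr_mono2 less_imp_le)
    then have "\<bar>b n \<xi> - blim p\<bar> \<le> Kb * norm (q - p) powr \<alpha> + 1 / (1 - \<theta>) * \<theta> ^ n"
      using b_blim[of n p] by linarith
    then have "\<bar>(b n \<xi> - blim p) * y\<bar> \<le> (Kb * norm (q - p) powr \<alpha> + 1 / (1 - \<theta>) * \<theta> ^ n) * \<bar>y\<bar>"
      unfolding abs_mult by (intro mult_right_mono) auto
    moreover have "fst (q - p) + blim p * y = (fst (q - p) + b n \<xi> * y) - (b n \<xi> - blim p) * y"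
      by (simp add: algebra_simps)
    ultimately show ?thesis using \<xi>(2) by linarith
  qed
  moreover have "(\<lambda>n. K * (1 / (\<bar>A\<bar> - 2 * \<epsilon>)) ^ n
    + (Kb * norm (q - p) powr \<alpha> + 1 / (1 - \<theta>) * \<theta> ^ n) * \<bar>y\<bar>)
    \<longlonglongrightarrow> 0 + (Kb * norm (q - p) powr \<alpha> + 1 / (1 - \<theta>) * 0) * \<bar>y\<bar>"
    using theta(1) theta_less_1
    by (intro tendsto_add tendsto_mult tendsto_const geometric_null LIMSEQ_realpow_zero) auto
  ultimately have "\<bar>fst (q - p) + blim p * y\<bar> \<le> 0 + (Kb * norm (q - p) powr \<alpha> + 1 / (1 - \<theta>) * 0) * \<bar>y\<bar>"
    by (intro LIMSEQ_le_const) blast+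
  then show ?thesis unfolding y_def by simp
qed

text \<open>The bound is the fixed point of K = (K + M) / |A|.\<close>

lemma phi_near_fst: "\<bar>\<phi> n p - fst p\<bar> \<le> M / (\<bar>A\<bar> - 1)"
proof (induction n arbitrary: p)
  case 0
  have "0 \<le> M" using bdd[of p] by linarith
  then show ?case using A by simp
next
  case (Suc n)
  have "\<phi> (Suc n) p - fst p = ((\<phi> n (H p) - fst (H p)) + (fst (H p) - A * fst p)) / A"
    using A by (auto simp: field_simps)
  then have "\<bar>\<phi> (Suc n) p - fst p\<bar> = \<bar>(\<phi> n (H p) - fst (H p)) + (fst (H p) - A * fst p)\<bar> / \<bar>A\<bar>"
    by (simp only: abs_divide)
  also have "\<dots> \<le> (M / (\<bar>A\<bar> - 1) + M) / \<bar>A\<bar>"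
    by (rule divide_right_mono[OF order_trans[OF abs_triangle_ineq add_mono[OF Suc bdd]]]) simp
  also have "\<dots> = M / (\<bar>A\<bar> - 1)"
  proof -
    have "(M / (c - 1) + M) / c = M / (c - 1)" if "1 < c" for c :: real
      using that by (simp add: field_simps)
    then show ?thesis using A by blast
  qed
  finally show ?case .
qed

lemma phi_add: "\<phi> (k + n) p = \<phi> n ((H ^^ k) p) / A ^ k"
  by (induction k arbitrary: p) (auto simp: funpow_swap1)

text \<open>At height \<open>y\<close> each \<open>\<phi> n\<close> changes sign on [-K, K]. A limit
  point of such zeros lies in \<open>W\<close>: for k \<le> n the k-th iterate of a zero of
  \<open>\<phi> n\<close> is a zero of \<open>\<phi> (n - k)\<close>, so its first coordinate is at
  most \<open>K\<close>, and for fixed \<open>k\<close> this survives the limit.\<close>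

lemma W_exists: "\<exists>x. (x, y) \<in> W"
proof -
  define K where "K = M / (\<bar>A\<bar> - 1)"
  have cont: "continuous_on UNIV (\<lambda>x. \<phi> n (x, y))" for n
  proof -
    have "continuous_on UNIV (\<phi> n)"
      by (intro continuous_at_imp_continuous_on ballI has_derivative_continuous[OF phi_derivative])
    then show ?thesis
      by (rule continuous_on_compose2) (auto intro!: continuous_intros)
  qed
  have "\<exists>x. \<bar>x\<bar> \<le> K \<and> \<phi> n (x, y) = 0" for n
  proof -
    have "\<phi> n (- K, y) \<le> 0" "0 \<le> \<phi> n (K, y)" "- K \<le> K"
      using phi_near_fst[of n "(- K, y)"] phi_near_fst[of n "(K, y)"] unfolding K_def[symmetric] by auto
    from IVT'[OF this] continuous_on_subset[OF cont] obtain x where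
      "- K \<le> x" "x \<le> K" "\<phi> n (x, y) = 0" by blast
    then have "\<bar>x\<bar> \<le> K" by simp
    with \<open>\<phi> n (x, y) = 0\<close> show ?thesis by blast
  qed
  then obtain X where X: "\<And>n. \<bar>X n\<bar> \<le> K" "\<And>n. \<phi> n (X n, y) = 0" by metis
  have "bounded (range X)" using X(1) by (auto simp: bounded_iff)
  then obtain x r where r: "strict_mono r" "(X \<circ> r) \<longlonglongrightarrow> x"
    using bounded_imp_convergent_subsequence by blast
  have "\<bar>fst ((H ^^ k) (x, y))\<bar> \<le> K" for k
  proof -
    have contH: "continuous_on UNIV (H ^^ k)"
    proof (induction k)
      case (Suc k)
      have "continuous_on UNIV H"
        by (intro continuous_at_imp_continuous_on ballI has_derivative_continuous[OF der])
      then show ?case using continuous_on_compose2[OF _ Suc, of UNIV H] by (simp add: o_def)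
    qed (simp add: id_def)
    have "(\<lambda>n. (X (r n), y)) \<longlonglongrightarrow> (x, y)"
      using r(2) by (intro tendsto_Pair tendsto_const) (simp add: o_def)
    then have "(\<lambda>n. (H ^^ k) (X (r n), y)) \<longlonglongrightarrow> (H ^^ k) (x, y)"
      using contH by (intro isCont_tendsto_compose[of _ "H ^^ k"])
        (auto simp: continuous_on_eq_continuous_at)
    then have lim: "(\<lambda>n. \<bar>fst ((H ^^ k) (X (r n), y))\<bar>) \<longlonglongrightarrow> \<bar>fst ((H ^^ k) (x, y))\<bar>"
      by (intro tendsto_intros)
    have "\<bar>fst ((H ^^ k) (X (r n), y))\<bar> \<le> K" if "n \<ge> k" for n
    proof -
      have "k \<le> r n" using that r(1) seq_suble[of r n] by linarith
      then have "\<phi> (r n - k) ((H ^^ k) (X (r n), y)) = 0"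
        using X(2)[of "r n"] phi_add[of k "r n - k" "(X (r n), y)"] A by auto
      then show ?thesis
        using phi_near_fst[of "r n - k" "(H ^^ k) (X (r n), y)"] unfolding K_def by simp
    qed
    then show ?thesis using LIMSEQ_le_const2[OF lim] by blast
  qed
  then show ?thesis unfolding W_def by blast
qed

theorem invariant_graph:
  obtains h h' :: "real \<Rightarrow> real" and K where
    "\<And>y. (h has_field_derivative h' y) (at y)"
    "\<And>y z. \<bar>h' y - h' z\<bar> \<le> K * \<bar>y - z\<bar> powr \<alpha>" "0 \<le> K"
    "h 0 = 0" "h' 0 = 0"
    "\<And>p. fst (H p) = h (snd (H p)) \<longleftrightarrow> fst p = h (snd p)"
proof -
  obtain h where h: "\<And>y. (h y, y) \<in> W" using W_exists by metis
  have Wh: "p \<in> W \<longleftrightarrow> fst p = h (snd p)" for p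
    using W_lipschitz[OF h[of "snd p"], of p] h[of "snd p"] by (metis abs_0 abs_le_zero_iff diff_self
      eq_iff_diff_eq_0 fst_conv fst_diff prod.collapse snd_conv snd_diff)
  define h' where "h' y = - blim (h y, y)" for y
  \<comment> \<open>The graph has Lipschitz constant at most 1, so its points at heights
    \<open>y\<close> and \<open>z\<close> are at distance at most 2 |y - z|.\<close>
  define K where "K = Kb * 2 powr \<alpha>"
  have dist: "norm ((h z, z) - (h y, y)) powr \<alpha> \<le> 2 powr \<alpha> * \<bar>z - y\<bar> powr \<alpha>" for y z
  proof -
    have "norm ((h z, z) - (h y, y)) \<le> 2 * \<bar>z - y\<bar>"
      using W_lipschitz[OF h[of y] h[of z]] norm_le_abs_fst_snd[of "(h z, z) - (h y, y)"] by simp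
    then have "norm ((h z, z) - (h y, y)) powr \<alpha> \<le> (2 * \<bar>z - y\<bar>) powr \<alpha>"
      using alpha by (intro powr_mono2) auto
    then show ?thesis by (simp add: powr_mult)
  qed
  have est: "\<bar>h z - h y - h' y * (z - y)\<bar> \<le> K * \<bar>z - y\<bar> powr \<alpha> * \<bar>z - y\<bar>" for y z
  proof -
    have "\<bar>h z - h y - h' y * (z - y)\<bar> \<le> Kb * norm ((h z, z) - (h y, y)) powr \<alpha> * \<bar>z - y\<bar>"
      using W_slope[OF h[of y] h[of z]] by (simp add: h'_def)
    also have "\<dots> \<le> Kb * (2 powr \<alpha> * \<bar>z - y\<bar> powr \<alpha>) * \<bar>z - y\<bar>"
      using dist Kb_nonneg by (intro mult_right_mono mult_left_mono) auto
    finally show ?thesis by (simp add: K_def mult.assoc)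
  qed
  show ?thesis
  proof (rule that)
    show "(h has_field_derivative h' y) (at y)" for y
      using alpha(1) est by (rule has_field_derivative_holder_remainder)
    show "\<bar>h' y - h' z\<bar> \<le> K * \<bar>y - z\<bar> powr \<alpha>" for y z
    proof -
      have "\<bar>h' y - h' z\<bar> \<le> Kb * norm ((h y, y) - (h z, z)) powr \<alpha>"
        using blim_holder[of "(h y, y)" "(h z, z)"] by (simp add: h'_def)
      also have "\<dots> \<le> Kb * (2 powr \<alpha> * \<bar>y - z\<bar> powr \<alpha>)"
        using dist Kb_nonneg by (intro mult_left_mono) auto
      finally show ?thesis by (simp add: K_def mult.assoc)
    qed
    show "0 \<le> K" using Kb_nonneg by (simp add: K_def)
    show h0: "h 0 = 0" using Wh[of 0] zero_in_W by simp
    show "h' 0 = 0" using blim_zero by (simp add: h'_def h0 zero_prod_def)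
    show "fst (H p) = h (snd (H p)) \<longleftrightarrow> fst p = h (snd p)" for p
      using W_iff[of p] Wh by simp
  qed
qed

end

section \<open>Linearizing the expanding coordinate\<close>

text \<open>The exponent \<open>\<tau>\<close> is found by balancing \<open>X^k d\<close> against \<open>Y^k\<close>.  The correction \<open>- d / (X - 1)\<close>
  makes the recursion \<open>d \<mapsto> d X / Y\<close>, under which \<open>d^\<tau>\<close> merely scales by \<open>1 / Y\<close>, close up.\<close>

lemma sum_min_geometric_le:
  fixes X Y :: real
  assumes X: "1 < X" and Y: "0 < Y" "Y < 1"
  defines "\<tau> \<equiv> - ln Y / (ln X - ln Y)"
  obtains K where "0 \<le> K"
    "\<And>n d. 0 < d \<Longrightarrow> d \<le> 1 \<Longrightarrow> (\<Sum>k<n. min (X ^ k * d) (Y ^ k)) \<le> K * d powr \<tau>"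
proof -
  \<comment> \<open>The first summand is the full geometric series in \<open>Y\<close>; the second
    pays for the correction d / (X - 1) at the largest admissible value d = X / Y.\<close>
  define K where "K = 1 / (1 - Y) + (X / Y) / (X - 1)"
  have lns: "0 < ln X" "ln Y < 0" using X Y by auto
  have tau: "0 < \<tau>" unfolding \<tau>_def using lns by (intro divide_pos_pos) auto
  have tau1: "\<tau> \<le> 1" unfolding \<tau>_def using lns by (subst divide_le_eq_1_pos) auto
  have XY: "1 < X / Y" using X Y by (simp add: field_simps)
  have XYt: "(X / Y) powr \<tau> = 1 / Y"
  proof -
    have "\<tau> * ln (X / Y) = ln (1 / Y)"
      unfolding \<tau>_def using X Y lns by (simp add: ln_div)
    then show ?thesis using X Y by (simp add: powr_def)
  qed
  have geom: "(\<Sum>k<n. Y ^ k) \<le> 1 / (1 - Y)" for n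
    using Y by (simp add: sum_gp_strict divide_le_cancel)
  \<comment> \<open>The range of \<open>d\<close> extends to X / Y because the induction step sends
    d \<le> 1 to d X / Y. For d > 1 the geometric series alone bounds the sum.\<close>
  have main: "(\<Sum>k<n. min (X ^ k * d) (Y ^ k)) \<le> K * d powr \<tau> - d / (X - 1)"
    if "0 < d" "d \<le> X / Y" for n d
    using that
  proof (induction n arbitrary: d)
    case 0
    show ?case
    proof (cases "d \<le> 1")
      case True
      have "d / (X - 1) \<le> (d powr \<tau>) / (X - 1) * (X / Y)"
      proof -
        have "d powr 1 \<le> d powr \<tau>"
          using 0 True tau1 by (intro powr_mono') auto
        then have "d / (X - 1) \<le> d powr \<tau> / (X - 1)"
          using 0 X by (intro divide_right_mono) auto
        also have "\<dots> \<le> (d powr \<tau>) / (X - 1) * (X / Y)"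
          using mult_left_mono[of 1 "X / Y" "d powr \<tau> / (X - 1)"] XY X by simp
        finally show ?thesis .
      qed
      moreover have "0 \<le> 1 / (1 - Y) * d powr \<tau>" using Y by simp
      moreover have "K * d powr \<tau> = 1 / (1 - Y) * d powr \<tau> + (d powr \<tau>) / (X - 1) * (X / Y)"
        unfolding K_def by (simp add: distrib_right distrib_left mult.commute)
      ultimately have "0 \<le> K * d powr \<tau> - d / (X - 1)" by linarith
      then show ?thesis by simp
    next
      case False
      have "1 \<le> d powr \<tau>" using False tau by (simp add: ge_one_powr_ge_zero)
      then have "K * 1 \<le> K * d powr \<tau>" using X Y by (intro mult_left_mono) (auto simp: K_def)
      moreover have "d / (X - 1) \<le> X / Y / (X - 1)" using 0 X by (intro divide_right_mono) auto
      moreover have "0 \<le> 1 / (1 - Y)" using Y by simp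
      ultimately have "0 \<le> K * d powr \<tau> - d / (X - 1)" using K_def by linarith
      then show ?thesis by simp
    qed
  next
    case (Suc n)
    show ?case
    proof (cases "d \<le> 1")
      case True
      define e where "e = d * (X / Y)"
      have e: "0 < e" "e \<le> X / Y" using Suc.prems True X Y by (auto simp: e_def field_simps)
      have "(\<Sum>k<Suc n. min (X ^ k * d) (Y ^ k)) = min d 1 + (\<Sum>k<n. min (X ^ Suc k * d) (Y ^ Suc k))"
        by (subst sum.lessThan_Suc_shift) simp
      also have "(\<Sum>k<n. min (X ^ Suc k * d) (Y ^ Suc k)) = Y * (\<Sum>k<n. min (X ^ k * e) (Y ^ k))"
        unfolding sum_distrib_left
      proof (intro sum.cong refl)
        fix k
        have "X ^ Suc k * d = Y * (X ^ k * e)" using Y by (simp add: e_def)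
        then show "min (X ^ Suc k * d) (Y ^ Suc k) = Y * min (X ^ k * e) (Y ^ k)"
          using Y by (simp only: min_mult_distrib_left power_Suc[of Y] less_imp_le if_True)
      qed
      also have "\<dots> \<le> Y * (K * e powr \<tau> - e / (X - 1))"
        using Suc.IH[OF e] Y by (intro mult_left_mono) auto
      also have "e powr \<tau> = d powr \<tau> * (1 / Y)"
        unfolding e_def using Suc.prems X Y by (simp only: powr_mult XYt)
      \<comment> \<open>The leading term \<open>min d 1 = d\<close> is absorbed exactly: d - d X /
        (X - 1) = - d / (X - 1).\<close>
      also have "min d 1 + Y * (K * (d powr \<tau> * (1 / Y)) - e / (X - 1)) = K * d powr \<tau> - d / (X - 1)"
        using True X Y unfolding e_def by (simp add: field_simps min_def)
      finally show ?thesis by simp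
    next
      case False
      have "(\<Sum>k<Suc n. min (X ^ k * d) (Y ^ k)) \<le> (\<Sum>k<Suc n. Y ^ k)"
        by (intro sum_mono) auto
      also have "\<dots> \<le> 1 / (1 - Y)" by (rule geom)
      also have "\<dots> \<le> K * d powr \<tau> - d / (X - 1)"
      proof -
        have "1 \<le> d powr \<tau>" using False tau by (simp add: ge_one_powr_ge_zero)
        then have "K * 1 \<le> K * d powr \<tau>" using X Y by (intro mult_left_mono) (auto simp: K_def)
        moreover have "d / (X - 1) \<le> X / Y / (X - 1)"
          using Suc.prems X by (intro divide_right_mono) auto
        ultimately show ?thesis using K_def by linarith
      qed
      finally show ?thesis .
    qed
  qed
  show ?thesis
  proof (rule that[of K])
    show "0 \<le> K" using X Y by (simp add: K_def)
    fix n and d :: real assume d: "0 < d" "d \<le> 1"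
    have "0 \<le> d / (X - 1)" using d X by simp
    then show "(\<Sum>k<n. min (X ^ k * d) (Y ^ k)) \<le> K * d powr \<tau>"
      using main[of d n] d XY by linarith
  qed
qed

lemma abs_ln_diff_le:
  fixes u v :: real
  assumes "1/2 \<le> u" "1/2 \<le> v"
  shows "\<bar>ln u - ln v\<bar> \<le> 2 * \<bar>u - v\<bar>"
proof -
  have *: "ln u - ln v \<le> 2 * \<bar>u - v\<bar>" if "1/2 \<le> u" "1/2 \<le> v" for u v :: real
  proof -
    have "ln u - ln v = ln (u / v)" using that by (simp add: ln_div)
    also have "\<dots> \<le> u / v - 1" using that by (intro ln_le_minus_one) auto
    also have "\<dots> = (u - v) / v" using that by (simp add: field_simps)
    also have "\<dots> \<le> \<bar>u - v\<bar> / (1/2)" using that by (intro frac_le) auto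
    finally show ?thesis by simp
  qed
  show ?thesis using *[of u v] *[of v u] assms by (simp add: abs_if abs_minus_commute split: if_splits)
qed

lemma abs_exp_diff_le:
  fixes u v K :: real
  assumes "u \<le> K" "v \<le> K"
  shows "\<bar>exp u - exp v\<bar> \<le> exp K * \<bar>u - v\<bar>"
proof -
  have *: "exp u - exp v \<le> exp K * \<bar>u - v\<bar>" if "u \<le> K" for u v
  proof -
    have "1 + (v - u) \<le> exp (v - u)" by (rule exp_ge_add_one_self)
    then have "exp u * (1 + (v - u)) \<le> exp u * exp (v - u)" by (intro mult_left_mono) auto
    then have "exp u - exp v \<le> exp u * (u - v)"
      by (simp add: exp_add[symmetric]) (simp add: algebra_simps)
    also have "\<dots> \<le> exp u * \<bar>u - v\<bar>" by (intro mult_left_mono) auto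
    also have "\<dots> \<le> exp K * \<bar>u - v\<bar>" using that by (intro mult_right_mono) auto
    finally show ?thesis .
  qed
  show ?thesis using *[of u v] *[of v u] assms by (simp add: abs_if abs_minus_commute split: if_splits)
qed

section \<open>Deviation from the linear model near a straight invariant axis\<close>

text \<open>\<open>supp\<close> cuts off in the first coordinate only: wherever this coordinate
  exceeds \<open>R\<close> in absolute value there is no distortion at all, so the expanding
  coordinate contributes distortion only while it is at most \<open>R\<close>.\<close>

locale planar_hyperbolic_straight = planar_hyperbolic +
  fixes R :: real
  assumes R: "0 < R"
    and axis: "\<And>x. H (x, 0) = (A * x, 0)"
    and supp: "\<And>p. R < \<bar>fst p\<bar> \<Longrightarrow> H' p = diag_blinfun A B"
begin

lemma H'_axis: "H' (x, 0) (1, 0) = (A, 0)"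
proof -
  have d: "((\<lambda>t. (t, 0)) has_derivative (\<lambda>t. (t, 0))) (at x)"
    by (auto intro!: derivative_eq_intros)
  have "((\<lambda>t. H (t, 0)) has_derivative (\<lambda>t. H' (x, 0) (t, 0))) (at x)"
    by (rule has_derivative_compose[OF d der])
  moreover have "((\<lambda>t. H (t, 0)) has_derivative (\<lambda>t. (A * t, 0))) (at x)"
    unfolding axis by (auto intro!: derivative_eq_intros)
  ultimately have "(\<lambda>t. H' (x, 0) (t, 0)) = (\<lambda>t. (A * t, 0))"
    by (rule has_derivative_unique)
  from fun_cong[OF this, of 1] show ?thesis by simp
qed

text \<open>On the axis the first column of \<open>H'\<close> is (A, 0). Since
  \<open>slope_den\<close> involves only this column, it equals \<open>A\<close> on the axis
  whatever the slope.\<close>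

lemma p11_near_axis: "\<bar>p11 p - A\<bar> \<le> C * \<bar>snd p\<bar> powr \<alpha>"
  and p21_near_axis: "\<bar>p21 p\<bar> \<le> C * \<bar>snd p\<bar> powr \<alpha>"
proof -
  have n: "norm (p - (fst p, 0)) = \<bar>snd p\<bar>" by (simp add: norm_prod_def)
  have "p11 (fst p, 0) = A" "p21 (fst p, 0) = 0" by (simp_all add: p11_def p21_def H'_axis)
  then show "\<bar>p11 p - A\<bar> \<le> C * \<bar>snd p\<bar> powr \<alpha>" "\<bar>p21 p\<bar> \<le> C * \<bar>snd p\<bar> powr \<alpha>"
    using partials_holder(1,3)[of p "(fst p, 0)"] unfolding n by auto
qed

text \<open>Up to the factor 2 C a majorant of the distance from \<open>H'\<close> to the diagonal
  matrix. It is split by coordinates because the first term is controlled by expansion up to the cut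
  at \<open>R\<close>, the second by contraction.\<close>

definition "\<omega> p = (if \<bar>fst p\<bar> \<le> R then \<bar>fst p\<bar> powr \<alpha> else 0) + \<bar>snd p\<bar> powr \<alpha>"

lemma omega_nonneg: "0 \<le> \<omega> p"
  unfolding \<omega>_def by auto

lemma H'_near_omega: "norm (H' p - diag_blinfun A B) \<le> 2 * C * \<omega> p"
proof (cases "\<bar>fst p\<bar> \<le> R")
  case True
  define m where "m = max \<bar>fst p\<bar> \<bar>snd p\<bar>"
  have "norm (H' p - diag_blinfun A B) \<le> C * norm p powr \<alpha>"
    using hol[of p 0] zero by simp
  also have "\<dots> \<le> C * (2 * m) powr \<alpha>"
    using norm_le_abs_fst_snd[of p] C alpha
    by (intro mult_left_mono powr_mono2) (auto simp: m_def)
  also have "\<dots> = C * (2 powr \<alpha> * m powr \<alpha>)"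
    by (simp add: powr_mult m_def)
  also have "\<dots> \<le> C * (2 * m powr \<alpha>)"
    using powr_mono[of \<alpha> 1 2] C alpha by (intro mult_left_mono mult_right_mono) auto
  also have "\<dots> \<le> C * (2 * \<omega> p)"
    using C True by (intro mult_left_mono) (auto simp: m_def \<omega>_def max_def)
  finally show ?thesis by simp
next
  case False
  then show ?thesis using supp C omega_nonneg by simp
qed

text \<open>Mean value inequality on a vertical segment starting from the axis, where
  \<open>H\<close> is already linear. The deviation is thus proportional to |snd p| and not to the
  norm of \<open>p\<close>, which lets the second coordinate be followed at its own rate.\<close>

lemma H_near_linear:
  assumes "\<And>t. \<bar>t\<bar> \<le> \<bar>snd p\<bar> \<Longrightarrow> norm (H' (fst p, t) - diag_blinfun A B) \<le> K"
  shows "norm (H p - diag_blinfun A B p) \<le> K * \<bar>snd p\<bar>"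
proof -
  define S where "S = {fst p} \<times> {- \<bar>snd p\<bar>..\<bar>snd p\<bar>}"
  have "norm ((H p - diag_blinfun A B p) - (H (fst p, 0) - diag_blinfun A B (fst p, 0)))
      \<le> K * norm (p - (fst p, 0))"
  proof (rule blinfun_derivative_lipschitz[of S])
    show "convex S" unfolding S_def by (intro convex_Times) auto
    show "((\<lambda>p. H p - diag_blinfun A B p) has_derivative (H' q - diag_blinfun A B)) (at q within S)" for q
      unfolding blinfun.diff_left minus_blinfun.rep_eq
      by (intro has_derivative_diff has_derivative_at_withinI[OF der]
          bounded_linear_imp_has_derivative blinfun.bounded_linear_right)
    show "norm (H' q - diag_blinfun A B) \<le> K" if "q \<in> S" for q
      using that assms by (cases q) (auto simp: S_def)
    show "p \<in> S" "(fst p, 0) \<in> S" by (auto simp: S_def mem_Times_iff)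
  qed
  moreover have "norm (p - (fst p, 0)) = \<bar>snd p\<bar>" by (simp add: norm_prod_def)
  ultimately show ?thesis by (simp add: axis)
qed

lemma H_near_linear_eps: "norm (H p - diag_blinfun A B p) \<le> \<epsilon> * \<bar>snd p\<bar>"
  by (rule H_near_linear[OF near])

lemma H_near_linear_omega: "norm (H p - diag_blinfun A B p) \<le> 2 * C * \<omega> p * \<bar>snd p\<bar>"
proof (rule H_near_linear)
  fix t assume t: "\<bar>t\<bar> \<le> \<bar>snd p\<bar>"
  have "\<omega> (fst p, t) \<le> \<omega> p"
    using t alpha unfolding \<omega>_def by (auto intro!: powr_mono2)
  then have "2 * C * \<omega> (fst p, t) \<le> 2 * C * \<omega> p" using C by (simp add: mult_left_mono)
  then show "norm (H' (fst p, t) - diag_blinfun A B) \<le> 2 * C * \<omega> p"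
    using H'_near_omega[of "(fst p, t)"] by linarith
qed

definition "\<kappa> = \<bar>B\<bar> + \<epsilon>"

lemma kappa: "0 < \<kappa>" "\<kappa> < 1" unfolding \<kappa>_def using eps B by auto

lemma fst_H_ge: "\<bar>A\<bar> * \<bar>fst p\<bar> - \<epsilon> * \<bar>snd p\<bar> \<le> \<bar>fst (H p)\<bar>"
  and snd_H_le: "\<bar>snd (H p)\<bar> \<le> \<kappa> * \<bar>snd p\<bar>"
proof -
  have n: "\<bar>fst (H p) - A * fst p\<bar> \<le> \<epsilon> * \<bar>snd p\<bar>" "\<bar>snd (H p) - B * snd p\<bar> \<le> \<epsilon> * \<bar>snd p\<bar>"
    using H_near_linear_eps[of p] abs_fst_le_norm[of "H p - diag_blinfun A B p"]
      abs_snd_le_norm[of "H p - diag_blinfun A B p"] by auto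
  show "\<bar>A\<bar> * \<bar>fst p\<bar> - \<epsilon> * \<bar>snd p\<bar> \<le> \<bar>fst (H p)\<bar>"
    using n(1) by (simp add: abs_mult[symmetric])
  show "\<bar>snd (H p)\<bar> \<le> \<kappa> * \<bar>snd p\<bar>"
    using n(2) abs_mult[of B "snd p"] unfolding \<kappa>_def distrib_right by linarith
qed

text \<open>Along every orbit the sum of \<open>\<omega>\<close> is bounded: \<open>\<omega>\<close> is dominated by the increment of a bounded
  potential.  This yields growth bounds without any loss in the exponential rates.\<close>

definition "\<rho> = \<bar>A\<bar> - \<epsilon>"
definition "V p = min \<bar>fst p\<bar> (\<rho> * R) powr \<alpha> - 3 / (1 - \<kappa> powr \<alpha>) * \<bar>snd p\<bar> powr \<alpha>"
definition "Kv = 1 + 1 / (\<rho> powr \<alpha> - 1)"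

lemma rho: "1 < \<rho>" unfolding \<rho>_def using eps A by linarith

lemma kappa_powr: "0 < \<kappa> powr \<alpha>" "\<kappa> powr \<alpha> < 1"
  using kappa alpha powr_less_mono2[of \<alpha> \<kappa> 1] by auto

lemma rho_powr: "1 < \<rho> powr \<alpha>"
  using rho alpha by (simp add: gr_one_powr)

text \<open>If |fst p| \<le> |snd p|, one third of the coefficient 3 in \<open>V\<close> pays for a
  possible drop of the first term and the other two for \<open>\<omega> p\<close>. Otherwise |fst p|
  grows by the factor \<open>\<rho>\<close>. Capping the first term at \<rho> R rather than at R
  counts this growth in full for every |fst p| \<le> R, and beyond R the term cannot
  decrease.\<close>

lemma omega_le_potential: "\<omega> p \<le> Kv * (V (H p) - V p)"
proof -
  define x y x' y' where xy: "x = \<bar>fst p\<bar>" "y = \<bar>snd p\<bar>" "x' = \<bar>fst (H p)\<bar>" "y' = \<bar>snd (H p)\<bar>"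
  define k where "k = 3 / (1 - \<kappa> powr \<alpha>)"
  have nn: "0 \<le> x" "0 \<le> y" "0 \<le> x'" "0 \<le> y'" by (auto simp: xy)
  have k: "0 < k" unfolding k_def using kappa_powr by simp
  have "y' powr \<alpha> \<le> \<kappa> powr \<alpha> * y powr \<alpha>"
    using snd_H_le[of p] kappa alpha by (simp add: xy powr_mult[symmetric] powr_mono2)
  then have "k * y' powr \<alpha> \<le> k * (\<kappa> powr \<alpha> * y powr \<alpha>)" using k by (intro mult_left_mono) auto
  moreover have "1 - \<kappa> powr \<alpha> \<noteq> 0" using kappa_powr by simp
  then have "k * (1 - \<kappa> powr \<alpha>) = 3"
    unfolding k_def by (simp only: times_divide_eq_left nonzero_mult_div_cancel_right not_False_eq_True)
  then have "k * (1 - \<kappa> powr \<alpha>) * y powr \<alpha> = 3 * y powr \<alpha>" by simp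
  ultimately have y: "3 * y powr \<alpha> \<le> k * y powr \<alpha> - k * y' powr \<alpha>" by (simp add: algebra_simps)
  define D where "D = min x' (\<rho> * R) powr \<alpha> - min x (\<rho> * R) powr \<alpha>"
  have VD: "D + 3 * y powr \<alpha> \<le> V (H p) - V p"
    using y unfolding V_def D_def xy k_def by (simp add: algebra_simps)
  have rR: "0 < \<rho> * R" using rho R by simp
  have wy: "\<omega> p = (if x \<le> R then x powr \<alpha> else 0) + y powr \<alpha>" unfolding \<omega>_def xy ..
  have Kv: "1 \<le> Kv" "1 \<le> Kv * (\<rho> powr \<alpha> - 1)"
    unfolding Kv_def using rho_powr by (auto simp: distrib_right)
  show ?thesis
  proof (cases "x \<le> y")
    case True
    have "x powr \<alpha> \<le> y powr \<alpha>" using True nn alpha by (intro powr_mono2) auto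
    moreover have "min x (\<rho> * R) powr \<alpha> \<le> x powr \<alpha>" using nn rR alpha by (intro powr_mono2) auto
    ultimately have "\<omega> p \<le> V (H p) - V p"
      using VD wy unfolding D_def by (smt (verit) powr_ge_zero)
    also from calculation have "0 \<le> V (H p) - V p" using omega_nonneg[of p] by linarith
    then have "V (H p) - V p \<le> Kv * (V (H p) - V p)"
      using mult_right_mono[OF Kv(1), of "V (H p) - V p"] by simp
    finally show ?thesis .
  next
    case False
    have "\<epsilon> * y \<le> \<epsilon> * x" using False eps by (intro mult_left_mono) auto
    then have x': "\<rho> * x \<le> x'" using fst_H_ge[of p] unfolding xy \<rho>_def by (simp add: algebra_simps)
    show ?thesis
    proof (cases "x \<le> R")
      case True
      have "\<rho> * x \<le> \<rho> * R" "x \<le> \<rho> * R"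
        using True rho nn R by (auto intro: mult_left_mono order_trans[OF True])
      then have "(\<rho> * x) powr \<alpha> \<le> min x' (\<rho> * R) powr \<alpha>" "min x (\<rho> * R) = x"
        using x' rho nn alpha by (auto intro!: powr_mono2)
      then have "(\<rho> powr \<alpha> - 1) * x powr \<alpha> \<le> D"
        unfolding D_def using rho nn by (simp add: powr_mult left_diff_distrib)
      then have "(\<rho> powr \<alpha> - 1) * x powr \<alpha> + y powr \<alpha> \<le> V (H p) - V p" using VD by (smt (verit) powr_ge_zero)
      then have "Kv * ((\<rho> powr \<alpha> - 1) * x powr \<alpha> + y powr \<alpha>) \<le> Kv * (V (H p) - V p)"
        using Kv by (intro mult_left_mono) auto
      moreover have "1 * x powr \<alpha> + 1 * y powr \<alpha>
          \<le> Kv * (\<rho> powr \<alpha> - 1) * x powr \<alpha> + Kv * y powr \<alpha>"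
        using Kv by (intro add_mono mult_right_mono) auto
      ultimately show ?thesis using True wy by (simp add: distrib_left mult.assoc)
    next
      case F: False
      have "\<rho> * R \<le> x'"
        using x' F rho by (smt (verit) mult_left_mono)
      then have "0 \<le> D" unfolding D_def using nn rR alpha by (auto intro!: powr_mono2)
      then have "y powr \<alpha> \<le> V (H p) - V p" using VD by (smt (verit) powr_ge_zero)
      then show ?thesis
        using F wy Kv mult_mono[of 1 Kv "y powr \<alpha>" "V (H p) - V p"] by auto
    qed
  qed
qed

section \<open>Growth of iterates at the exact rates\<close>

definition "Q = 2 * C / \<bar>B\<bar> * Kv"

text \<open>\<open>Q\<close> is formed with |B|, the smaller of the two rates, so one potential
  serves both c = |A| and c = |B|. By 1 + x \<le> exp x the relative error becomes an increment of
  the potential, which telescopes along orbits.\<close>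

lemma rate_bound:
  assumes "\<bar>B\<bar> \<le> c"
  shows "c + 2 * C * \<omega> p \<le> c * exp (Q * (V (H p) - V p))"
proof -
  have c: "0 < c" using assms B by linarith
  have "2 * C / c \<le> 2 * C / \<bar>B\<bar>" using assms B C by (intro frac_le) auto
  then have "(2 * C / c) * \<omega> p \<le> (2 * C / \<bar>B\<bar>) * (Kv * (V (H p) - V p))"
    using omega_le_potential[of p] omega_nonneg[of p] C B by (intro mult_mono) auto
  then have "1 + (2 * C / c) * \<omega> p \<le> 1 + Q * (V (H p) - V p)" unfolding Q_def by (simp add: mult.assoc)
  also have "\<dots> \<le> exp (Q * (V (H p) - V p))" by (rule exp_ge_add_one_self)
  finally have "c * (1 + (2 * C / c) * \<omega> p) \<le> c * exp (Q * (V (H p) - V p))"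
    using c by (intro mult_left_mono) auto
  then show ?thesis using c by (simp add: distrib_left)
qed

fun DH :: "nat \<Rightarrow> plane \<Rightarrow> plane \<Rightarrow>\<^sub>L plane" where
  "DH 0 p = id_blinfun"
| "DH (Suc n) p = DH n (H p) o\<^sub>L H' p"

lemma DH_derivative: "((H ^^ n) has_derivative DH n p) (at p)"
proof (induction n arbitrary: p)
  case 0 then show ?case by (simp add: id_def id_blinfun.rep_eq)
next
  case (Suc n)
  show ?case
    using has_derivative_compose[OF der[of p] Suc[of "H p"]]
    by (simp add: funpow_Suc_right o_def blinfun_compose.rep_eq del: funpow.simps)
qed

text \<open>The exponential factors telescope: the rate is exactly |A|, and the accumulated
  distortion is the exponential of a single difference of potentials.\<close>

lemma DH_norm: "norm (DH n p) \<le> \<bar>A\<bar> ^ n * exp (Q * (V ((H ^^ n) p) - V p))"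
proof (induction n arbitrary: p)
  case 0 then show ?case by (simp add: norm_blinfun_id_le)
next
  case (Suc n)
  have "norm (H' p) \<le> \<bar>A\<bar> + 2 * C * \<omega> p"
    using norm_triangle_sub[of "H' p" "diag_blinfun A B"] H'_near_omega[of p]
      norm_diag_blinfun_le[of B A] A B by linarith
  also have "\<dots> \<le> \<bar>A\<bar> * exp (Q * (V (H p) - V p))"
    using A B by (intro rate_bound) auto
  finally have 1: "norm (H' p) \<le> \<bar>A\<bar> * exp (Q * (V (H p) - V p))" .
  have "norm (DH (Suc n) p) \<le> norm (DH n (H p)) * norm (H' p)"
    by (simp add: norm_blinfun_compose)
  also have "\<dots> \<le> (\<bar>A\<bar> ^ n * exp (Q * (V ((H ^^ n) (H p)) - V (H p)))) * (\<bar>A\<bar> * exp (Q * (V (H p) - V p)))"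
    using Suc 1 by (intro mult_mono) auto
  also have "\<dots> = \<bar>A\<bar> ^ Suc n * (exp (Q * (V ((H ^^ n) (H p)) - V (H p))) * exp (Q * (V (H p) - V p)))"
    by simp
  also have "exp (Q * (V ((H ^^ n) (H p)) - V (H p))) * exp (Q * (V (H p) - V p))
      = exp (Q * (V ((H ^^ Suc n) p) - V p))"
    by (simp add: exp_add[symmetric] funpow_Suc_right algebra_simps del: funpow.simps)
  finally show ?case .
qed

lemma snd_iterate_le: "\<bar>snd ((H ^^ n) p)\<bar> \<le> \<bar>B\<bar> ^ n * \<bar>snd p\<bar> * exp (Q * (V ((H ^^ n) p) - V p))"
proof (induction n)
  case (Suc n)
  define q where "q = (H ^^ n) p"
  have "\<bar>snd (H q) - B * snd q\<bar> \<le> 2 * C * \<omega> q * \<bar>snd q\<bar>"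
    using H_near_linear_omega[of q] abs_snd_le_norm[of "H q - diag_blinfun A B q"] by simp
  then have "\<bar>snd (H q)\<bar> \<le> (\<bar>B\<bar> + 2 * C * \<omega> q) * \<bar>snd q\<bar>"
    using abs_mult[of B "snd q"] unfolding distrib_right by linarith
  also have "\<dots> \<le> (\<bar>B\<bar> * exp (Q * (V (H q) - V q))) * (\<bar>B\<bar> ^ n * \<bar>snd p\<bar> * exp (Q * (V q - V p)))"
    using Suc rate_bound[of "\<bar>B\<bar>" q] unfolding q_def by (intro mult_mono) auto
  also have "\<dots> = \<bar>B\<bar> ^ Suc n * \<bar>snd p\<bar> * (exp (Q * (V (H q) - V q)) * exp (Q * (V q - V p)))"
    by simp
  also have "exp (Q * (V (H q) - V q)) * exp (Q * (V q - V p)) = exp (Q * (V (H q) - V p))"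
    by (simp add: exp_add[symmetric] algebra_simps)
  finally show ?case by (simp add: q_def)
qed simp

text \<open>A convex forward invariant strip. \<open>V\<close> is bounded above on the plane, but
  its term in the second coordinate is unbounded below, so the distortion is uniformly bounded only
  for orbits that start in a strip.\<close>

definition "T = {p :: plane. \<bar>snd p\<bar> \<le> 1}"

lemma convex_T: "convex T"
proof -
  have T_eq: "T = UNIV \<times> {-1..1}" unfolding T_def by (auto simp: mem_Times_iff abs_le_iff)
  show ?thesis unfolding T_eq by (intro convex_Times convex_UNIV convex_real_interval)
qed

lemma H_in_T: "p \<in> T \<Longrightarrow> H p \<in> T"
proof -
  assume "p \<in> T"
  then have "\<kappa> * \<bar>snd p\<bar> \<le> 1 * 1" using kappa unfolding T_def by (intro mult_mono) auto
  then show ?thesis using snd_H_le[of p] unfolding T_def by simp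
qed

definition "E = exp (Q * ((\<rho> * R) powr \<alpha> + 3 / (1 - \<kappa> powr \<alpha>)))"

lemma Q_nonneg: "0 \<le> Q"
  unfolding Q_def Kv_def using C rho_powr B by (intro mult_nonneg_nonneg) auto

lemma E_ge_1: "1 \<le> E"
  unfolding E_def using Q_nonneg kappa_powr rho R by simp

lemma potential_bound:
  assumes "p \<in> T"
  shows "exp (Q * (V q - V p)) \<le> E"
proof -
  define k where "k = 3 / (1 - \<kappa> powr \<alpha>)"
  have k: "0 < k" unfolding k_def using kappa_powr by simp
  have "V q \<le> (\<rho> * R) powr \<alpha>"
  proof -
    have "min \<bar>fst q\<bar> (\<rho> * R) powr \<alpha> \<le> (\<rho> * R) powr \<alpha>"
      using rho R alpha by (intro powr_mono2) auto
    moreover have "0 \<le> k * \<bar>snd q\<bar> powr \<alpha>" using k by simp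
    ultimately show ?thesis unfolding V_def k_def by linarith
  qed
  moreover have "- k \<le> V p"
  proof -
    have "\<bar>snd p\<bar> powr \<alpha> \<le> 1" using assms alpha unfolding T_def by (simp add: powr_le1)
    then have "k * \<bar>snd p\<bar> powr \<alpha> \<le> k * 1" using k by (intro mult_left_mono) auto
    then show ?thesis unfolding V_def k_def by (smt (verit) powr_ge_zero)
  qed
  ultimately show ?thesis
    unfolding E_def k_def[symmetric] using Q_nonneg by (simp add: mult_left_mono)
qed

lemma iterate_lipschitz:
  assumes "p \<in> T" "q \<in> T"
  shows "norm ((H ^^ n) p - (H ^^ n) q) \<le> E * \<bar>A\<bar> ^ n * norm (p - q)"
proof (rule blinfun_derivative_lipschitz[OF convex_T _ _ assms])
  show "((H ^^ n) has_derivative DH n x) (at x within T)" for x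
    by (rule has_derivative_at_withinI[OF DH_derivative])
  show "norm (DH n x) \<le> E * \<bar>A\<bar> ^ n" if "x \<in> T" for x
    using DH_norm[of n x] mult_left_mono[OF potential_bound[OF that, of "(H ^^ n) x"], of "\<bar>A\<bar> ^ n"]
    by (simp add: mult.commute)
qed

lemma snd_iterate_bound:
  assumes "p \<in> T"
  shows "\<bar>snd ((H ^^ n) p)\<bar> \<le> E * \<bar>B\<bar> ^ n"
proof -
  have "\<bar>snd ((H ^^ n) p)\<bar> \<le> (\<bar>B\<bar> ^ n * \<bar>snd p\<bar>) * exp (Q * (V ((H ^^ n) p) - V p))"
    using snd_iterate_le by simp
  also have "\<dots> \<le> (\<bar>B\<bar> ^ n * 1) * E"
    using assms potential_bound[OF assms] by (intro mult_mono) (auto simp: T_def)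
  finally show ?thesis by (simp add: mult.commute)
qed

end

lemma power_powr_commute: "0 \<le> x \<Longrightarrow> (x ^ k) powr a = (x powr a) ^ k" for x a :: real
  by (induction k) (auto simp: powr_mult)

context planar_hyperbolic_straight begin

section \<open>Logarithms of the length factors\<close>

text \<open>The one-step factor in the recursion for \<open>a\<close>, equal to 1 on the axis. Its
  logarithm turns the product \<open>a\<close> into the sum \<open>S\<close>.\<close>

definition "c n p = slope_den p (b n (H p)) / A"
definition "l n p = ln (c n p)"

fun S :: "nat \<Rightarrow> plane \<Rightarrow> real" where
  "S 0 p = 0"
| "S (Suc n) p = S n (H p) + l n p"

lemma divide_A_le: "\<bar>x\<bar> \<le> y \<Longrightarrow> \<bar>x / A\<bar> \<le> y"
proof -
  assume "\<bar>x\<bar> \<le> y"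
  then have "\<bar>x\<bar> / \<bar>A\<bar> \<le> y / 1" using A by (intro frac_le) auto
  then show ?thesis by simp
qed

lemma c_minus_1: "c n p - 1 = (slope_den p (b n (H p)) - A) / A"
  using A by (auto simp: c_def field_simps)

lemma c_ge: "1/2 \<le> c n p"
proof -
  have "\<bar>c n p - 1\<bar> \<le> (2 * \<epsilon>) / (4 * \<epsilon>)"
    unfolding c_minus_1 abs_divide using slope_den_near[OF b_le] eps by (intro frac_le) auto
  then have "\<bar>c n p - 1\<bar> \<le> 1/2" using eps by simp
  then show ?thesis by linarith
qed

lemma c_near_axis: "\<bar>c n p - 1\<bar> \<le> 2 * C * \<bar>snd p\<bar> powr \<alpha>"
  unfolding c_minus_1
proof (rule divide_A_le)
  have "\<bar>b n (H p) * p21 p\<bar> \<le> 1 * (C * \<bar>snd p\<bar> powr \<alpha>)"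
    unfolding abs_mult using b_le p21_near_axis by (intro mult_mono) auto
  then show "\<bar>slope_den p (b n (H p)) - A\<bar> \<le> 2 * C * \<bar>snd p\<bar> powr \<alpha>"
    using p11_near_axis[of p] unfolding slope_den_def by linarith
qed

definition "Kc = 2 * C + Kb * (\<bar>A\<bar> + \<epsilon>)"

lemma Kc_nonneg: "0 \<le> Kc"
  unfolding Kc_def using C Kb_nonneg A eps by (intro add_nonneg_nonneg mult_nonneg_nonneg) auto

lemma c_holder: "\<bar>c n p - c n q\<bar> \<le> Kc * norm (p - q) powr \<alpha>"
proof -
  define d where "d = norm (p - q) powr \<alpha>"
  have d: "0 \<le> d" unfolding d_def by simp
  have 1: "\<bar>b n (H p) * (p21 p - p21 q)\<bar> \<le> 1 * (C * d)"
    unfolding abs_mult d_def using b_le partials_holder(3) by (intro mult_mono) auto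
  have "\<bar>b n (H p) - b n (H q)\<bar> \<le> Kb * ((\<bar>A\<bar> + \<epsilon>) * d)"
    unfolding d_def using b_holder norm_H_powr Kb_nonneg by (meson mult_left_mono order_trans)
  moreover have "\<bar>p21 q\<bar> \<le> 1" using partials_near(3)[of q] eps B by linarith
  ultimately have 2: "\<bar>(b n (H p) - b n (H q)) * p21 q\<bar> \<le> (Kb * ((\<bar>A\<bar> + \<epsilon>) * d)) * 1"
    unfolding abs_mult by (intro mult_mono) auto
  have "slope_den p (b n (H p)) - slope_den q (b n (H q))
      = (p11 p - p11 q) + b n (H p) * (p21 p - p21 q) + (b n (H p) - b n (H q)) * p21 q"
    unfolding slope_den_def by (simp add: algebra_simps)
  then have "\<bar>slope_den p (b n (H p)) - slope_den q (b n (H q))\<bar> \<le> C * d + C * d + Kb * ((\<bar>A\<bar> + \<epsilon>) * d)"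
    using 1 2 partials_holder(1)[of p q, folded d_def] by linarith
  also have "\<dots> = Kc * d" unfolding Kc_def by (simp add: algebra_simps)
  finally have "\<bar>(slope_den p (b n (H p)) - slope_den q (b n (H q))) / A\<bar> \<le> Kc * d"
    by (rule divide_A_le)
  then show ?thesis by (simp add: c_def d_def diff_divide_distrib)
qed

lemma l_near_axis: "\<bar>l n p\<bar> \<le> 4 * C * \<bar>snd p\<bar> powr \<alpha>"
  using abs_ln_diff_le[OF c_ge[of n p], of 1] c_near_axis[of n p] unfolding l_def by simp

lemma l_holder: "\<bar>l n p - l n q\<bar> \<le> 2 * Kc * norm (p - q) powr \<alpha>"
  using abs_ln_diff_le[OF c_ge[of n p] c_ge[of n q]] c_holder[of n p q] unfolding l_def by simp

text \<open>\<open>n\<close> enters only through the slope, which is multiplied by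
  \<open>p21\<close>. The increment therefore carries both the contraction of slopes and the
  vanishing on the axis.\<close>

lemma l_increment: "\<bar>l (Suc n) p - l n p\<bar> \<le> 2 * C * \<theta> ^ n * \<bar>snd p\<bar> powr \<alpha>"
proof -
  have "\<bar>(b (Suc n) (H p) - b n (H p)) * p21 p\<bar> \<le> \<theta> ^ n * (C * \<bar>snd p\<bar> powr \<alpha>)"
    unfolding abs_mult using b_increment p21_near_axis theta(1) by (intro mult_mono) auto
  then have "\<bar>((b (Suc n) (H p) - b n (H p)) * p21 p) / A\<bar> \<le> \<theta> ^ n * (C * \<bar>snd p\<bar> powr \<alpha>)"
    by (rule divide_A_le)
  moreover have "c (Suc n) p - c n p = ((b (Suc n) (H p) - b n (H p)) * p21 p) / A"
    unfolding c_def slope_den_def by (simp add: diff_divide_distrib[symmetric] left_diff_distrib del: b.simps)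
  ultimately have "\<bar>c (Suc n) p - c n p\<bar> \<le> \<theta> ^ n * (C * \<bar>snd p\<bar> powr \<alpha>)" by simp
  then have "\<bar>l (Suc n) p - l n p\<bar> \<le> 2 * (\<theta> ^ n * (C * \<bar>snd p\<bar> powr \<alpha>))"
    unfolding l_def by (intro order_trans[OF abs_ln_diff_le[OF c_ge c_ge]] mult_left_mono) auto
  then show ?thesis by (simp add: mult.assoc mult.left_commute)
qed

lemma a_eq_exp: "a n p = exp (S n p)"
proof (induction n arbitrary: p)
  case (Suc n)
  have "0 < c n p" using c_ge[of n p] by linarith
  then have "exp (l n p) = c n p" by (simp add: l_def)
  then show ?case using Suc by (simp add: exp_add c_def)
qed simp

text \<open>A rate strictly above both \<theta> (slopes) and \<kappa> powr \<alpha> (second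
  coordinate along orbits), so that even when these two coincide no polynomial factor appears.
  \<open>Ks\<close> is chosen such that Ks (\<kappa> powr \<alpha>) + 2 C \<le> Ks \<nu>, which
  closes the induction in \<open>S_increment\<close>.\<close>

definition "\<nu> = (1 + max \<theta> (\<kappa> powr \<alpha>)) / 2"
definition "Ks = 4 * C + 2 * C / (\<nu> - \<kappa> powr \<alpha>)"

lemma nu: "\<theta> \<le> \<nu>" "\<kappa> powr \<alpha> < \<nu>" "0 < \<nu>" "\<nu> < 1"
  unfolding \<nu>_def using theta(1) theta_less_1 kappa_powr by (auto simp: max_def)

lemma Ks: "4 * C \<le> Ks" "2 * C \<le> Ks * (\<nu> - \<kappa> powr \<alpha>)" "0 \<le> Ks"
proof -
  show "4 * C \<le> Ks" "0 \<le> Ks" unfolding Ks_def using C nu by auto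
  have "2 * C = 2 * C / (\<nu> - \<kappa> powr \<alpha>) * (\<nu> - \<kappa> powr \<alpha>)" using nu by simp
  also have "\<dots> \<le> Ks * (\<nu> - \<kappa> powr \<alpha>)"
    unfolding Ks_def using nu C by (intro mult_right_mono) auto
  finally show "2 * C \<le> Ks * (\<nu> - \<kappa> powr \<alpha>)" .
qed

lemma S_increment: "\<bar>S (Suc n) p - S n p\<bar> \<le> Ks * \<nu> ^ n * \<bar>snd p\<bar> powr \<alpha>"
proof (induction n arbitrary: p)
  case 0
  have "4 * C * \<bar>snd p\<bar> powr \<alpha> \<le> Ks * \<bar>snd p\<bar> powr \<alpha>" using Ks by (intro mult_right_mono) auto
  then show ?case using l_near_axis[of 0 p] by simp
next
  case (Suc n)
  define y where "y = \<bar>snd p\<bar> powr \<alpha>"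
  have y: "0 \<le> y" unfolding y_def by simp
  have "\<bar>snd (H p)\<bar> powr \<alpha> \<le> \<kappa> powr \<alpha> * y"
    unfolding y_def using snd_H_le[of p] kappa alpha
    by (simp add: powr_mult[symmetric] powr_mono2)
  then have "Ks * \<nu> ^ n * \<bar>snd (H p)\<bar> powr \<alpha> \<le> Ks * \<nu> ^ n * (\<kappa> powr \<alpha> * y)"
    using Ks nu by (intro mult_left_mono) auto
  then have "\<bar>S (Suc n) (H p) - S n (H p)\<bar> \<le> Ks * \<nu> ^ n * (\<kappa> powr \<alpha> * y)"
    using Suc[of "H p"] by linarith
  moreover have "2 * C * \<theta> ^ n * y \<le> 2 * C * \<nu> ^ n * y"
    using C y nu theta(1) by (intro mult_right_mono mult_left_mono power_mono) auto
  then have "\<bar>l (Suc n) p - l n p\<bar> \<le> 2 * C * \<nu> ^ n * y"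
    using l_increment[of n p] unfolding y_def by linarith
  moreover have "2 * C * (\<nu> ^ n * y) \<le> Ks * (\<nu> - \<kappa> powr \<alpha>) * (\<nu> ^ n * y)"
    using Ks(2) y nu by (intro mult_right_mono) auto
  moreover have "S (Suc (Suc n)) p - S (Suc n) p
      = (S (Suc n) (H p) - S n (H p)) + (l (Suc n) p - l n p)"
    by simp
  ultimately have "\<bar>S (Suc (Suc n)) p - S (Suc n) p\<bar> \<le> Ks * \<nu> ^ n * (\<kappa> powr \<alpha> * y)
      + Ks * (\<nu> - \<kappa> powr \<alpha>) * (\<nu> ^ n * y)"
    by (smt (verit) mult.assoc)
  also have "\<dots> = Ks * \<nu> ^ Suc n * y" by (simp add: algebra_simps)
  finally show ?case unfolding y_def .
qed

definition "Slim p = lim (\<lambda>n. S n p)"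
definition "Kl = Ks / (1 - \<nu>)"

lemma Kl_nonneg: "0 \<le> Kl" unfolding Kl_def using Ks nu by simp

lemma S_tendsto: "p \<in> T \<Longrightarrow> (\<lambda>n. S n p) \<longlonglongrightarrow> Slim p"
  and S_Slim: "p \<in> T \<Longrightarrow> \<bar>S n p - Slim p\<bar> \<le> Kl * \<nu> ^ n"
proof -
  assume "p \<in> T"
  then have "\<bar>snd p\<bar> powr \<alpha> \<le> 1" using alpha unfolding T_def by (simp add: powr_le1)
  then have "Ks * \<nu> ^ n * \<bar>snd p\<bar> powr \<alpha> \<le> Ks * \<nu> ^ n * 1" for n
    using Ks nu by (intro mult_left_mono) auto
  then have "\<bar>S (Suc n) p - S n p\<bar> \<le> Ks * \<nu> ^ n" for n
    using S_increment[of n p] by (smt (verit) mult.right_neutral)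
  then obtain s where s: "(\<lambda>n. S n p) \<longlonglongrightarrow> s" "\<And>n. \<bar>S n p - s\<bar> \<le> Ks / (1 - \<nu>) * \<nu> ^ n"
    using geometric_increments_limit[of "\<lambda>n. S n p" Ks \<nu>] nu by auto
  then show "(\<lambda>n. S n p) \<longlonglongrightarrow> Slim p" "\<bar>S n p - Slim p\<bar> \<le> Kl * \<nu> ^ n"
    unfolding Slim_def Kl_def using limI[OF s(1)] by auto
qed

lemma Slim_le: "p \<in> T \<Longrightarrow> \<bar>Slim p\<bar> \<le> Kl"
  using S_Slim[of p 0] by simp

lemma S_le: "p \<in> T \<Longrightarrow> \<bar>S n p\<bar> \<le> 2 * Kl"
proof -
  assume p: "p \<in> T"
  have "Kl * \<nu> ^ n \<le> Kl * 1" using Kl_nonneg nu by (intro mult_left_mono) (auto simp: power_le_one)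
  then show ?thesis using S_Slim[OF p, of n] Slim_le[OF p] by simp
qed

text \<open>At the k-th orbit point the slope still comes from n - k - 1 pull-backs, which fixes the
  index of \<open>l\<close>. The bounds on \<open>l\<close> are uniform in this index.\<close>

lemma S_eq_sum: "S n p = (\<Sum>k<n. l (n - Suc k) ((H ^^ k) p))"
proof (induction n arbitrary: p)
  case (Suc n)
  have "(\<Sum>k<Suc n. l (Suc n - Suc k) ((H ^^ k) p)) = l n p + (\<Sum>k<n. l (n - Suc k) ((H ^^ Suc k) p))"
    by (subst sum.lessThan_Suc_shift) simp
  also have "(\<Sum>k<n. l (n - Suc k) ((H ^^ Suc k) p)) = S n (H p)"
    unfolding Suc by (simp add: funpow_Suc_right del: funpow.simps)
  finally show ?case by simp
qed simp

section \<open>Hoelder continuity of the logarithms at the sharp exponent\<close>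

definition "\<gamma> = \<alpha> * (- ln \<bar>B\<bar>) / (ln \<bar>A\<bar> - ln \<bar>B\<bar>)"

lemma gamma: "0 < \<gamma>" "\<gamma> < \<alpha>"
proof -
  have lns: "0 < ln \<bar>A\<bar>" "ln \<bar>B\<bar> < 0" using A B by auto
  show "0 < \<gamma>" unfolding \<gamma>_def using lns alpha by (intro divide_pos_pos mult_pos_pos) auto
  have "\<alpha> * (- ln \<bar>B\<bar>) < \<alpha> * (ln \<bar>A\<bar> - ln \<bar>B\<bar>)" using lns alpha by (intro mult_strict_left_mono) auto
  then show "\<gamma> < \<alpha>" unfolding \<gamma>_def using lns by (subst pos_divide_less_eq) auto
qed

lemma S_holder:
  obtains K where "0 \<le> K"
    "\<And>n p q. p \<in> T \<Longrightarrow> q \<in> T \<Longrightarrow> norm (p - q) \<le> 1 \<Longrightarrow> \<bar>S n p - S n q\<bar> \<le> K * norm (p - q) powr \<gamma>"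
proof -
  \<comment> \<open>\<open>sum_min_geometric_le\<close> is applied to \<alpha>-th powers of the
    rates and of the distance; its exponent \<tau> becomes \<alpha> \<tau> = \<gamma> in terms of
    the distance itself.\<close>
  define X Y where "X = \<bar>A\<bar> powr \<alpha>" and "Y = \<bar>B\<bar> powr \<alpha>"
  have X: "1 < X" unfolding X_def using A alpha by (simp add: gr_one_powr)
  have Y: "0 < Y" "Y < 1" unfolding Y_def using B alpha powr_less_mono2[of \<alpha> "\<bar>B\<bar>" 1] by auto
  define \<tau> where "\<tau> = - ln Y / (ln X - ln Y)"
  have tau: "\<alpha> * \<tau> = \<gamma>"
  proof -
    have "ln X - ln Y = \<alpha> * (ln \<bar>A\<bar> - ln \<bar>B\<bar>)"
      unfolding X_def Y_def using A B by (simp add: ln_powr right_diff_distrib)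
    moreover have "ln Y = \<alpha> * ln \<bar>B\<bar>" unfolding Y_def using B by (simp add: ln_powr)
    ultimately show ?thesis unfolding \<tau>_def \<gamma>_def using alpha by simp
  qed
  obtain K where K: "0 \<le> K"
    "\<And>n d. 0 < d \<Longrightarrow> d \<le> 1 \<Longrightarrow> (\<Sum>k<n. min (X ^ k * d) (Y ^ k)) \<le> K * d powr \<tau>"
    using sum_min_geometric_le[OF X Y] unfolding \<tau>_def by blast
  \<comment> \<open>Covers both estimates of a summand: \<open>2 * Kc\<close> from comparing the two
    orbits, \<open>8 * C\<close> from the two separate values near the axis, each with the
    distortion \<open>E\<close> raised to \<alpha>.\<close>
  define K2 where "K2 = (2 * Kc + 8 * C) * E powr \<alpha>"
  have K2: "0 \<le> K2" unfolding K2_def using Kc_nonneg C by simp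
  have "\<bar>S n p - S n q\<bar> \<le> (K2 * K) * norm (p - q) powr \<gamma>"
    if pq: "p \<in> T" "q \<in> T" "norm (p - q) \<le> 1" for n p q
  proof (cases "p = q")
    case False
    define d where "d = norm (p - q) powr \<alpha>"
    have d: "0 < d" "d \<le> 1" unfolding d_def using False pq(3) alpha by (auto simp: powr_le1)
    have increment: "\<bar>l m ((H ^^ k) p) - l m ((H ^^ k) q)\<bar> \<le> K2 * min (X ^ k * d) (Y ^ k)" for m k
    proof -
      define P P' where "P = (H ^^ k) p" and "P' = (H ^^ k) q"
      have "norm (P - P') powr \<alpha> \<le> (E * \<bar>A\<bar> ^ k * norm (p - q)) powr \<alpha>"
        unfolding P_def P'_def using iterate_lipschitz[OF pq(1,2)] alpha by (intro powr_mono2) auto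
      also have "\<dots> = E powr \<alpha> * (X ^ k * d)"
        using E_ge_1 by (simp add: powr_mult X_def d_def power_powr_commute)
      finally have 1: "norm (P - P') powr \<alpha> \<le> E powr \<alpha> * (X ^ k * d)" .
      have ax: "\<bar>snd Z\<bar> powr \<alpha> \<le> E powr \<alpha> * Y ^ k" if "Z = P \<or> Z = P'" for Z
      proof -
        have "\<bar>snd Z\<bar> powr \<alpha> \<le> (E * \<bar>B\<bar> ^ k) powr \<alpha>"
          using that snd_iterate_bound[OF pq(1)] snd_iterate_bound[OF pq(2)] alpha
          unfolding P_def P'_def by (intro powr_mono2) auto
        also have "\<dots> = E powr \<alpha> * Y ^ k"
          using E_ge_1 by (simp add: powr_mult Y_def power_powr_commute)
        finally show ?thesis .
      qed
      have "\<bar>l m P - l m P'\<bar> \<le> 2 * Kc * (E powr \<alpha> * (X ^ k * d))"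
        using l_holder[of m P P'] 1 Kc_nonneg by (smt (verit) mult_left_mono)
      also have "\<dots> \<le> (2 * Kc + 8 * C) * (E powr \<alpha> * (X ^ k * d))"
        using C d X by (intro mult_right_mono) auto
      finally have u: "\<bar>l m P - l m P'\<bar> \<le> K2 * (X ^ k * d)" by (simp add: K2_def mult.assoc)
      have "4 * C * \<bar>snd Z\<bar> powr \<alpha> \<le> 4 * C * (E powr \<alpha> * Y ^ k)" if "Z = P \<or> Z = P'" for Z
        using ax[OF that] C by (intro mult_left_mono) auto
      then have "\<bar>l m Z\<bar> \<le> 4 * C * (E powr \<alpha> * Y ^ k)" if "Z = P \<or> Z = P'" for Z
        using that by (intro order_trans[OF l_near_axis])
      from this[of P] this[of P'] have "\<bar>l m P - l m P'\<bar> \<le> 8 * C * (E powr \<alpha> * Y ^ k)" by simp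
      also have "\<dots> \<le> (2 * Kc + 8 * C) * (E powr \<alpha> * Y ^ k)"
        using Kc_nonneg Y by (intro mult_right_mono) auto
      finally have v: "\<bar>l m P - l m P'\<bar> \<le> K2 * Y ^ k" by (simp add: K2_def mult.assoc)
      show ?thesis using u v unfolding P_def P'_def by (auto simp: min_def)
    qed
    have "\<bar>S n p - S n q\<bar> = \<bar>\<Sum>k<n. (l (n - Suc k) ((H ^^ k) p) - l (n - Suc k) ((H ^^ k) q))\<bar>"
      unfolding S_eq_sum sum_subtractf ..
    also have "\<dots> \<le> (\<Sum>k<n. \<bar>l (n - Suc k) ((H ^^ k) p) - l (n - Suc k) ((H ^^ k) q)\<bar>)"
      by (rule sum_abs)
    also have "\<dots> \<le> (\<Sum>k<n. K2 * min (X ^ k * d) (Y ^ k))" by (intro sum_mono increment)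
    also have "\<dots> \<le> K2 * (K * d powr \<tau>)"
      unfolding sum_distrib_left[symmetric] using K(2)[OF d] K2 by (intro mult_left_mono) auto
    also have "d powr \<tau> = norm (p - q) powr \<gamma>"
      unfolding d_def powr_powr tau ..
    finally show ?thesis by (simp add: mult.assoc)
  qed simp
  then show ?thesis using K2 K(1) by (intro that[of "K2 * K"]) auto
qed

section \<open>Passage to the limit\<close>

definition \<phi>' :: "plane \<Rightarrow> plane \<Rightarrow>\<^sub>L real" where
  "\<phi>' p = exp (Slim p) *\<^sub>R (fst_blinfun + blim p *\<^sub>R snd_blinfun)"

lemma phi'_apply: "\<phi>' p v = exp (Slim p) * (fst v + blim p * snd v)"
  by (simp add: \<phi>'_def blinfun.add_left blinfun.scaleR_left)

text \<open>The error is uniform over \<open>T\<close> and linear in the norm of \<open>v\<close>,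
  the form of convergence that allows limit and derivative to be exchanged.\<close>

lemma phi_derivative_converges:
  "p \<in> T \<Longrightarrow> \<bar>a n p * (fst v + b n p * snd v) - \<phi>' p v\<bar>
    \<le> (2 * exp (2 * Kl) * Kl * \<nu> ^ n + exp Kl * (1 / (1 - \<theta>) * \<theta> ^ n)) * norm v"
proof -
  assume p: "p \<in> T"
  have "\<bar>exp (S n p) - exp (Slim p)\<bar> \<le> exp (2 * Kl) * \<bar>S n p - Slim p\<bar>"
    using S_le[OF p, of n] Slim_le[OF p] Kl_nonneg by (intro abs_exp_diff_le) auto
  also have "\<dots> \<le> exp (2 * Kl) * (Kl * \<nu> ^ n)"
    using S_Slim[OF p] by (intro mult_left_mono) auto
  finally have 1: "\<bar>exp (S n p) - exp (Slim p)\<bar> \<le> exp (2 * Kl) * (Kl * \<nu> ^ n)" .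
  have "\<bar>b n p * snd v\<bar> \<le> 1 * norm v"
    unfolding abs_mult using b_le abs_snd_le_norm by (intro mult_mono) auto
  then have "\<bar>fst v + b n p * snd v\<bar> \<le> 2 * norm v"
    using abs_fst_le_norm[of v] by linarith
  then have t1: "\<bar>(exp (S n p) - exp (Slim p)) * (fst v + b n p * snd v)\<bar>
      \<le> (exp (2 * Kl) * (Kl * \<nu> ^ n)) * (2 * norm v)"
    unfolding abs_mult using 1 Kl_nonneg nu by (intro mult_mono) auto
  have "exp (Slim p) \<le> exp Kl" using Slim_le[OF p] by simp
  moreover have "\<bar>(b n p - blim p) * snd v\<bar> \<le> (1 / (1 - \<theta>) * \<theta> ^ n) * norm v"
    unfolding abs_mult using b_blim abs_snd_le_norm theta(1) theta_less_1 by (intro mult_mono) auto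
  ultimately have t2: "\<bar>exp (Slim p) * ((b n p - blim p) * snd v)\<bar>
      \<le> exp Kl * ((1 / (1 - \<theta>) * \<theta> ^ n) * norm v)"
    unfolding abs_mult[of "exp (Slim p)"] by (intro mult_mono) auto
  have "a n p * (fst v + b n p * snd v) - \<phi>' p v
    = (exp (S n p) - exp (Slim p)) * (fst v + b n p * snd v) + exp (Slim p) * ((b n p - blim p) * snd v)"
    unfolding a_eq_exp phi'_apply by (simp add: algebra_simps)
  then have "\<bar>a n p * (fst v + b n p * snd v) - \<phi>' p v\<bar>
    \<le> (exp (2 * Kl) * (Kl * \<nu> ^ n)) * (2 * norm v) + exp Kl * ((1 / (1 - \<theta>) * \<theta> ^ n) * norm v)"
    using t1 t2 by linarith
  then show ?thesis by (simp add: algebra_simps)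
qed

lemma phi_limit_exists:
  "\<exists>\<psi>. \<forall>p\<in>T. (\<lambda>n. \<phi> n p) \<longlonglongrightarrow> \<psi> p \<and> (\<psi> has_derivative \<phi>' p) (at p within T)"
proof (rule has_derivative_sequence[OF convex_T])
  show "(\<phi> n has_derivative (\<lambda>v. a n p * (fst v + b n p * snd v))) (at p within T)" for n p
    by (rule has_derivative_at_withinI[OF phi_derivative])
  fix e :: real assume "0 < e"
  have "(\<lambda>n. 2 * exp (2 * Kl) * Kl * \<nu> ^ n + exp Kl * (1 / (1 - \<theta>) * \<theta> ^ n))
      \<longlonglongrightarrow> 2 * exp (2 * Kl) * Kl * 0 + exp Kl * (1 / (1 - \<theta>) * 0)"
    using nu theta(1) theta_less_1
    by (intro tendsto_add tendsto_mult tendsto_const LIMSEQ_realpow_zero) auto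
  then have "\<forall>\<^sub>F n in sequentially.
      2 * exp (2 * Kl) * Kl * \<nu> ^ n + exp Kl * (1 / (1 - \<theta>) * \<theta> ^ n) < e"
    using \<open>0 < e\<close> by (intro order_tendstoD(2)[where y=0]) simp_all
  then show "\<forall>\<^sub>F n in sequentially. \<forall>p\<in>T. \<forall>v.
      norm (a n p * (fst v + b n p * snd v) - \<phi>' p v) \<le> e * norm v"
  proof (rule eventually_mono, intro ballI allI)
    fix n p v assume n: "2 * exp (2 * Kl) * Kl * \<nu> ^ n + exp Kl * (1 / (1 - \<theta>) * \<theta> ^ n) < e"
      and p: "p \<in> T"
    show "norm (a n p * (fst v + b n p * snd v) - \<phi>' p v) \<le> e * norm v"
      using phi_derivative_converges[OF p, of n v] mult_right_mono[OF less_imp_le[OF n] norm_ge_zero[of v]]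
      by simp
  qed
next
  show "(0 :: plane) \<in> T" by (simp add: T_def)
  have "\<phi> n 0 = 0" for n by (induction n) (auto simp: zero)
  then show "(\<lambda>n. \<phi> n 0) \<longlonglongrightarrow> 0" by simp
qed

theorem linearized_coordinate:
  obtains \<psi> where "C1_holder_on \<gamma> (cball 0 (1/2)) \<psi>" "(\<psi> has_derivative fst) (at 0)"
    "\<And>p. \<bar>snd p\<bar> \<le> 1 \<Longrightarrow> \<psi> (H p) = A * \<psi> p"
proof -
  obtain \<psi> where \<psi>: "\<And>p. p \<in> T \<Longrightarrow> (\<lambda>n. \<phi> n p) \<longlonglongrightarrow> \<psi> p"
    "\<And>p. p \<in> T \<Longrightarrow> (\<psi> has_derivative \<phi>' p) (at p within T)"
    using phi_limit_exists by blast
  \<comment> \<open>Radius 1/2 makes all distances at most 1, as \<open>S_holder\<close> and the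
    passage from exponent \<alpha> to \<gamma> require.\<close>
  define D where "D = cball (0 :: plane) (1/2)"
  have DT: "D \<subseteq> T"
  proof
    fix p assume "p \<in> D"
    then have "norm p \<le> 1/2" by (simp add: D_def)
    then show "p \<in> T" using abs_snd_le_norm[of p] by (simp add: T_def)
  qed
  have D1: "norm (p - q) \<le> 1" if "p \<in> D" "q \<in> D" for p q
    using norm_triangle_ineq4[of p q] that by (simp add: D_def)
  have d0: "0 \<in> interior T"
  proof (rule interiorI)
    show "ball (0 :: plane) 1 \<subseteq> T"
    proof
      fix p :: plane assume "p \<in> ball 0 1"
      then have "norm p < 1" by simp
      then show "p \<in> T" using abs_snd_le_norm[of p] by (simp add: T_def)
    qed
  qed auto
  obtain K where K: "0 \<le> K"
    "\<And>n p q. p \<in> T \<Longrightarrow> q \<in> T \<Longrightarrow> norm (p - q) \<le> 1 \<Longrightarrow> \<bar>S n p - S n q\<bar> \<le> K * norm (p - q) powr \<gamma>"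
    using S_holder by blast
  have Slim_holder: "\<bar>Slim p - Slim q\<bar> \<le> K * norm (p - q) powr \<gamma>" if "p \<in> T" "q \<in> T" "norm (p - q) \<le> 1" for p q
  proof (rule LIMSEQ_le_const2)
    show "(\<lambda>n. \<bar>S n p - S n q\<bar>) \<longlonglongrightarrow> \<bar>Slim p - Slim q\<bar>"
      by (intro tendsto_intros S_tendsto that)
  qed (use K(2) that in auto)
  have "C1_holder_on \<gamma> D \<psi>"
  proof (rule C1_holder_onI[OF gamma(1)])
    show "(\<psi> has_derivative \<phi>' p) (at p within D)" if "p \<in> D" for p
      using \<psi>(2)[of p] that DT by (auto intro: has_derivative_subset)
    fix p q assume pq: "p \<in> D" "q \<in> D"
    define d where "d = norm (p - q) powr \<gamma>"
    have pqT: "p \<in> T" "q \<in> T" using pq DT by auto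
    have "norm (p - q) powr \<alpha> \<le> d"
      unfolding d_def using D1[OF pq] gamma by (intro powr_mono') auto
    then have bl: "\<bar>blim p - blim q\<bar> \<le> Kb * d"
      using blim_holder[of p q] Kb_nonneg by (meson mult_left_mono order_trans)
    have "\<bar>exp (Slim p) - exp (Slim q)\<bar> \<le> exp Kl * \<bar>Slim p - Slim q\<bar>"
      using Slim_le pqT by (intro abs_exp_diff_le) (auto simp: abs_le_iff)
    also have "\<dots> \<le> exp Kl * (K * d)"
      unfolding d_def using Slim_holder[OF pqT D1[OF pq]] by (intro mult_left_mono) auto
    finally have ex: "\<bar>exp (Slim p) - exp (Slim q)\<bar> \<le> exp Kl * (K * d)" .
    show "norm (\<phi>' p - \<phi>' q) \<le> (exp Kl * K * 2 + exp Kl * Kb) * norm (p - q) powr \<gamma>"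
    proof (rule norm_blinfun_bound)
      show "0 \<le> (exp Kl * K * 2 + exp Kl * Kb) * norm (p - q) powr \<gamma>"
        using K(1) Kb_nonneg by simp
      fix v :: plane
      have "\<bar>blim p * snd v\<bar> \<le> 1 * norm v"
        unfolding abs_mult by (intro mult_mono blim_le abs_snd_le_norm) auto
      then have "\<bar>fst v + blim p * snd v\<bar> \<le> 2 * norm v"
        using abs_fst_le_norm[of v] by linarith
      then have t1: "\<bar>(exp (Slim p) - exp (Slim q)) * (fst v + blim p * snd v)\<bar>
          \<le> (exp Kl * (K * d)) * (2 * norm v)"
        unfolding abs_mult using ex K(1) by (intro mult_mono) (auto simp: d_def)
      have "exp (Slim q) \<le> exp Kl" using Slim_le[OF pqT(2)] by simp
      moreover have "\<bar>(blim p - blim q) * snd v\<bar> \<le> (Kb * d) * norm v"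
        unfolding abs_mult using bl abs_snd_le_norm Kb_nonneg by (intro mult_mono) (auto simp: d_def)
      ultimately have t2: "\<bar>exp (Slim q) * ((blim p - blim q) * snd v)\<bar> \<le> exp Kl * ((Kb * d) * norm v)"
        unfolding abs_mult[of "exp (Slim q)"] by (intro mult_mono) auto
      have "(\<phi>' p - \<phi>' q) v = (exp (Slim p) - exp (Slim q)) * (fst v + blim p * snd v)
          + exp (Slim q) * ((blim p - blim q) * snd v)"
        by (simp add: blinfun.diff_left phi'_apply algebra_simps)
      then have "\<bar>(\<phi>' p - \<phi>' q) v\<bar> \<le> (exp Kl * (K * d)) * (2 * norm v) + exp Kl * ((Kb * d) * norm v)"
        using t1 t2 by linarith
      then show "norm ((\<phi>' p - \<phi>' q) v) \<le> (exp Kl * K * 2 + exp Kl * Kb) * norm (p - q) powr \<gamma> * norm v"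
        by (simp add: algebra_simps d_def)
    qed
  qed
  moreover have "(\<psi> has_derivative fst) (at 0)"
  proof -
    \<comment> \<open>All logarithms vanish on the axis; together with \<open>blim_zero\<close> the
      limiting gradient at the origin is (1, 0).\<close>
    have "S n 0 = 0" for n
    proof (induction n)
      case (Suc n) then show ?case using l_near_axis[of n 0] alpha by (simp add: zero)
    qed simp
    then have "Slim 0 = 0" unfolding Slim_def by simp
    then have "blinfun_apply (\<phi>' 0) = fst" by (auto simp: phi'_apply blim_zero)
    then show ?thesis using \<psi>(2)[of 0] d0 interior_subset at_within_interior[OF d0] by auto
  qed
  moreover have "\<psi> (H p) = A * \<psi> p" if "\<bar>snd p\<bar> \<le> 1" for p
  proof -
    have p: "p \<in> T" using that by (simp add: T_def)
    \<comment> \<open>The conjugacy is the recursion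
      \<open>\<phi> (Suc n) p = \<phi> n (H p) / A\<close> read in the limit.\<close>
    have "(\<lambda>n. \<phi> n (H p) / A) \<longlonglongrightarrow> \<psi> (H p) / A"
      using A by (intro tendsto_divide tendsto_const \<psi>(1) H_in_T p) auto
    moreover have "(\<lambda>n. \<phi> (Suc n) p) \<longlonglongrightarrow> \<psi> p"
      using \<psi>(1)[OF p] by (rule LIMSEQ_Suc)
    ultimately have "\<psi> (H p) / A = \<psi> p" using LIMSEQ_unique by auto
    then show ?thesis using A by (auto simp: field_simps)
  qed
  ultimately show ?thesis using that unfolding D_def by blast
qed

end

section \<open>Cutting off a germ\<close>

text \<open>A projection landing in the open ball would force \<open>p\<close> itself into the open
  ball. This places projections on the sphere, where a cut-off derivative vanishes.\<close>

lemma closest_point_cball_outside: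
  fixes p :: "'a::euclidean_space"
  assumes "0 < s" "s \<le> norm p"
  shows "norm (closest_point (cball 0 s) p) = s"
proof (rule ccontr)
  assume *: "norm (closest_point (cball 0 s) p) \<noteq> s"
  have ri: "rel_interior (cball 0 s) = ball (0 :: 'a) s"
    using assms by (subst rel_interior_nonempty_interior) auto
  have mem: "closest_point (cball 0 s) p \<in> cball 0 s"
    using assms by (intro closest_point_in_set) auto
  then have "closest_point (cball 0 s) p \<in> rel_interior (cball 0 s)"
    using * mem by (simp add: ri)
  then have "p \<in> rel_interior (cball 0 s)"
    using assms affine_hull_nonempty_interior[of "cball (0 :: 'a) s"]
    by (subst (asm) closest_point_in_rel_interior) auto
  then show False using assms by (simp add: ri)
qed

section \<open>Products and cut-off functions of class C^{1,gamma}\<close>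

lemma C1_holder_on_const: "0 < \<gamma> \<Longrightarrow> C1_holder_on \<gamma> S (\<lambda>x. c)"
  by (rule C1_holder_onI[where G'="\<lambda>_. 0" and C=0]) (auto simp: zero_blinfun.rep_eq)

text \<open>Meant for quadratic maps: their derivative is Lipschitz in the base point, hence Hoelder
  of every exponent up to 1 on bounded sets.\<close>

lemma C1_holder_on_linear_derivative:
  fixes G :: "'a::real_normed_vector \<Rightarrow> 'b::real_normed_vector"
  assumes lin: "bounded_linear G'" and der: "\<And>x. (G has_derivative blinfun_apply (G' x)) (at x)"
    and "bounded S" "0 < \<gamma>" "\<gamma> \<le> 1"
  shows "C1_holder_on \<gamma> S G"
proof -
  obtain K where K: "\<And>x. norm (G' x) \<le> norm x * K"
    using bounded_linear.bounded[OF lin] by blast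
  have "C1_holder_on 1 S G"
  proof (rule C1_holder_onI)
    show "(G has_derivative blinfun_apply (G' x)) (at x within S)" for x
      using der by (rule has_derivative_at_withinI)
    show "norm (G' x - G' y) \<le> K * norm (x - y) powr 1" for x y
      using K[of "x - y"] bounded_linear.linear[OF lin] by (simp add: linear_diff mult.commute)
  qed simp
  then show ?thesis using assms(3-5) by (rule C1_holder_on_exponent_mono)
qed

lemma C1_holder_on_inner_self:
  assumes "bounded S" "0 < \<gamma>" "\<gamma> \<le> 1"
  shows "C1_holder_on \<gamma> S (\<lambda>p :: 'a::euclidean_space. p \<bullet> p)"
proof (rule C1_holder_on_linear_derivative[where G'="\<lambda>p. 2 *\<^sub>R blinfun_inner_right p"])
  show "bounded_linear (\<lambda>p :: 'a. 2 *\<^sub>R blinfun_inner_right p)"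
    by (intro bounded_linear_intros)
  show "((\<lambda>p. p \<bullet> p) has_derivative blinfun_apply (2 *\<^sub>R blinfun_inner_right x)) (at x)" for x :: 'a
    by (auto intro!: derivative_eq_intros simp: blinfun.scaleR_left blinfun_inner_right.rep_eq inner_commute)
qed (use assms in auto)

lemma C1_holder_on_scaleR_pair:
  assumes "bounded S" "0 < \<gamma>" "\<gamma> \<le> 1"
  shows "C1_holder_on \<gamma> S (\<lambda>q :: real \<times> 'b::real_normed_vector. fst q *\<^sub>R snd q)"
proof (rule C1_holder_on_linear_derivative[where
      G'="\<lambda>q. fst q *\<^sub>R snd_blinfun + (blinfun_scaleR_left (snd q) o\<^sub>L fst_blinfun)"])
  show "bounded_linear (\<lambda>q :: real \<times> 'b. fst q *\<^sub>R snd_blinfun + (blinfun_scaleR_left (snd q) o\<^sub>L fst_blinfun))"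
  proof (rule bounded_linear_add)
    show "bounded_linear (\<lambda>q :: real \<times> 'b. fst q *\<^sub>R (snd_blinfun :: (real \<times> 'b) \<Rightarrow>\<^sub>L 'b))"
      by (rule bounded_linear_compose[OF bounded_linear_scaleR_left bounded_linear_fst])
    have "bounded_linear (\<lambda>q :: real \<times> 'b. blinfun_scaleR_left (snd q))"
      by (rule bounded_linear_compose[OF bounded_linear_blinfun_scaleR_left bounded_linear_snd])
    from bounded_linear_compose[OF
        bounded_bilinear.bounded_linear_left[OF bounded_bilinear_blinfun_compose, of fst_blinfun] this]
    show "bounded_linear (\<lambda>q :: real \<times> 'b. blinfun_scaleR_left (snd q) o\<^sub>L fst_blinfun)" .
  qed
  show "((\<lambda>q. fst q *\<^sub>R snd q) has_derivative
      blinfun_apply (fst x *\<^sub>R snd_blinfun + (blinfun_scaleR_left (snd x) o\<^sub>L fst_blinfun))) (at x)"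
    for x :: "real \<times> 'b"
  proof -
    have "((\<lambda>q. fst q *\<^sub>R snd q) has_derivative (\<lambda>v. fst x *\<^sub>R snd v + fst v *\<^sub>R snd x)) (at x)"
      by (intro has_derivative_scaleR has_derivative_fst has_derivative_snd has_derivative_ident)
    moreover have "blinfun_apply (fst x *\<^sub>R snd_blinfun + (blinfun_scaleR_left (snd x) o\<^sub>L fst_blinfun))
        = (\<lambda>v. fst x *\<^sub>R snd v + fst v *\<^sub>R snd x)"
      by (simp add: fun_eq_iff blinfun.add_left blinfun.scaleR_left)
    ultimately show ?thesis by (simp only:)
  qed
qed (use assms in auto)

text \<open>The product is the pair (f, g) followed by the quadratic scaling map; compactness of
  \<open>S\<close> bounds the range of the pair.\<close>

lemma C1_holder_on_scaleR:
  fixes f :: "'a::real_normed_vector \<Rightarrow> real" and g :: "'a \<Rightarrow> 'b::real_normed_vector"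
  assumes f: "C1_holder_on \<gamma> S f" and g: "C1_holder_on \<gamma> S g" and S: "convex S" "compact S"
    and \<gamma>: "0 < \<gamma>" "\<gamma> \<le> 1"
  shows "C1_holder_on \<gamma> S (\<lambda>x. f x *\<^sub>R g x)"
proof -
  have fg: "C1_holder_on \<gamma> S (\<lambda>x. (f x, g x))" by (rule C1_holder_on_Pair[OF f g \<gamma>(1)])
  have b: "bounded ((\<lambda>x. (f x, g x)) ` S)"
    using C1_holder_on_imp_continuous_on[OF fg] S(2)
    by (intro compact_imp_bounded compact_continuous_image)
  have "C1_holder_on \<gamma> S (\<lambda>x. (\<lambda>q. fst q *\<^sub>R snd q) ((f x, g x)))"
    by (rule C1_holder_on_compose[OF fg C1_holder_on_scaleR_pair[OF b \<gamma>]])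
      (use S \<gamma> compact_imp_bounded in auto)
  then show ?thesis by simp
qed

text \<open>A quadratic spline with knots \<open>0\<close>, \<open>1/2\<close> and \<open>1\<close>.\<close>

definition bump :: "real \<Rightarrow> real" where
  "bump t = 1 - 2 * (max 0 t)\<^sup>2 + 4 * (max 0 (t - 1/2))\<^sup>2 - 2 * (max 0 (t - 1))\<^sup>2"

definition bump' :: "real \<Rightarrow> real" where
  "bump' t = - 4 * max 0 t + 8 * max 0 (t - 1/2) - 4 * max 0 (t - 1)"

lemma bump_eq: "t \<le> 0 \<Longrightarrow> bump t = 1" "1 \<le> t \<Longrightarrow> bump t = 0" "1 \<le> t \<Longrightarrow> bump' t = 0"
  unfolding bump_def bump'_def by (auto simp: power2_eq_square algebra_simps)

lemma abs_bump'_le: "\<bar>bump' t\<bar> \<le> 2"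
  unfolding bump'_def by (auto simp: max_def abs_le_iff)

lemma bump'_lipschitz: "\<bar>bump' s - bump' t\<bar> \<le> 16 * \<bar>s - t\<bar>"
proof -
  have m: "\<bar>max 0 (s - c) - max 0 (t - c)\<bar> \<le> \<bar>s - t\<bar>" for c
    by (cases "0 \<le> s - c"; cases "0 \<le> t - c") (simp_all add: max_def)
  have l: "\<bar>- 4 * u + 8 * v - 4 * w\<bar> \<le> 16 * d" if "\<bar>u\<bar> \<le> d" "\<bar>v\<bar> \<le> d" "\<bar>w\<bar> \<le> d" for u v w d :: real
    using that by linarith
  have "bump' s - bump' t = - 4 * (max 0 (s - 0) - max 0 (t - 0))
     + 8 * (max 0 (s - 1/2) - max 0 (t - 1/2)) - 4 * (max 0 (s - 1) - max 0 (t - 1))"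
    unfolding bump'_def by simp
  then show ?thesis using l[OF m[of 0] m[of "1/2"] m[of 1]] by (simp only:)
qed

lemma abs_bump_le: "\<bar>bump t\<bar> \<le> 1"
proof -
  consider "t \<le> 0" | "0 < t" "t \<le> 1/2" | "1/2 < t" "t < 1" | "1 \<le> t" by linarith
  then show ?thesis
  proof cases
    case 2
    then have "t\<^sup>2 \<le> (1/2)\<^sup>2" by (intro power_mono) auto
    then show ?thesis using 2 by (simp add: bump_def power2_eq_square)
  next
    case 3
    then have "bump t = 2 * (1 - t)\<^sup>2" by (simp add: bump_def power2_eq_square algebra_simps)
    moreover have "(1 - t)\<^sup>2 \<le> (1/2)\<^sup>2" using 3 by (intro power_mono) auto
    ultimately show ?thesis by (simp add: power2_eq_square)
  qed (auto simp: bump_eq)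
qed

lemma has_field_derivative_pos_part_square:
  "((\<lambda>t. (max 0 t)\<^sup>2) has_field_derivative 2 * max 0 t) (at (t :: real))"
proof (rule has_field_derivative_holder_remainder[of 1])
  fix s :: real
  have sq: "0 \<le> s * s" "0 \<le> t * t" by auto
  have "\<bar>(max 0 s)\<^sup>2 - (max 0 t)\<^sup>2 - 2 * max 0 t * (s - t)\<bar> \<le> (s - t)\<^sup>2"
  proof (cases "0 \<le> s"; cases "0 \<le> t")
    assume st: "0 \<le> s" "\<not> 0 \<le> t"
    then have "s * t \<le> 0" by (simp add: mult_nonneg_nonpos)
    then show ?thesis using st sq by (simp add: power2_eq_square algebra_simps)
  next
    assume st: "\<not> 0 \<le> s" "0 \<le> t"
    then have "s * t \<le> 0" by (simp add: mult_nonpos_nonneg)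
    moreover have "(max 0 s)\<^sup>2 - (max 0 t)\<^sup>2 - 2 * max 0 t * (s - t) = t * t - 2 * (s * t)"
      "(s - t)\<^sup>2 = s * s + t * t - 2 * (s * t)"
      using st by (simp_all add: power2_eq_square algebra_simps)
    ultimately show ?thesis using sq by linarith
  next
    assume "0 \<le> s" "0 \<le> t"
    then have "(max 0 s)\<^sup>2 - (max 0 t)\<^sup>2 - 2 * max 0 t * (s - t) = (s - t)\<^sup>2"
      by (simp add: power2_eq_square algebra_simps)
    then show ?thesis by simp
  qed (simp add: max_def)
  then show "\<bar>(max 0 s)\<^sup>2 - (max 0 t)\<^sup>2 - 2 * max 0 t * (s - t)\<bar> \<le> 1 * \<bar>s - t\<bar> powr 1 * \<bar>s - t\<bar>"
    by (simp add: power2_eq_square)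
qed simp

lemma has_field_derivative_bump: "(bump has_field_derivative bump' t) (at t)"
proof -
  have "((\<lambda>t. (max 0 (t - c))\<^sup>2) has_field_derivative 2 * max 0 (t - c) * 1) (at t)" for c
    by (rule DERIV_chain2[where f="\<lambda>t. (max 0 t)\<^sup>2" and g="\<lambda>t. t - c"])
      (auto intro!: derivative_eq_intros has_field_derivative_pos_part_square)
  then have sh: "((\<lambda>t. (max 0 (t - c))\<^sup>2) has_field_derivative 2 * max 0 (t - c)) (at t)" for c
    by simp
  have "((\<lambda>t. 1 - 2 * (max 0 t)\<^sup>2 + 4 * (max 0 (t - 1/2))\<^sup>2 - 2 * (max 0 (t - 1))\<^sup>2)
      has_field_derivative
      0 - 2 * (2 * max 0 t) + 4 * (2 * max 0 (t - 1/2)) - 2 * (2 * max 0 (t - 1))) (at t)"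
    by (intro DERIV_diff DERIV_add DERIV_const DERIV_cmult has_field_derivative_pos_part_square sh)
  then show ?thesis by (simp add: bump_def[abs_def] bump'_def)
qed

lemma C1_holder_on_real:
  fixes f :: "real \<Rightarrow> real"
  assumes "0 < \<gamma>" and der: "\<And>x. x \<in> S \<Longrightarrow> (f has_field_derivative f' x) (at x within S)"
    and hol: "\<And>x y. x \<in> S \<Longrightarrow> y \<in> S \<Longrightarrow> \<bar>f' x - f' y\<bar> \<le> C * \<bar>x - y\<bar> powr \<gamma>"
  shows "C1_holder_on \<gamma> S f"
proof (rule C1_holder_onI[OF \<open>0 < \<gamma>\<close>])
  show "(f has_derivative blinfun_apply (blinfun_scaleR_left (f' x))) (at x within S)" if "x \<in> S" for x
  proof -
    have "blinfun_apply (blinfun_scaleR_left (f' x)) = (*) (f' x)"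
      by (auto simp: fun_eq_iff)
    then show ?thesis using der[OF that] by (simp only: has_field_derivative_def)
  qed
  fix x y assume "x \<in> S" "y \<in> S"
  moreover have "norm (blinfun_scaleR_left (f' x) - blinfun_scaleR_left (f' y)) \<le> \<bar>f' x - f' y\<bar>"
    by (rule norm_blinfun_bound)
      (auto simp: blinfun.diff_left right_diff_distrib[symmetric] abs_mult)
  ultimately show "norm (blinfun_scaleR_left (f' x) - blinfun_scaleR_left (f' y)) \<le> C * norm (x - y) powr \<gamma>"
    using hol[of x y] by simp
qed

lemma C1_holder_on_bump: "bounded S \<Longrightarrow> 0 < \<gamma> \<Longrightarrow> \<gamma> \<le> 1 \<Longrightarrow> C1_holder_on \<gamma> S bump"
  by (rule C1_holder_on_exponent_mono[OF C1_holder_on_real[where f'=bump' and C=16]])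
    (auto intro: has_field_derivative_at_within has_field_derivative_bump bump'_lipschitz)

text \<open>The extension is \<open>L\<close> plus the product of \<open>g = f - L\<close> with a
  bump \<eta> at scale \<rho>. The gradient of the bump is of order 1 / \<rho> while
  \<open>g\<close> is of order \<rho> powr (1 + \<alpha>), so the derivative of the product is small
  for small \<rho>. Points where \<open>f\<close> is already linear stay so, which protects a
  straightened axis.\<close>

theorem cutoff_extension:
  fixes f :: "'a::euclidean_space \<Rightarrow> 'b::real_normed_vector" and L :: "'a \<Rightarrow>\<^sub>L 'b"
  assumes "0 < r" and \<alpha>: "0 < \<alpha>" "\<alpha> \<le> 1" and f: "C1_holder_on \<alpha> (cball 0 r) f" and f0: "f 0 = 0"
    and L: "(f has_derivative blinfun_apply L) (at 0)" and "0 < \<epsilon>"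
  obtains H H' C \<rho> R where "0 \<le> C" "0 < \<rho>" "0 < R"
    "\<forall>p. (H has_derivative blinfun_apply (H' p)) (at p)"
    "\<forall>p. norm (H' p - L) \<le> \<epsilon>"
    "\<forall>p q. norm (H' p - H' q) \<le> C * norm (p - q) powr \<alpha>"
    "H' 0 = L" "\<forall>p. norm p \<le> \<rho> \<longrightarrow> H p = f p"
    "\<forall>p. R < norm p \<longrightarrow> H' p = L" "\<forall>p. R < norm p \<longrightarrow> H p = L p"
    "\<forall>p. norm p \<le> r \<longrightarrow> f p = L p \<longrightarrow> H p = L p" "R \<le> r"
proof -
  have "0 \<in> interior (cball 0 r :: 'a set)" using \<open>0 < r\<close> by simp
  with f L obtain f' C0 where f': "0 \<le> C0"
    "\<forall>x\<in>cball 0 r. (f has_derivative blinfun_apply (f' x)) (at x within cball 0 r)"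
    "continuous_on (cball 0 r) f'"
    "\<forall>x\<in>cball 0 r. \<forall>y\<in>cball 0 r. norm (f' x - f' y) \<le> C0 * norm (x - y) powr \<alpha>"
    "blinfun_apply (f' 0) = blinfun_apply L"
    by (rule C1_holder_onE_at) (rule that)
  note f' = f'[rule_format]
  have f'0: "f' 0 = L" using f'(5) by (simp add: blinfun_eqI)
  \<comment> \<open>17 = 1 + 16: with u = C0 (2 \<rho>) powr \<alpha>, the derivative of
    \<open>g\<close> contributes u, and |g| \<le> 2 \<rho> u times the bound 8 / \<rho> for the
    gradient of \<eta> contributes 16 u. The added 1 in the denominator covers C0 = 0.\<close>
  define \<rho> where "\<rho> = min (r / 3) ((\<epsilon> / (17 * C0 + 1)) powr (1 / \<alpha>) / 2)"
  have pos: "0 < \<epsilon> / (17 * C0 + 1)" using f'(1) \<open>0 < \<epsilon>\<close> by simp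
  have \<rho>: "0 < \<rho>" "2 * \<rho> < r" unfolding \<rho>_def using pos \<open>0 < r\<close> by auto
  have small: "17 * C0 * (2 * \<rho>) powr \<alpha> \<le> \<epsilon>"
  proof -
    have "(2 * \<rho>) powr \<alpha> \<le> ((\<epsilon> / (17 * C0 + 1)) powr (1 / \<alpha>)) powr \<alpha>"
      using \<rho> \<alpha> by (intro powr_mono2) (auto simp: \<rho>_def)
    also have "\<dots> = \<epsilon> / (17 * C0 + 1)" using \<alpha> f'(1) \<open>0 < \<epsilon>\<close> by (simp add: powr_powr)
    finally have "17 * C0 * (2 * \<rho>) powr \<alpha> \<le> 17 * C0 * (\<epsilon> / (17 * C0 + 1))"
      using f'(1) by (intro mult_left_mono) auto
    also have "\<dots> \<le> \<epsilon>" using f'(1) \<open>0 < \<epsilon>\<close> by (simp add: divide_le_eq algebra_simps)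
    finally show ?thesis .
  qed
  define g where "g p = f p - L p" for p
  \<comment> \<open>The squared norm keeps the cut-off smooth at the origin. \<eta> is 1 up to
    radius \<rho> and 0 once \<open>p \<bullet> p\<close> reaches twice \<rho> squared, hence
    already inside \<open>K\<close>.\<close>
  define t where "t p = (p \<bullet> p) / \<rho>\<^sup>2 - 1" for p :: 'a
  define \<eta> where "\<eta> p = bump (t p)" for p
  define K where "K = cball (0 :: 'a) (2 * \<rho>)"
  have Kr: "p \<in> cball 0 r" "p \<in> ball 0 r" if "p \<in> K" for p using that \<rho> by (auto simp: K_def)
  have g': "(g has_derivative blinfun_apply (f' p - L)) (at p)" if "p \<in> ball 0 r" for p
  proof -
    have "(f has_derivative blinfun_apply (f' p)) (at p)"
      using f'(2)[of p] that at_within_interior[of p "cball 0 r"] by auto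
    then show ?thesis unfolding g_def blinfun.diff_left minus_blinfun.rep_eq
      by (intro has_derivative_diff bounded_linear_imp_has_derivative blinfun.bounded_linear_right)
  qed
  have g'_le: "norm (f' p - L) \<le> C0 * (2 * \<rho>) powr \<alpha>" if "p \<in> K" for p
  proof -
    have "norm (f' p - L) \<le> C0 * norm p powr \<alpha>"
      using f'(4)[of p 0] Kr[OF that] \<open>0 < r\<close> by (simp add: f'0)
    also have "\<dots> \<le> C0 * (2 * \<rho>) powr \<alpha>"
      using that f'(1) \<alpha> by (intro mult_left_mono powr_mono2) (auto simp: K_def)
    finally show ?thesis .
  qed
  have g_le: "norm (g p) \<le> C0 * (2 * \<rho>) powr \<alpha> * (2 * \<rho>)" if "p \<in> K" for p
  proof -
    have "norm (g p - g 0) \<le> C0 * (2 * \<rho>) powr \<alpha> * norm (p - 0)"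
    proof (rule blinfun_derivative_lipschitz[of K _ "\<lambda>p. f' p - L"])
      show "(g has_derivative blinfun_apply (f' x - L)) (at x within K)" if "x \<in> K" for x
        using g'[OF Kr(2)[OF that]] by (rule has_derivative_at_withinI)
    qed (use g'_le that \<rho> in \<open>auto simp: K_def\<close>)
    also have "\<dots> \<le> C0 * (2 * \<rho>) powr \<alpha> * (2 * \<rho>)"
      using that f'(1) by (intro mult_left_mono) (auto simp: K_def)
    finally show ?thesis by (simp add: g_def f0)
  qed
  define \<eta>d where "\<eta>d p = (bump' (t p) * (2 / \<rho>\<^sup>2)) *\<^sub>R blinfun_inner_right p" for p :: 'a
  have \<eta>d: "(\<eta> has_derivative blinfun_apply (\<eta>d p)) (at p)" for p
  proof -
    have "(t has_derivative (\<lambda>v. (2 / \<rho>\<^sup>2) * (p \<bullet> v))) (at p)"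
    proof -
      have "((\<lambda>p. inverse (\<rho>\<^sup>2) * (p \<bullet> p) - 1) has_derivative
          (\<lambda>v. inverse (\<rho>\<^sup>2) * (p \<bullet> v + v \<bullet> p) - 0)) (at p)"
        by (intro has_derivative_diff has_derivative_mult_right has_derivative_inner
            has_derivative_ident has_derivative_const)
      moreover have "(\<lambda>v. inverse (\<rho>\<^sup>2) * (p \<bullet> v + v \<bullet> p) - 0) = (\<lambda>v. (2 / \<rho>\<^sup>2) * (p \<bullet> v))"
      proof
        show "inverse (\<rho>\<^sup>2) * (p \<bullet> v + v \<bullet> p) - 0 = (2 / \<rho>\<^sup>2) * (p \<bullet> v)" for v
          by (simp add: inner_commute[of v p] divide_inverse)
      qed
      moreover have "t = (\<lambda>p. inverse (\<rho>\<^sup>2) * (p \<bullet> p) - 1)"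
        by (simp add: t_def[abs_def] divide_inverse mult.commute)
      ultimately show ?thesis by (simp only:)
    qed
    from has_derivative_compose[OF this has_field_derivative_bump[unfolded has_field_derivative_def]]
    have "((\<lambda>p. bump (t p)) has_derivative (\<lambda>v. bump' (t p) * ((2 / \<rho>\<^sup>2) * (p \<bullet> v)))) (at p)" .
    moreover have "blinfun_apply (\<eta>d p) = (\<lambda>v. bump' (t p) * ((2 / \<rho>\<^sup>2) * (p \<bullet> v)))"
      by (simp add: \<eta>d_def blinfun.scaleR_left fun_eq_iff)
    ultimately show ?thesis by (simp only: \<eta>_def[abs_def])
  qed
  have \<eta>d_le: "norm (\<eta>d p) \<le> 8 / \<rho>" if "p \<in> K" for p
  proof -
    have "norm (blinfun_inner_right p) \<le> norm p"
      by (rule norm_blinfun_bound) (auto simp: Cauchy_Schwarz_ineq2)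
    then have "norm (\<eta>d p) \<le> (2 * (2 / \<rho>\<^sup>2)) * (2 * \<rho>)"
      unfolding \<eta>d_def norm_scaleR abs_mult using abs_bump'_le[of "t p"] that
      by (intro mult_mono) (auto simp: K_def)
    also have "\<dots> = 8 / \<rho>" using \<rho>(1) by (simp add: power2_eq_square)
    finally show ?thesis .
  qed
  define D0 where "D0 p = \<eta> p *\<^sub>R (f' p - L) + (blinfun_scaleR_left (g p) o\<^sub>L \<eta>d p)" for p
  have D0: "((\<lambda>p. \<eta> p *\<^sub>R g p) has_derivative blinfun_apply (D0 p)) (at p)" if "p \<in> ball 0 r" for p
  proof -
    have "blinfun_apply (D0 p) = (\<lambda>v. \<eta> p *\<^sub>R (f' p - L) v + \<eta>d p v *\<^sub>R g p)"
      by (simp add: D0_def blinfun.add_left blinfun.scaleR_left fun_eq_iff)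
    then show ?thesis using has_derivative_scaleR[OF \<eta>d[of p] g'[OF that]] by (simp only:)
  qed
  have D0_le: "norm (D0 p) \<le> \<epsilon>" if "p \<in> K" for p
  proof -
    have "norm (blinfun_scaleR_left (g p)) \<le> norm (g p)"
      by (rule norm_blinfun_bound) (auto simp: mult.commute)
    then have "norm (blinfun_scaleR_left (g p) o\<^sub>L \<eta>d p) \<le> norm (g p) * norm (\<eta>d p)"
      using norm_blinfun_compose mult_right_mono norm_ge_zero by (meson order_trans)
    also have "\<dots> \<le> (C0 * (2 * \<rho>) powr \<alpha> * (2 * \<rho>)) * (8 / \<rho>)"
      using g_le[OF that] \<eta>d_le[OF that] f'(1) \<rho>(1) by (intro mult_mono) auto
    also have "\<dots> = 16 * (C0 * (2 * \<rho>) powr \<alpha>)" using \<rho>(1) by simp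
    finally have 1: "norm (blinfun_scaleR_left (g p) o\<^sub>L \<eta>d p) \<le> 16 * (C0 * (2 * \<rho>) powr \<alpha>)" .
    have "norm (\<eta> p *\<^sub>R (f' p - L)) \<le> 1 * (C0 * (2 * \<rho>) powr \<alpha>)"
      unfolding norm_scaleR \<eta>_def using g'_le[OF that] abs_bump_le f'(1) by (intro mult_mono) auto
    then have "norm (D0 p) \<le> 17 * (C0 * (2 * \<rho>) powr \<alpha>)"
      unfolding D0_def using 1 norm_triangle_ineq[of "\<eta> p *\<^sub>R (f' p - L)" "blinfun_scaleR_left (g p) o\<^sub>L \<eta>d p"]
      by linarith
    then show ?thesis using small by (simp add: mult.assoc)
  qed
  have far: "\<eta> p = 0" "\<eta>d p = 0" if "2 * \<rho>\<^sup>2 \<le> p \<bullet> p" for p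
  proof -
    have "1 \<le> t p" unfolding t_def using that \<rho>(1) by (simp add: field_simps)
    then show "\<eta> p = 0" "\<eta>d p = 0" by (auto simp: \<eta>_def \<eta>d_def bump_eq)
  qed
  have far': "2 * \<rho>\<^sup>2 < p \<bullet> p" if "2 * \<rho> \<le> norm p" for p :: 'a
  proof -
    have "(2 * \<rho>)\<^sup>2 \<le> (norm p)\<^sup>2" using that \<rho>(1) by (intro power_mono) auto
    then have "4 * \<rho>\<^sup>2 \<le> p \<bullet> p" by (simp add: power2_norm_eq_inner power_mult_distrib)
    moreover have "0 < \<rho>\<^sup>2" using \<rho>(1) by (rule zero_less_power)
    ultimately show ?thesis by linarith
  qed
  obtain C where C: "0 \<le> C"
    "\<And>x y. x \<in> K \<Longrightarrow> y \<in> K \<Longrightarrow> norm (D0 x - D0 y) \<le> C * norm (x - y) powr \<alpha>"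
  proof -
    have cc: "convex (cball (0::'a) r)" "compact (cball (0::'a) r)" "bounded (cball (0::'a) r)" by auto
    have tC: "C1_holder_on \<alpha> (cball 0 r) t"
    proof -
      have "C1_holder_on \<alpha> (cball 0 r) (\<lambda>p::'a. (p \<bullet> p) * (1 / \<rho>\<^sup>2))"
        by (rule C1_holder_on_linear_compose[OF bounded_linear_mult_left
              C1_holder_on_inner_self[OF cc(3) \<alpha>] cc(1,3) \<alpha>(1)])
      from C1_holder_on_diff[OF this C1_holder_on_const[of \<alpha> _ 1] cc(1,3) \<alpha>(1)]
      show ?thesis using \<alpha> by (simp add: t_def[abs_def])
    qed
    have "bounded (t ` cball 0 r)"
      by (intro compact_imp_bounded compact_continuous_image C1_holder_on_imp_continuous_on[OF tC] cc)
    then have "C1_holder_on \<alpha> (cball 0 r) (\<lambda>p. bump (t p))"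
      by (intro C1_holder_on_compose[OF tC C1_holder_on_bump[OF _ \<alpha>], of "t ` cball 0 r"] imageI cc \<alpha>)
    then have \<eta>C: "C1_holder_on \<alpha> (cball 0 r) \<eta>" by (simp add: \<eta>_def[abs_def])
    have gC: "C1_holder_on \<alpha> (cball 0 r) g"
      unfolding g_def[abs_def]
      by (intro C1_holder_on_diff f C1_holder_on_linear blinfun.bounded_linear_right cc \<alpha>)
    have "C1_holder_on \<alpha> (cball 0 r) (\<lambda>p. \<eta> p *\<^sub>R g p)"
      by (rule C1_holder_on_scaleR[OF \<eta>C gC cc(1,2) \<alpha>])
    then obtain G' C where G': "0 \<le> C"
      "\<forall>x\<in>cball 0 r. ((\<lambda>p. \<eta> p *\<^sub>R g p) has_derivative blinfun_apply (G' x)) (at x within cball 0 r)"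
      "continuous_on (cball 0 r) G'"
      "\<forall>x\<in>cball 0 r. \<forall>y\<in>cball 0 r. norm (G' x - G' y) \<le> C * norm (x - y) powr \<alpha>"
      by (rule C1_holder_onE) (rule that)
    \<comment> \<open>Uniqueness at interior points identifies the explicit derivative with the
      abstract one, so \<open>D0\<close> inherits a Hoelder bound on \<open>K\<close>.\<close>
    have "G' x = D0 x" if "x \<in> K" for x
    proof -
      have "((\<lambda>p. \<eta> p *\<^sub>R g p) has_derivative blinfun_apply (G' x)) (at x)"
        using G'(2)[rule_format, OF Kr(1)[OF that]] Kr(2)[OF that] at_within_interior[of x "cball 0 r"] by auto
      from has_derivative_unique[OF this D0[OF Kr(2)[OF that]]]
      show ?thesis by (simp add: blinfun_eqI)
    qed
    then show ?thesis using that[of C] G'(1,4) Kr(1) by metis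
  qed
  \<comment> \<open>The derivative is extended by precomposition with the nearest-point projection
    to \<open>K\<close>. The projection is 1-Lipschitz, so the Hoelder bound becomes global, and
    outside \<open>K\<close> the result is \<open>L\<close> because \<open>D0\<close> vanishes on
    the bounding sphere.\<close>
  define pr where "pr = closest_point K"
  have Kcl: "convex K" "closed K" "K \<noteq> {}" using \<rho>(1) by (auto simp: K_def)
  have pr_in: "pr p \<in> K" for p unfolding pr_def using Kcl by (intro closest_point_in_set)
  have pr_lip: "norm (pr p - pr q) \<le> norm (p - q)" for p q
    using closest_point_lipschitz[OF Kcl, of p q] by (simp add: pr_def dist_norm)
  have pr_id: "pr p = p" if "p \<in> K" for p unfolding pr_def using that by (rule closest_point_self)
  have D0far: "D0 (pr p) = 0" if "2 * \<rho> \<le> norm p" for p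
  proof -
    have "norm (pr p) = 2 * \<rho>"
      unfolding pr_def K_def using that \<rho>(1) by (intro closest_point_cball_outside) auto
    then have "2 * \<rho>\<^sup>2 \<le> pr p \<bullet> pr p" using far'[of "pr p"] by simp
    then show ?thesis by (simp add: D0_def far blinfun_eqI)
  qed
  define H where "H p = L p + \<eta> p *\<^sub>R g p" for p
  define H' where "H' p = L + D0 (pr p)" for p
  have der: "(H has_derivative blinfun_apply (H' p)) (at p)" for p
  proof (cases "norm p < 2 * \<rho>")
    case True
    then have p: "p \<in> K" by (simp add: K_def)
    show ?thesis
      unfolding H_def[abs_def] H'_def pr_id[OF p] plus_blinfun.rep_eq
      by (intro has_derivative_add D0 Kr(2) p bounded_linear_imp_has_derivative blinfun.bounded_linear_right)
  next
    case False
    have "(H has_derivative blinfun_apply L) (at p)"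
    proof (rule has_derivative_transform_within_open)
      show "(blinfun_apply L has_derivative blinfun_apply L) (at p)"
        by (intro bounded_linear_imp_has_derivative blinfun.bounded_linear_right)
      show "open {q :: 'a. 2 * \<rho>\<^sup>2 < q \<bullet> q}" by (intro open_Collect_less continuous_intros)
      show "p \<in> {q. 2 * \<rho>\<^sup>2 < q \<bullet> q}" using far' False by simp
      show "L q = H q" if "q \<in> {q. 2 * \<rho>\<^sup>2 < q \<bullet> q}" for q
        using that by (simp add: H_def far)
    qed
    then show ?thesis using D0far False by (simp add: H'_def)
  qed
  show ?thesis
  proof (rule that[of C \<rho> "2 * \<rho>" H H'])
    show "\<forall>p q. norm (H' p - H' q) \<le> C * norm (p - q) powr \<alpha>"
    proof (intro allI)
      fix p q
      have "norm (H' p - H' q) \<le> C * norm (pr p - pr q) powr \<alpha>"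
        using C(2)[OF pr_in pr_in] by (simp add: H'_def)
      also have "\<dots> \<le> C * norm (p - q) powr \<alpha>"
        using pr_lip C(1) \<alpha> by (intro mult_left_mono powr_mono2) auto
      finally show "norm (H' p - H' q) \<le> C * norm (p - q) powr \<alpha>" .
    qed
    show "\<forall>p. norm p \<le> \<rho> \<longrightarrow> H p = f p"
    proof (intro allI impI)
      fix p :: 'a assume "norm p \<le> \<rho>"
      then have "(norm p)\<^sup>2 \<le> \<rho>\<^sup>2" by (intro power_mono) auto
      then have "t p \<le> 0" unfolding t_def using \<rho>(1) by (simp add: power2_norm_eq_inner divide_le_eq)
      then show "H p = f p" by (simp add: H_def \<eta>_def bump_eq g_def)
    qed
    have "0 \<in> K" using \<rho>(1) by (simp add: K_def)
    then show "H' 0 = L" by (simp add: H'_def pr_id D0_def f'0 g_def f0 blinfun_eqI \<eta>d_def)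
    show "\<forall>p. 2 * \<rho> < norm p \<longrightarrow> H p = L p" using far far' by (auto simp: H_def less_imp_le)
    show "\<forall>p. norm p \<le> r \<longrightarrow> f p = L p \<longrightarrow> H p = L p" by (simp add: H_def g_def)
  qed (use C \<rho> der D0_le pr_in D0far in \<open>auto simp: H'_def\<close>)
qed

section \<open>Germs at the origin\<close>

text \<open>\<open>q \<epsilon>\<close> is the smallest \<theta> that the last condition admits. As
  \<epsilon> tends to 0, its product with |A| + \<epsilon> tends to (|A| |B| / |A|^2) |A| = |B| <
  1.\<close>

lemma hyperbolic_constants:
  fixes A B :: real
  assumes A: "1 < \<bar>A\<bar>" and B: "0 < \<bar>B\<bar>" "\<bar>B\<bar> < 1"
  obtains \<epsilon> \<theta> where "0 < \<epsilon>" "4 * \<epsilon> \<le> \<bar>A\<bar> - 1" "\<bar>B\<bar> + 4 * \<epsilon> \<le> 1"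
    "0 < \<theta>" "\<theta> * (\<bar>A\<bar> + \<epsilon>) < 1" "(\<bar>A\<bar> + \<epsilon>) * (\<bar>B\<bar> + \<epsilon>) + \<epsilon>\<^sup>2 \<le> \<theta> * (\<bar>A\<bar> - 2 * \<epsilon>)\<^sup>2"
proof -
  define q where "q \<epsilon> = ((\<bar>A\<bar> + \<epsilon>) * (\<bar>B\<bar> + \<epsilon>) + \<epsilon>\<^sup>2) / (\<bar>A\<bar> - 2 * \<epsilon>)\<^sup>2" for \<epsilon>
  have "((\<lambda>\<epsilon>. q \<epsilon> * (\<bar>A\<bar> + \<epsilon>)) \<longlongrightarrow>
      ((\<bar>A\<bar> + 0) * (\<bar>B\<bar> + 0) + 0\<^sup>2) / (\<bar>A\<bar> - 2 * 0)\<^sup>2 * (\<bar>A\<bar> + 0)) (at_right 0)"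
    unfolding q_def using A by (intro tendsto_intros) auto
  moreover have "((\<bar>A\<bar> + 0) * (\<bar>B\<bar> + 0) + 0\<^sup>2) / (\<bar>A\<bar> - 2 * 0)\<^sup>2 * (\<bar>A\<bar> + 0) = \<bar>B\<bar>"
  proof -
    have "(c * d) / c\<^sup>2 * c = d" if "1 < c" for c d :: real
      using that by (simp add: power2_eq_square)
    from this[of "\<bar>A\<bar>" "\<bar>B\<bar>"] show ?thesis using A by simp
  qed
  ultimately have "((\<lambda>\<epsilon>. q \<epsilon> * (\<bar>A\<bar> + \<epsilon>)) \<longlongrightarrow> \<bar>B\<bar>) (at_right 0)" by simp
  from order_tendstoD(2)[OF this B(2)] have ev: "\<forall>\<^sub>F \<epsilon> in at_right 0. q \<epsilon> * (\<bar>A\<bar> + \<epsilon>) < 1" .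
  define m where "m = min ((\<bar>A\<bar> - 1) / 4) ((1 - \<bar>B\<bar>) / 4)"
  have m: "0 < m" unfolding m_def using A B by auto
  have "\<forall>\<^sub>F \<epsilon> in at_right 0. 0 < \<epsilon> \<and> \<epsilon> < m"
    using eventually_at_right_less[of 0] eventually_at_right_real[OF m] by (auto elim: eventually_elim2)
  from eventually_happens'[OF _ eventually_conj[OF ev this]] obtain \<epsilon> where
    e: "q \<epsilon> * (\<bar>A\<bar> + \<epsilon>) < 1" "0 < \<epsilon>" "\<epsilon> < m" by auto
  have e': "4 * \<epsilon> \<le> \<bar>A\<bar> - 1" "\<bar>B\<bar> + 4 * \<epsilon> \<le> 1" using e(3) unfolding m_def by auto
  have den: "0 < (\<bar>A\<bar> - 2 * \<epsilon>)\<^sup>2" using e' e(2) by simp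
  have num: "0 < (\<bar>A\<bar> + \<epsilon>) * (\<bar>B\<bar> + \<epsilon>) + \<epsilon>\<^sup>2"
    using e(2) A B by (intro add_pos_pos mult_pos_pos) auto
  show ?thesis
  proof (rule that[of \<epsilon> "q \<epsilon>"])
    show "0 < q \<epsilon>" unfolding q_def using num den by (rule divide_pos_pos)
    show "(\<bar>A\<bar> + \<epsilon>) * (\<bar>B\<bar> + \<epsilon>) + \<epsilon>\<^sup>2 \<le> q \<epsilon> * (\<bar>A\<bar> - 2 * \<epsilon>)\<^sup>2"
      unfolding q_def using den by simp
  qed (use e e' in auto)
qed

lemma eventually_cball: "0 < r \<Longrightarrow> \<forall>\<^sub>F x in nhds (0 :: 'a::real_normed_vector). x \<in> cball 0 r"
  unfolding eventually_nhds by (intro exI[of _ "ball 0 r"]) auto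

lemma eventually_cballE:
  assumes "eventually P (nhds (0 :: 'a::real_normed_vector))"
  obtains r where "0 < r" "\<And>x. x \<in> cball 0 r \<Longrightarrow> P x"
proof -
  obtain S where S: "open S" "0 \<in> S" "\<forall>x\<in>S. P x" using assms unfolding eventually_nhds by blast
  then obtain r where "0 < r" "cball 0 r \<subseteq> S" using open_contains_cball by blast
  with S show ?thesis by (intro that[of r]) auto
qed

lemma eventually_nhds_image:
  assumes "(f has_derivative D) (at a)" "eventually P (nhds (f a))"
  shows "\<forall>\<^sub>F x in nhds a. P (f x)"
proof -
  have "isCont f a" using has_derivative_continuous[OF assms(1)] .
  then have "filterlim f (nhds (f a)) (nhds a)"
    by (simp add: isCont_def tendsto_at_iff_tendsto_nhds)
  then show ?thesis using assms(2) by (simp add: filterlim_iff)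
qed

lemma germ_hyperbolic_extension:
  fixes f :: "plane \<Rightarrow> plane"
  assumes A: "1 < \<bar>A\<bar>" and B: "0 < \<bar>B\<bar>" "\<bar>B\<bar> < 1" and \<alpha>: "0 < \<alpha>" "\<alpha> \<le> 1" and "0 < r"
    and f: "C1_holder_on \<alpha> (cball 0 r) f" and f0: "f 0 = 0"
    and f': "(f has_derivative (\<lambda>v. (A * fst v, B * snd v))) (at 0)"
  obtains \<epsilon> \<theta> C H H' \<rho> R where "planar_hyperbolic A B \<alpha> \<epsilon> C \<theta> H H'"
    "0 < \<rho>" "0 < R" "R \<le> r" "\<forall>p. norm p \<le> \<rho> \<longrightarrow> H p = f p"
    "\<forall>p. R < norm p \<longrightarrow> H' p = diag_blinfun A B" "\<forall>p. R < norm p \<longrightarrow> H p = diag_blinfun A B p"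
    "\<forall>p. norm p \<le> r \<longrightarrow> f p = diag_blinfun A B p \<longrightarrow> H p = diag_blinfun A B p"
proof -
  obtain \<epsilon> \<theta> where e: "0 < \<epsilon>" "4 * \<epsilon> \<le> \<bar>A\<bar> - 1" "\<bar>B\<bar> + 4 * \<epsilon> \<le> 1"
    "0 < \<theta>" "\<theta> * (\<bar>A\<bar> + \<epsilon>) < 1" "(\<bar>A\<bar> + \<epsilon>) * (\<bar>B\<bar> + \<epsilon>) + \<epsilon>\<^sup>2 \<le> \<theta> * (\<bar>A\<bar> - 2 * \<epsilon>)\<^sup>2"
    by (rule hyperbolic_constants[OF A B])
  have L: "(f has_derivative blinfun_apply (diag_blinfun A B)) (at 0)"
    using f' by (simp add: diag_blinfun_apply[abs_def])
  obtain H H' C \<rho> R where H: "0 \<le> C" "0 < \<rho>" "0 < R"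
    "\<forall>p. (H has_derivative blinfun_apply (H' p)) (at p)"
    "\<forall>p. norm (H' p - diag_blinfun A B) \<le> \<epsilon>"
    "\<forall>p q. norm (H' p - H' q) \<le> C * norm (p - q) powr \<alpha>"
    "H' 0 = diag_blinfun A B" "\<forall>p. norm p \<le> \<rho> \<longrightarrow> H p = f p"
    "\<forall>p. R < norm p \<longrightarrow> H' p = diag_blinfun A B" "\<forall>p. R < norm p \<longrightarrow> H p = diag_blinfun A B p"
    "\<forall>p. norm p \<le> r \<longrightarrow> f p = diag_blinfun A B p \<longrightarrow> H p = diag_blinfun A B p" "R \<le> r"
    by (rule cutoff_extension[OF \<open>0 < r\<close> \<alpha> f f0 L e(1)])
  have H0: "H 0 = 0" using H(8)[rule_format, of 0] H(2) f0 by simp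
  have "planar_hyperbolic A B \<alpha> \<epsilon> C \<theta> H H'"
    by (rule planar_hyperbolic.intro[OF A B \<alpha> e H(1) H(4-6)[rule_format] H0 H(7)])
  then show ?thesis using H(2,3,12,8-11) by (rule that)
qed

lemma germ_invariant_graph:
  fixes f :: "plane \<Rightarrow> plane"
  assumes A: "1 < \<bar>A\<bar>" and B: "0 < \<bar>B\<bar>" "\<bar>B\<bar> < 1" and \<alpha>: "0 < \<alpha>" "\<alpha> \<le> 1" and "0 < r"
    and f: "C1_holder_on \<alpha> (cball 0 r) f" and f0: "f 0 = 0"
    and f': "(f has_derivative (\<lambda>v. (A * fst v, B * snd v))) (at 0)"
  obtains h where "\<And>S. C1_holder_on \<alpha> S h" "(h has_field_derivative 0) (at 0)" "h 0 = 0"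
    "\<forall>\<^sub>F p in nhds 0. fst (f p) = h (snd (f p)) \<longleftrightarrow> fst p = h (snd p)"
proof -
  obtain \<epsilon> \<theta> C H H' \<rho> R where hyp: "planar_hyperbolic A B \<alpha> \<epsilon> C \<theta> H H'"
    and H: "0 < \<rho>" "0 < R" "R \<le> r" "\<forall>p. norm p \<le> \<rho> \<longrightarrow> H p = f p"
    "\<forall>p. R < norm p \<longrightarrow> H' p = diag_blinfun A B" "\<forall>p. R < norm p \<longrightarrow> H p = diag_blinfun A B p"
    "\<forall>p. norm p \<le> r \<longrightarrow> f p = diag_blinfun A B p \<longrightarrow> H p = diag_blinfun A B p"
    by (rule germ_hyperbolic_extension[OF A B \<alpha> \<open>0 < r\<close> f f0 f'])
  interpret planar_hyperbolic A B \<alpha> \<epsilon> C \<theta> H H' by (rule hyp)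
  \<comment> \<open>The difference between \<open>H\<close> and its linear part is
    \<epsilon>-Lipschitz, vanishes at 0 and beyond radius \<open>R\<close>, so it is bounded by
    \<epsilon> R.\<close>
  interpret planar_hyperbolic_bounded A B \<alpha> \<epsilon> C \<theta> H H' "\<epsilon> * R"
  proof
    fix p
    show "\<bar>fst (H p) - A * fst p\<bar> \<le> \<epsilon> * R"
    proof (cases "R < norm p")
      case True then show ?thesis using H(2) H(6)[rule_format, of p] eps(1) by simp
    next
      case False
      have "norm ((H p - diag_blinfun A B p) - (H 0 - diag_blinfun A B 0)) \<le> \<epsilon> * norm (p - 0)"
      proof (rule blinfun_derivative_lipschitz[of UNIV _ "\<lambda>p. H' p - diag_blinfun A B"])
        show "((\<lambda>p. H p - diag_blinfun A B p) has_derivative (H' q - diag_blinfun A B)) (at q within UNIV)" for q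
          unfolding blinfun.diff_left minus_blinfun.rep_eq
          by (intro has_derivative_diff der bounded_linear_imp_has_derivative blinfun.bounded_linear_right)
      qed (use near in auto)
      then have "norm (H p - diag_blinfun A B p) \<le> \<epsilon> * norm p"
        by (simp add: zero(1) zero_prod_def[symmetric])
      also have "\<dots> \<le> \<epsilon> * R" using False eps(1) by (intro mult_left_mono) auto
      finally show ?thesis
        using abs_fst_le_norm[of "H p - diag_blinfun A B p"] by simp
    qed
  qed
  obtain h h' K where h: "\<And>y. (h has_field_derivative h' y) (at y)"
    "\<And>y z. \<bar>h' y - h' z\<bar> \<le> K * \<bar>y - z\<bar> powr \<alpha>" "0 \<le> K" "h 0 = 0" "h' 0 = 0"
    "\<And>p. fst (H p) = h (snd (H p)) \<longleftrightarrow> fst p = h (snd p)"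
    by (rule invariant_graph) blast
  show ?thesis
  proof (rule that[of h])
    show "C1_holder_on \<alpha> S h" for S
      by (rule C1_holder_on_real[OF \<alpha>(1) has_field_derivative_at_within[OF h(1)] h(2)])
    show "(h has_field_derivative 0) (at 0)" using h(1)[of 0] h(5) by simp
    show "\<forall>\<^sub>F p in nhds 0. fst (f p) = h (snd (f p)) \<longleftrightarrow> fst p = h (snd p)"
      using eventually_cball[OF H(1)]
    proof eventually_elim
      case (elim p)
      then have "H p = f p" using H(4)[rule_format, of p] by simp
      then show ?case using h(6)[of p] by simp
    qed
  qed (rule h(4))
qed

lemma germ_linearized_coordinate:
  fixes f :: "plane \<Rightarrow> plane"
  assumes A: "1 < \<bar>A\<bar>" and B: "0 < \<bar>B\<bar>" "\<bar>B\<bar> < 1" and \<alpha>: "0 < \<alpha>" "\<alpha> \<le> 1" and "0 < r"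
    and f: "C1_holder_on \<alpha> (cball 0 r) f" and f0: "f 0 = 0"
    and f': "(f has_derivative (\<lambda>v. (A * fst v, B * snd v))) (at 0)"
    and axis: "\<And>x. \<bar>x\<bar> \<le> r \<Longrightarrow> f (x, 0) = (A * x, 0)"
  obtains \<psi> where "C1_holder_on (\<alpha> * (- ln \<bar>B\<bar>) / (ln \<bar>A\<bar> - ln \<bar>B\<bar>)) (cball 0 (1/2)) \<psi>"
    "(\<psi> has_derivative fst) (at 0)" "\<forall>\<^sub>F p in nhds 0. \<psi> (f p) = A * \<psi> p"
proof -
  obtain \<epsilon> \<theta> C H H' \<rho> R where hyp: "planar_hyperbolic A B \<alpha> \<epsilon> C \<theta> H H'"
    and H: "0 < \<rho>" "0 < R" "R \<le> r" "\<forall>p. norm p \<le> \<rho> \<longrightarrow> H p = f p"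
    "\<forall>p. R < norm p \<longrightarrow> H' p = diag_blinfun A B" "\<forall>p. R < norm p \<longrightarrow> H p = diag_blinfun A B p"
    "\<forall>p. norm p \<le> r \<longrightarrow> f p = diag_blinfun A B p \<longrightarrow> H p = diag_blinfun A B p"
    by (rule germ_hyperbolic_extension[OF A B \<alpha> \<open>0 < r\<close> f f0 f'])
  interpret planar_hyperbolic A B \<alpha> \<epsilon> C \<theta> H H' by (rule hyp)
  interpret planar_hyperbolic_straight A B \<alpha> \<epsilon> C \<theta> H H' R
  proof
    show "0 < R" by (rule H(2))
    \<comment> \<open>Up to radius \<open>r\<close> the extension preserves the points where
      \<open>f\<close> is linear; beyond \<open>r\<close> it is linear because R \<le> r.\<close>
    show "H (x, 0) = (A * x, 0)" for x
    proof (cases "\<bar>x\<bar> \<le> r")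
      case True
      then show ?thesis using H(7) axis[OF True] by (simp add: norm_Pair)
    next
      case False
      then show ?thesis using H(3,6) by (simp add: norm_Pair)
    qed
    show "H' p = diag_blinfun A B" if "R < \<bar>fst p\<bar>" for p
      using H(5) that abs_fst_le_norm[of p] by (meson less_le_trans)
  qed
  obtain \<psi> where \<psi>: "C1_holder_on \<gamma> (cball 0 (1/2)) \<psi>" "(\<psi> has_derivative fst) (at 0)"
    "\<And>p. \<bar>snd p\<bar> \<le> 1 \<Longrightarrow> \<psi> (H p) = A * \<psi> p"
    by (rule linearized_coordinate) blast
  show ?thesis
  proof (rule that[OF \<psi>(1)[unfolded \<gamma>_def] \<psi>(2)])
    show "\<forall>\<^sub>F p in nhds 0. \<psi> (f p) = A * \<psi> p"
      using eventually_cball[OF H(1)] eventually_cball[OF zero_less_one]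
    proof eventually_elim
      case (elim p)
      then have "H p = f p" "norm p \<le> 1" using H(4)[rule_format, of p] by auto
      then show ?case using \<psi>(3)[of p] abs_snd_le_norm[of p] by simp
    qed
  qed
qed

section \<open>Linearization of contractions of the line\<close>

text \<open>If \<open>\<psi> \<circ> k = \<lambda> \<psi>\<close> then \<open>ln \<psi>'\<close> solves the cohomological equation \<open>S = S \<circ> k + ln (k' / \<lambda>)\<close>.
  Conversely, an antiderivative of \<open>exp S\<close> linearizes \<open>k\<close>.\<close>

lemma contraction_cohomological_solution:
  fixes k l :: "real \<Rightarrow> real"
  assumes \<rho>: "0 < \<rho>" "\<rho> < 1" and \<alpha>: "0 < \<alpha>" and Cl: "0 \<le> Cl" and s: "0 < s"
    and k: "\<And>x y. \<bar>x\<bar> \<le> s \<Longrightarrow> \<bar>y\<bar> \<le> s \<Longrightarrow> \<bar>k x - k y\<bar> \<le> \<rho> * \<bar>x - y\<bar>" and k0: "k 0 = 0"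
    and l: "\<And>x y. \<bar>x\<bar> \<le> s \<Longrightarrow> \<bar>y\<bar> \<le> s \<Longrightarrow> \<bar>l x - l y\<bar> \<le> Cl * \<bar>x - y\<bar> powr \<alpha>" and l0: "l 0 = 0"
  obtains S K where "\<And>x. \<bar>x\<bar> \<le> s \<Longrightarrow> S x = S (k x) + l x" "S 0 = 0" "0 \<le> K"
    "\<And>x y. \<bar>x\<bar> \<le> s \<Longrightarrow> \<bar>y\<bar> \<le> s \<Longrightarrow> \<bar>S x - S y\<bar> \<le> K * \<bar>x - y\<bar> powr \<alpha>"
proof -
  \<comment> \<open>Picard iterates from 0 for S = S o k + l, that is, partial sums of
    \<open>l\<close> along the orbit of \<open>x\<close> under \<open>k\<close>.\<close>
  define T where "T n x = (((\<lambda>S x. S (k x) + l x) ^^ n) (\<lambda>_. 0)) x" for n x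
  have T0: "T 0 x = 0" and TS: "T (Suc n) x = T n (k x) + l x" for n x by (simp_all add: T_def)
  have ks: "\<bar>k x\<bar> \<le> \<rho> * \<bar>x\<bar>" if "\<bar>x\<bar> \<le> s" for x using k[OF that, of 0] k0 s by simp
  have ks': "\<bar>k x\<bar> \<le> s" if "\<bar>x\<bar> \<le> s" for x
    using ks[OF that] that \<rho> mult_left_le_one_le[of "\<bar>x\<bar>" \<rho>] by linarith
  define r where "r = \<rho> powr \<alpha>"
  have r: "0 < r" "r < 1" unfolding r_def using \<rho> \<alpha> powr_less_mono2[of \<alpha> \<rho> 1] by auto
  have kpow: "\<bar>k x - k y\<bar> powr \<alpha> \<le> r * \<bar>x - y\<bar> powr \<alpha>" if "\<bar>x\<bar> \<le> s" "\<bar>y\<bar> \<le> s" for x y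
    unfolding r_def using k[OF that] \<rho> \<alpha> by (simp add: powr_mult[symmetric] powr_mono2)
  define K where "K = Cl / (1 - r)"
  have K: "0 \<le> K" "K * r + Cl = K" unfolding K_def using Cl r by (auto simp: field_simps)
  have hol: "\<bar>T n x - T n y\<bar> \<le> K * \<bar>x - y\<bar> powr \<alpha>" if "\<bar>x\<bar> \<le> s" "\<bar>y\<bar> \<le> s" for n x y
    using that
  proof (induction n arbitrary: x y)
    case 0 then show ?case using K by (simp add: T0)
  next
    case (Suc n)
    have "\<bar>T (Suc n) x - T (Suc n) y\<bar> \<le> \<bar>T n (k x) - T n (k y)\<bar> + \<bar>l x - l y\<bar>" by (simp add: TS)
    also have "\<dots> \<le> K * \<bar>k x - k y\<bar> powr \<alpha> + Cl * \<bar>x - y\<bar> powr \<alpha>"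
      using Suc l ks' by (intro add_mono) auto
    also have "\<dots> \<le> K * (r * \<bar>x - y\<bar> powr \<alpha>) + Cl * \<bar>x - y\<bar> powr \<alpha>"
      using kpow[OF Suc.prems] K(1) Cl by (intro add_mono mult_left_mono) auto
    also have "\<dots> = (K * r + Cl) * \<bar>x - y\<bar> powr \<alpha>" by (simp add: algebra_simps)
    finally show ?case unfolding K(2) .
  qed
  have inc: "\<bar>T (Suc n) x - T n x\<bar> \<le> Cl * r ^ n * \<bar>x\<bar> powr \<alpha>" if "\<bar>x\<bar> \<le> s" for n x
    using that
  proof (induction n arbitrary: x)
    case 0 then show ?case using l[of x 0] l0 s by (simp add: T0 TS)
  next
    case (Suc n)
    have "\<bar>T (Suc (Suc n)) x - T (Suc n) x\<bar> = \<bar>T (Suc n) (k x) - T n (k x)\<bar>"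
      by (simp add: TS)
    also have "\<dots> \<le> Cl * r ^ n * \<bar>k x\<bar> powr \<alpha>" using Suc ks' by blast
    also have "\<dots> \<le> Cl * r ^ n * (r * \<bar>x\<bar> powr \<alpha>)"
      using kpow[OF Suc.prems, of 0] k0 s Cl r by (intro mult_left_mono) auto
    finally show ?case by (simp add: mult_ac)
  qed
  define S where "S x = lim (\<lambda>n. T n x)" for x
  have lim: "(\<lambda>n. T n x) \<longlonglongrightarrow> S x" if "\<bar>x\<bar> \<le> s" for x
  proof -
    have "\<bar>T (Suc n) x - T n x\<bar> \<le> (Cl * \<bar>x\<bar> powr \<alpha>) * r ^ n" for n
      using inc[OF that, of n] by (simp add: mult_ac)
    then obtain z where "(\<lambda>n. T n x) \<longlonglongrightarrow> z"
      using geometric_increments_limit[of "\<lambda>n. T n x" _ r] r by (metis less_imp_le)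
    then show ?thesis unfolding S_def by (simp add: limI)
  qed
  show ?thesis
  proof (rule that)
    show "S x = S (k x) + l x" if "\<bar>x\<bar> \<le> s" for x
    proof -
      have "(\<lambda>n. T (Suc n) x) \<longlonglongrightarrow> S (k x) + l x"
        unfolding TS by (intro tendsto_intros lim ks' that)
      then show ?thesis using LIMSEQ_Suc[OF lim[OF that]] LIMSEQ_unique by blast
    qed
    have "T n 0 = 0" for n by (induction n) (simp_all add: T0 TS k0 l0)
    then show "S 0 = 0" unfolding S_def by simp
    show "\<bar>S x - S y\<bar> \<le> K * \<bar>x - y\<bar> powr \<alpha>" if "\<bar>x\<bar> \<le> s" "\<bar>y\<bar> \<le> s" for x y
    proof (rule LIMSEQ_le_const2)
      show "(\<lambda>n. \<bar>T n x - T n y\<bar>) \<longlonglongrightarrow> \<bar>S x - S y\<bar>" by (intro tendsto_intros lim that)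
    qed (use hol that in auto)
  qed (rule K(1))
qed

theorem contraction_linearization:
  fixes k :: "real \<Rightarrow> real"
  assumes lam: "0 < \<bar>lam\<bar>" "\<bar>lam\<bar> < 1" and \<alpha>: "0 < \<alpha>" and "0 < r"
    and k: "C1_holder_on \<alpha> (cball 0 r) k" and k0: "k 0 = 0"
    and der: "(k has_field_derivative lam) (at 0)"
  obtains s \<psi> where "0 < s" "C1_holder_on \<alpha> (cball 0 s) \<psi>" "\<psi> 0 = 0"
    "(\<psi> has_field_derivative 1) (at 0)" "\<And>x. \<bar>x\<bar> \<le> s \<Longrightarrow> \<psi> (k x) = lam * \<psi> x"
proof -
  have "0 \<in> interior (cball 0 r :: real set)" using \<open>0 < r\<close> by simp
  with k der[unfolded has_field_derivative_def] obtain D C where D: "0 \<le> C"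
    "\<forall>x\<in>cball 0 r. (k has_derivative blinfun_apply (D x)) (at x within cball 0 r)"
    "continuous_on (cball 0 r) D"
    "\<forall>x\<in>cball 0 r. \<forall>y\<in>cball 0 r. norm (D x - D y) \<le> C * norm (x - y) powr \<alpha>"
    "blinfun_apply (D 0) = (*) lam"
    by (rule C1_holder_onE_at) (rule that)
  define k' where "k' x = D x 1" for x
  have Dk: "D x v = k' x * v" for x v
    using blinfun.scaleR_right[of "D x" v 1] by (simp add: k'_def mult.commute)
  have k'0: "k' 0 = lam" by (simp add: k'_def D(5))
  have hol: "\<bar>k' x - k' y\<bar> \<le> C * \<bar>x - y\<bar> powr \<alpha>" if "\<bar>x\<bar> \<le> r" "\<bar>y\<bar> \<le> r" for x y
  proof -
    have "\<bar>k' x - k' y\<bar> \<le> norm (D x - D y)"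
      using norm_blinfun[of "D x - D y" 1] by (simp add: k'_def blinfun.diff_left)
    also have "\<dots> \<le> C * \<bar>x - y\<bar> powr \<alpha>" using D(4) that by simp
    finally show ?thesis .
  qed
  \<comment> \<open>The first entry keeps |k'| at most \<rho> < 1, so that \<open>k\<close>
    contracts; the second keeps k' / lam at least 1/2, so that its logarithm is defined and
    Lipschitz in it.\<close>
  define m where "m = min ((1 - \<bar>lam\<bar>) / 2) (\<bar>lam\<bar> / 2)"
  have m: "0 < m" unfolding m_def using lam by simp
  define s where "s = min r ((m / (C + 1)) powr (1 / \<alpha>))"
  have s: "0 < s" "s \<le> r" unfolding s_def using \<open>0 < r\<close> m D(1) by auto
  have near: "\<bar>k' x - lam\<bar> \<le> m" if "\<bar>x\<bar> \<le> s" for x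
  proof -
    have "\<bar>k' x - lam\<bar> \<le> C * \<bar>x\<bar> powr \<alpha>" using hol[of x 0] that s \<open>0 < r\<close> k'0 by simp
    also have "\<dots> \<le> C * ((m / (C + 1)) powr (1 / \<alpha>)) powr \<alpha>"
      using that \<alpha> D(1) by (intro mult_left_mono powr_mono2) (auto simp: s_def)
    also have "\<dots> = C * (m / (C + 1))" using \<alpha> m D(1) by (simp add: powr_powr)
    also have "\<dots> \<le> m" using m D(1) by (simp add: divide_le_eq algebra_simps)
    finally show ?thesis .
  qed
  define I where "I = {-s..s}"
  have I: "x \<in> I \<longleftrightarrow> \<bar>x\<bar> \<le> s" for x by (auto simp: I_def abs_le_iff)
  have Icball: "I = cball 0 s" by (auto simp: I)
  have kder: "(k has_field_derivative k' x) (at x within I)" if "x \<in> I" for x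
  proof -
    have "(k has_derivative blinfun_apply (D x)) (at x within I)"
      using that s by (intro has_derivative_subset[OF D(2)[rule_format]]) (auto simp: I)
    moreover have "blinfun_apply (D x) = (*) (k' x)" by (simp add: Dk fun_eq_iff)
    ultimately show ?thesis by (simp add: has_field_derivative_def)
  qed
  define \<rho> where "\<rho> = (1 + \<bar>lam\<bar>) / 2"
  have \<rho>: "0 < \<rho>" "\<rho> < 1" unfolding \<rho>_def using lam by auto
  have klip: "\<bar>k x - k y\<bar> \<le> \<rho> * \<bar>x - y\<bar>" if "\<bar>x\<bar> \<le> s" "\<bar>y\<bar> \<le> s" for x y
  proof -
    have "norm (k x - k y) \<le> \<rho> * norm (x - y)"
    proof (rule field_differentiable_bound[of I k k'])
      show "convex I" by (simp add: I_def)
      show "norm (k' z) \<le> \<rho>" if "z \<in> I" for z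
      proof -
        have "\<bar>k' z - lam\<bar> \<le> (1 - \<bar>lam\<bar>) / 2" using near[of z] that unfolding I m_def by simp
        then show ?thesis unfolding \<rho>_def real_norm_def by argo
      qed
    qed (use kder that in \<open>auto simp: I\<close>)
    then show ?thesis by simp
  qed
  have kI: "\<bar>k x\<bar> \<le> s" if "\<bar>x\<bar> \<le> s" for x
    using klip[OF that, of 0] that s k0 \<rho> mult_left_le_one_le[of "\<bar>x\<bar>" \<rho>] by simp
  define l where "l x = ln (k' x / lam)" for x
  have half: "1/2 \<le> k' x / lam" if "\<bar>x\<bar> \<le> s" for x
  proof -
    have "\<bar>k' x / lam - 1\<bar> = \<bar>k' x - lam\<bar> / \<bar>lam\<bar>"
      using lam by (simp add: diff_divide_distrib abs_divide[symmetric])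
    also have "\<dots> \<le> (\<bar>lam\<bar> / 2) / \<bar>lam\<bar>" using near[OF that] unfolding m_def by (intro divide_right_mono) auto
    also have "\<dots> = 1/2" using lam by simp
    finally show ?thesis by linarith
  qed
  have lhol: "\<bar>l x - l y\<bar> \<le> 2 * C / \<bar>lam\<bar> * \<bar>x - y\<bar> powr \<alpha>" if "\<bar>x\<bar> \<le> s" "\<bar>y\<bar> \<le> s" for x y
  proof -
    have "\<bar>l x - l y\<bar> \<le> 2 * \<bar>k' x / lam - k' y / lam\<bar>"
      unfolding l_def by (intro abs_ln_diff_le half that)
    also have "\<dots> = 2 * \<bar>k' x - k' y\<bar> / \<bar>lam\<bar>"
      by (simp add: diff_divide_distrib[symmetric])
    also have "\<dots> \<le> 2 * (C * \<bar>x - y\<bar> powr \<alpha>) / \<bar>lam\<bar>"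
      using hol[of x y] that s by (intro divide_right_mono mult_left_mono) auto
    finally show ?thesis by simp
  qed
  have l0: "l 0 = 0" using lam by (simp add: l_def k'0)
  obtain S K where S: "\<And>x. \<bar>x\<bar> \<le> s \<Longrightarrow> S x = S (k x) + l x" "S 0 = 0" "0 \<le> K"
    "\<And>x y. \<bar>x\<bar> \<le> s \<Longrightarrow> \<bar>y\<bar> \<le> s \<Longrightarrow> \<bar>S x - S y\<bar> \<le> K * \<bar>x - y\<bar> powr \<alpha>"
    by (rule contraction_cohomological_solution[OF \<rho> \<alpha> _ s(1) klip k0 lhol l0]) (use D(1) in auto)
  define M where "M = K * s powr \<alpha>"
  have S_le: "S x \<le> M" if "\<bar>x\<bar> \<le> s" for x
  proof -
    have "\<bar>S x\<bar> \<le> K * \<bar>x\<bar> powr \<alpha>" using S(4)[OF that, of 0] S(2) s by simp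
    also have "\<dots> \<le> M" unfolding M_def using that S(3) \<alpha> by (intro mult_left_mono powr_mono2) auto
    finally show ?thesis by simp
  qed
  have ehol: "\<bar>exp (S x) - exp (S y)\<bar> \<le> (exp M * K) * \<bar>x - y\<bar> powr \<alpha>" if "\<bar>x\<bar> \<le> s" "\<bar>y\<bar> \<le> s" for x y
  proof -
    have "\<bar>exp (S x) - exp (S y)\<bar> \<le> exp M * \<bar>S x - S y\<bar>"
      by (intro abs_exp_diff_le S_le that)
    also have "\<dots> \<le> exp M * (K * \<bar>x - y\<bar> powr \<alpha>)"
      using S(4)[OF that] by (intro mult_left_mono) auto
    finally show ?thesis by (simp add: mult.assoc)
  qed
  have "continuous_on I (\<lambda>x. exp (S x))"
    using ehol by (intro holder_imp_continuous_on[OF \<alpha>, of _ _ "exp M * K"]) (auto simp: I)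
  then obtain g where g: "\<And>x. x \<in> I \<Longrightarrow> (g has_vector_derivative exp (S x)) (at x within I)"
    unfolding I_def using antiderivative_continuous by metis
  define \<psi> where "\<psi> x = g x - g 0" for x
  have \<psi>: "(\<psi> has_field_derivative exp (S x)) (at x within I)" if "x \<in> I" for x
    unfolding \<psi>_def using DERIV_diff[OF _ DERIV_const, of g "exp (S x)" x I "g 0"] g[OF that]
    by (simp add: has_real_derivative_iff_has_vector_derivative)
  \<comment> \<open>By the cohomological equation the defect of the conjugacy has zero derivative,
    hence is constant; its value at 0 is 0.\<close>
  have conj0: "((\<lambda>x. \<psi> (k x) - lam * \<psi> x) has_field_derivative 0) (at x within I)" if x: "x \<in> I" for x
  proof -
    have kx: "k x \<in> I" "k ` I \<subseteq> I" using kI x by (auto simp: I)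
    have "(\<psi> has_field_derivative exp (S (k x))) (at (k x) within k ` I)"
      using \<psi>[OF kx(1)] kx(2) by (rule has_field_derivative_subset)
    from DERIV_image_chain[OF this kder[OF x]]
    have "((\<lambda>x. \<psi> (k x) - lam * \<psi> x) has_field_derivative exp (S (k x)) * k' x - lam * exp (S x)) (at x within I)"
      unfolding o_def by (intro DERIV_diff DERIV_cmult \<psi> x)
    moreover have "exp (S (k x)) * k' x = lam * exp (S x)"
    proof -
      have "\<bar>x\<bar> \<le> s" using x I by simp
      from half[OF this] have "0 < k' x / lam" by linarith
      then have "exp (l x) = k' x / lam" by (simp add: l_def)
      then have "exp (S x) = exp (S (k x)) * (k' x / lam)"
        using S(1)[of x] x I by (simp add: exp_add)
      then show ?thesis using lam by simp
    qed
    ultimately show ?thesis by simp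
  qed
  obtain c where c: "\<And>x. x \<in> I \<Longrightarrow> \<psi> (k x) - lam * \<psi> x = c"
    using has_field_derivative_zero_constant[of I "\<lambda>x. \<psi> (k x) - lam * \<psi> x"] conj0
    by (auto simp: I_def)
  have "c = 0" using c[of 0] s k0 by (simp add: \<psi>_def I)
  show ?thesis
  proof (rule that[of s \<psi>])
    show "C1_holder_on \<alpha> (cball 0 s) \<psi>"
      unfolding Icball[symmetric] by (rule C1_holder_on_real[OF \<alpha> \<psi> ehol]) (auto simp: I)
    show "\<psi> 0 = 0" by (simp add: \<psi>_def)
    have "0 \<in> interior I" using s by (simp add: Icball)
    then show "(\<psi> has_field_derivative 1) (at 0)"
      using \<psi>[of 0] s S(2) at_within_interior[of 0 I] by (simp add: I)
    show "\<psi> (k x) = lam * \<psi> x" if "\<bar>x\<bar> \<le> s" for x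
      using c[of x] that \<open>c = 0\<close> by (simp add: I)
  qed (rule s(1))
qed

section \<open>The contracted coordinate of a saddle\<close>

lemma swap_has_derivative: "(prod.swap has_derivative prod.swap) F"
  for F :: "plane filter"
  by (intro bounded_linear_imp_has_derivative linear_conv_bounded_linear[THEN iffD1] linearI) auto

lemma bounded_linear_swap: "bounded_linear (prod.swap :: plane \<Rightarrow> plane)"
  using swap_has_derivative by (rule has_derivative_bounded_linear)

lemma norm_swap: "norm (prod.swap p) = norm p" for p :: plane
  by (cases p) (simp add: norm_Pair add.commute)

lemma C1_holder_on_swap_conj:
  fixes f :: "plane \<Rightarrow> plane"
  assumes "C1_holder_on \<alpha> (cball 0 r) f" "0 < \<alpha>"
  shows "C1_holder_on \<alpha> (cball 0 r) (\<lambda>p. prod.swap (f (prod.swap p)))"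
  by (intro C1_holder_on_linear_compose[OF bounded_linear_swap]
      C1_holder_on_compose[OF C1_holder_on_linear[OF bounded_linear_swap] assms(1)] assms(2))
    (auto simp: norm_swap)

lemma swap_conj_has_derivative:
  fixes f :: "plane \<Rightarrow> plane"
  assumes "(f has_derivative (\<lambda>v. (a * fst v, b * snd v))) (at 0)"
  shows "((\<lambda>p. prod.swap (f (prod.swap p))) has_derivative (\<lambda>v. (b * fst v, a * snd v))) (at 0)"
proof -
  have 0: "prod.swap (0 :: plane) = 0" by (simp add: zero_prod_def)
  have "((\<lambda>p. f (prod.swap p)) has_derivative (\<lambda>v. (a * fst (prod.swap v), b * snd (prod.swap v)))) (at 0)"
    using has_derivative_compose[OF swap_has_derivative, of f "\<lambda>v. (a * fst v, b * snd v)" 0 UNIV] assms 0 by simp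
  from has_derivative_compose[OF this swap_has_derivative]
  show ?thesis by simp
qed

text \<open>With the axes exchanged the coordinate with multiplier \<open>mu\<close> comes first,
  and its invariant graph, exchanged back, is the stable curve of \<open>F\<close>. On this curve
  \<open>F\<close> is a contraction of the line, linearized by \<open>\<psi>\<close>. The final
  implication starts from \<open>F p\<close> on the curve because it is later used with
  \<open>p\<close> a value of the inverse of \<open>F\<close>.\<close>

lemma germ_straighten_contracted:
  fixes F :: "plane \<Rightarrow> plane"
  assumes lam: "0 < \<bar>lam\<bar>" "\<bar>lam\<bar> < 1" and mu: "1 < \<bar>mu\<bar>" and \<alpha>: "0 < \<alpha>" "\<alpha> \<le> 1" and "0 < r"
    and F: "C1_holder_on \<alpha> (cball 0 r) F" and F0: "F 0 = 0"
    and F': "(F has_derivative (\<lambda>v. (lam * fst v, mu * snd v))) (at 0)"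
  obtains h \<psi> s where "\<And>S. C1_holder_on \<alpha> S h" "(h has_field_derivative 0) (at 0)" "h 0 = 0"
    "0 < s" "C1_holder_on \<alpha> (cball 0 s) \<psi>" "(\<psi> has_field_derivative 1) (at 0)" "\<psi> 0 = 0"
    "\<forall>\<^sub>F p in nhds 0. snd (F p) = h (fst (F p)) \<longrightarrow> snd p = h (fst p) \<and> \<psi> (fst (F p)) = lam * \<psi> (fst p)"
proof -
  define Fs where "Fs p = prod.swap (F (prod.swap p))" for p
  obtain h where h: "\<And>S. C1_holder_on \<alpha> S h" "(h has_field_derivative 0) (at 0)" "h 0 = 0"
    "\<forall>\<^sub>F p in nhds 0. fst (Fs p) = h (snd (Fs p)) \<longleftrightarrow> fst p = h (snd p)"
  proof (rule germ_invariant_graph[OF mu lam \<alpha> \<open>0 < r\<close>, of Fs])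
    show "C1_holder_on \<alpha> (cball 0 r) Fs"
      unfolding Fs_def[abs_def] by (rule C1_holder_on_swap_conj[OF F \<alpha>(1)])
    show "Fs 0 = 0" using F0 by (simp add: Fs_def zero_prod_def)
    show "(Fs has_derivative (\<lambda>v. (mu * fst v, lam * snd v))) (at 0)"
      unfolding Fs_def[abs_def] by (rule swap_conj_has_derivative[OF F'])
  qed blast
  have swap0: "prod.swap (0 :: plane) = 0" by (simp add: zero_prod_def)
  have graph: "\<forall>\<^sub>F p in nhds 0. snd (F p) = h (fst (F p)) \<longleftrightarrow> snd p = h (fst p)"
  proof -
    have "\<forall>\<^sub>F p in nhds (prod.swap 0). fst (Fs p) = h (snd (Fs p)) \<longleftrightarrow> fst p = h (snd p)"
      using h(4) swap0 by simp
    from eventually_nhds_image[OF swap_has_derivative this] show ?thesis by (simp add: Fs_def)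
  qed
  define k where "k x = fst (F (x, h x))" for x
  have hd: "(h has_derivative (\<lambda>v. 0)) (at 0)"
    using h(2) unfolding has_field_derivative_def lambda_zero .
  have gd: "((\<lambda>x. (x, h x)) has_derivative (\<lambda>v. (v, 0))) (at 0)"
    by (intro has_derivative_Pair has_derivative_ident hd)
  have g0: "(0, h 0) = (0 :: plane)" by (simp add: h(3) zero_prod_def)
  have "\<forall>\<^sub>F x in nhds 0. (x, h x) \<in> cball 0 r"
    using eventually_nhds_image[OF gd] eventually_cball[OF \<open>0 < r\<close>] by (simp only: g0)
  then obtain r1 where r1: "0 < r1" "\<And>x. x \<in> cball 0 r1 \<Longrightarrow> (x, h x) \<in> cball 0 r"
    by (rule eventually_cballE) blast
  have gC: "C1_holder_on \<alpha> (cball 0 r1) (\<lambda>x. (x, h x))"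
    by (intro C1_holder_on_Pair h(1) \<alpha> C1_holder_on_linear bounded_linear_ident)
  have kC: "C1_holder_on \<alpha> (cball 0 r1) k"
    unfolding k_def[abs_def]
    by (intro C1_holder_on_linear_compose[OF bounded_linear_fst] C1_holder_on_compose[OF gC F] r1 \<alpha>) auto
  have k0: "k 0 = 0" using F0 by (simp add: k_def h(3) zero_prod_def[symmetric])
  have "((\<lambda>x. F (x, h x)) has_derivative (\<lambda>v. (lam * v, mu * 0))) (at 0)"
    using has_derivative_compose[OF gd, of F "\<lambda>v. (lam * fst v, mu * snd v)"] F' g0 by simp
  from has_derivative_fst[OF this] have kd: "(k has_field_derivative lam) (at 0)"
    by (simp add: k_def[abs_def] has_field_derivative_def)
  obtain s \<psi> where \<psi>: "0 < s" "C1_holder_on \<alpha> (cball 0 s) \<psi>" "\<psi> 0 = 0"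
    "(\<psi> has_field_derivative 1) (at 0)" "\<And>x. \<bar>x\<bar> \<le> s \<Longrightarrow> \<psi> (k x) = lam * \<psi> x"
    using contraction_linearization[OF lam \<alpha>(1) r1(1) kC k0 kd] by metis
  show ?thesis
  proof (rule that[OF h(1-3) \<psi>(1,2,4,3)])
    show "\<forall>\<^sub>F p in nhds 0. snd (F p) = h (fst (F p)) \<longrightarrow>
        snd p = h (fst p) \<and> \<psi> (fst (F p)) = lam * \<psi> (fst p)"
      using graph eventually_cball[OF \<psi>(1)]
    proof eventually_elim
      case (elim p)
      show ?case
      proof
        assume "snd (F p) = h (fst (F p))"
        then have 1: "snd p = h (fst p)" using elim(1) by simp
        then have "F p = F (fst p, h (fst p))" by (metis prod.collapse)
        then have "fst (F p) = k (fst p)" by (simp add: k_def)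
        moreover have "\<bar>fst p\<bar> \<le> s" using elim(2) abs_fst_le_norm[of p] by simp
        ultimately show "snd p = h (fst p) \<and> \<psi> (fst (F p)) = lam * \<psi> (fst p)"
          using 1 \<psi>(5)[of "fst p"] by simp
      qed
    qed
  qed
qed

text \<open>The coordinate to be linearized must be the expanding one, so the inverse germ
  \<open>G\<close> is considered, conjugated by a C^{1,alpha} chart that makes the stable curve
  straight and the dynamics on it linear. The exponent drops from \<alpha> only in
  \<open>germ_linearized_coordinate\<close>.\<close>

theorem saddle_contracted_coordinate:
  fixes F G :: "plane \<Rightarrow> plane"
  assumes lam: "0 < \<bar>lam\<bar>" "\<bar>lam\<bar> < 1" and mu: "1 < \<bar>mu\<bar>" and \<alpha>: "0 < \<alpha>" "\<alpha> \<le> 1"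
    and r: "0 < r" "0 < r'"
    and F: "C1_holder_on \<alpha> (cball 0 r) F" and F0: "F 0 = 0"
    and F': "(F has_derivative (\<lambda>v. (lam * fst v, mu * snd v))) (at 0)"
    and G: "C1_holder_on \<alpha> (cball 0 r') G" and G0: "G 0 = 0"
    and G': "(G has_derivative (\<lambda>v. (1 / lam * fst v, 1 / mu * snd v))) (at 0)"
    and FG: "\<forall>\<^sub>F p in nhds 0. F (G p) = p" and GF: "\<forall>\<^sub>F p in nhds 0. G (F p) = p"
  obtains s \<phi> where "0 < s" "C1_holder_on (\<alpha> * ln \<bar>mu\<bar> / (ln \<bar>mu\<bar> - ln \<bar>lam\<bar>)) (cball 0 s) \<phi>"
    "(\<phi> has_derivative fst) (at 0)" "\<forall>\<^sub>F p in nhds 0. \<phi> (F p) = lam * \<phi> p"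
proof -
  obtain h \<psi> s where h: "\<And>S. C1_holder_on \<alpha> S h" "(h has_field_derivative 0) (at 0)" "h 0 = 0"
    and \<psi>: "0 < s" "C1_holder_on \<alpha> (cball 0 s) \<psi>" "(\<psi> has_field_derivative 1) (at 0)" "\<psi> 0 = 0"
    and inv: "\<forall>\<^sub>F p in nhds 0. snd (F p) = h (fst (F p)) \<longrightarrow>
      snd p = h (fst p) \<and> \<psi> (fst (F p)) = lam * \<psi> (fst p)"
    by (rule germ_straighten_contracted[OF lam mu \<alpha> r(1) F F0 F']) blast
  \<comment> \<open>Flattens the curve snd p = h (fst p) to the first axis and linearizes the motion
    on it. Its derivative at 0 is the identity, since there \<open>\<psi>\<close> has derivative 1
    and \<open>h\<close> has derivative 0.\<close>
  define T where "T p = (\<psi> (fst p), snd p - h (fst p))" for p :: plane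
  have T0: "T 0 = 0" by (simp add: T_def \<psi>(4) h(3) zero_prod_def)
  have TC: "C1_holder_on \<alpha> (cball 0 s) T"
  proof -
    have fstC: "C1_holder_on \<alpha> (cball 0 s) (fst :: plane \<Rightarrow> real)"
      by (intro C1_holder_on_linear bounded_linear_fst \<alpha>)
    have fst_in: "fst p \<in> cball 0 s" if "p \<in> cball 0 s" for p :: plane
      using that abs_fst_le_norm[of p] by simp
    have "C1_holder_on \<alpha> (cball 0 s) (\<lambda>p :: plane. \<psi> (fst p))"
      by (rule C1_holder_on_compose[OF fstC \<psi>(2)]) (use fst_in \<alpha> in auto)
    moreover have "C1_holder_on \<alpha> (cball 0 s) (\<lambda>p :: plane. h (fst p))"
      by (rule C1_holder_on_compose[OF fstC h(1)]) (use fst_in \<alpha> in auto)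
    then have "C1_holder_on \<alpha> (cball 0 s) (\<lambda>p :: plane. snd p - h (fst p))"
      by (rule C1_holder_on_diff[OF C1_holder_on_linear[OF bounded_linear_snd \<alpha>(1)]]) (use \<alpha> in auto)
    ultimately show ?thesis unfolding T_def[abs_def] by (rule C1_holder_on_Pair[OF _ _ \<alpha>(1)])
  qed
  have Td: "(T has_derivative (\<lambda>v. v)) (at 0)"
  proof -
    have "((\<lambda>p :: plane. \<psi> (fst p)) has_derivative (\<lambda>v. 1 * fst v)) (at 0)"
      using has_derivative_compose[of fst fst 0 UNIV \<psi> "(*) 1"] \<psi>(3)
      by (simp add: has_field_derivative_def bounded_linear_imp_has_derivative bounded_linear_fst)
    moreover have "((\<lambda>p :: plane. h (fst p)) has_derivative (\<lambda>v. 0 * fst v)) (at 0)"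
      using has_derivative_compose[of fst fst 0 UNIV h "(*) 0"] h(2)
      by (simp add: has_field_derivative_def bounded_linear_imp_has_derivative bounded_linear_fst)
    then have "((\<lambda>p :: plane. snd p - h (fst p)) has_derivative (\<lambda>v. snd v - 0 * fst v)) (at 0)"
      by (intro has_derivative_diff bounded_linear_imp_has_derivative bounded_linear_snd)
    ultimately have "(T has_derivative (\<lambda>v. (1 * fst v, snd v - 0 * fst v))) (at 0)"
      unfolding T_def[abs_def] by (rule has_derivative_Pair)
    then show ?thesis by simp
  qed
  obtain s' t' where s': "0 < s'" "s' \<le> s" "inj_on T (cball 0 s')"
    "C1_holder_on \<alpha> (T ` cball 0 s') (inv_into (cball 0 s') T)"
    "0 < t'" "cball 0 t' \<subseteq> T ` cball 0 s'" "(inv_into (cball 0 s') T has_derivative (\<lambda>v. v)) (at 0)"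
    using C1_holder_inverse[OF \<psi>(1) \<alpha>(1) TC T0 Td bounded_linear_ident] by metis
  define Ti where "Ti = inv_into (cball 0 s') T"
  have TiC: "C1_holder_on \<alpha> (cball 0 t') Ti"
    unfolding Ti_def using s'(4,6) by (rule C1_holder_on_subset)
  have Tid: "(Ti has_derivative (\<lambda>v. v)) (at 0)" unfolding Ti_def by (rule s'(7))
  have TiT: "Ti (T p) = p" if "p \<in> cball 0 s'" for p
    unfolding Ti_def using s'(3) that by (rule inv_into_f_f)
  have TTi: "T (Ti q) = q" if "q \<in> cball 0 t'" for q
    unfolding Ti_def using s'(6) that by (intro f_inv_into_f) auto
  have Ti0: "Ti 0 = 0" using TiT[of 0] T0 s'(1) by simp
  define H where "H q = T (G (Ti q))" for q
  have GTid: "((\<lambda>q. G (Ti q)) has_derivative (\<lambda>v. (1 / lam * fst v, 1 / mu * snd v))) (at 0)"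
    using has_derivative_compose[OF Tid, of G "\<lambda>v. (1 / lam * fst v, 1 / mu * snd v)"] G' Ti0 by simp
  have Hd: "(H has_derivative (\<lambda>v. (1 / lam * fst v, 1 / mu * snd v))) (at 0)"
    using has_derivative_compose[OF GTid, of T "\<lambda>v. v"] Td Ti0 G0 by (simp add: H_def[abs_def])
  have H0: "H 0 = 0" by (simp add: H_def Ti0 G0 T0)
  have via_Ti: "\<forall>\<^sub>F q in nhds 0. P (Ti q)" if "eventually P (nhds 0)" for P
    using eventually_nhds_image[OF Tid, of P] that Ti0 by simp
  have via_G: "\<forall>\<^sub>F q in nhds 0. P (G q)" if "eventually P (nhds 0)" for P
    using eventually_nhds_image[OF G', of P] that G0 by simp
  have via_F: "\<forall>\<^sub>F q in nhds 0. P (F q)" if "eventually P (nhds 0)" for P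
    using eventually_nhds_image[OF F', of P] that F0 by simp
  have via_T: "\<forall>\<^sub>F q in nhds 0. P (T q)" if "eventually P (nhds 0)" for P
    using eventually_nhds_image[OF Td, of P] that T0 by simp
  \<comment> \<open>All germ relations are gathered on one ball, because the axis condition has to
    hold pointwise on a definite interval.\<close>
  have "\<forall>\<^sub>F q in nhds 0. q \<in> cball 0 t' \<and> Ti q \<in> cball 0 r' \<and> G (Ti q) \<in> cball 0 s
    \<and> F (G (Ti q)) = Ti q \<and> (snd (F (G (Ti q))) = h (fst (F (G (Ti q)))) \<longrightarrow>
      snd (G (Ti q)) = h (fst (G (Ti q))) \<and> \<psi> (fst (F (G (Ti q)))) = lam * \<psi> (fst (G (Ti q))))"
    by (intro eventually_conj eventually_cball s' via_Ti r \<psi>(1) via_G[OF eventually_cball, THEN via_Ti]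
        FG[THEN via_Ti] inv[THEN via_G, THEN via_Ti])
  then obtain \<rho> where \<rho>: "0 < \<rho>"
    and near: "\<And>q. q \<in> cball 0 \<rho> \<Longrightarrow> q \<in> cball 0 t' \<and> Ti q \<in> cball 0 r' \<and> G (Ti q) \<in> cball 0 s
    \<and> F (G (Ti q)) = Ti q \<and> (snd (F (G (Ti q))) = h (fst (F (G (Ti q)))) \<longrightarrow>
      snd (G (Ti q)) = h (fst (G (Ti q))) \<and> \<psi> (fst (F (G (Ti q)))) = lam * \<psi> (fst (G (Ti q))))"
    by (rule eventually_cballE) blast
  have HC: "C1_holder_on \<alpha> (cball 0 \<rho>) H"
  proof -
    have "C1_holder_on \<alpha> (cball 0 \<rho>) Ti"
      by (rule C1_holder_on_subset[OF TiC]) (use near in blast)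
    then have "C1_holder_on \<alpha> (cball 0 \<rho>) (\<lambda>q. G (Ti q))"
      by (rule C1_holder_on_compose[OF _ G]) (use near \<alpha> in auto)
    then show ?thesis unfolding H_def[abs_def]
      by (rule C1_holder_on_compose[OF _ TC]) (use near \<alpha> in auto)
  qed
  \<comment> \<open>The chart takes the curve to the axis. As \<open>F\<close> maps
    \<open>G p\<close> to \<open>p\<close> on the curve, \<open>G p\<close> is on the curve too, and
    the relation for \<open>\<psi>\<close> gives the factor 1 / lam.\<close>
  have axis: "H (x, 0) = (1 / lam * x, 0)" if "\<bar>x\<bar> \<le> \<rho>" for x
  proof -
    define p where "p = Ti (x, 0)"
    have x: "(x, 0) \<in> cball (0 :: plane) \<rho>" using that by (simp add: norm_Pair)
    note n = near[OF x, folded p_def]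
    have "T p = (x, 0)" unfolding p_def using TTi n by blast
    then have p: "\<psi> (fst p) = x" "snd p = h (fst p)" by (auto simp: T_def)
    have "snd (G p) = h (fst (G p))" "\<psi> (fst p) = lam * \<psi> (fst (G p))"
      using n p by auto
    then have "T (G p) = (1 / lam * x, 0)" using p lam by (simp add: T_def)
    then show ?thesis by (simp add: H_def p_def)
  qed
  have A: "1 < \<bar>1 / lam\<bar>" "0 < \<bar>1 / mu\<bar>" "\<bar>1 / mu\<bar> < 1" using lam mu by auto
  obtain \<psi>2 where \<psi>2: "C1_holder_on (\<alpha> * (- ln \<bar>1 / mu\<bar>) / (ln \<bar>1 / lam\<bar> - ln \<bar>1 / mu\<bar>)) (cball 0 (1/2)) \<psi>2"
    "(\<psi>2 has_derivative fst) (at 0)" "\<forall>\<^sub>F p in nhds 0. \<psi>2 (H p) = 1 / lam * \<psi>2 p"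
    by (rule germ_linearized_coordinate[OF A \<alpha> \<rho> HC H0 Hd axis]) blast
  define \<gamma> where "\<gamma> = \<alpha> * ln \<bar>mu\<bar> / (ln \<bar>mu\<bar> - ln \<bar>lam\<bar>)"
  have \<gamma>_eq: "\<alpha> * (- ln \<bar>1 / mu\<bar>) / (ln \<bar>1 / lam\<bar> - ln \<bar>1 / mu\<bar>) = \<gamma>"
    unfolding \<gamma>_def using lam mu by (simp add: ln_div)
  have lns: "0 < ln \<bar>mu\<bar>" "ln \<bar>lam\<bar> < 0" using lam mu by auto
  have \<gamma>: "0 < \<gamma>" "\<gamma> \<le> \<alpha>"
  proof -
    show "0 < \<gamma>" unfolding \<gamma>_def using lns \<alpha> by (intro divide_pos_pos mult_pos_pos) auto
    have "\<alpha> * ln \<bar>mu\<bar> \<le> \<alpha> * (ln \<bar>mu\<bar> - ln \<bar>lam\<bar>)" using lns \<alpha> by (intro mult_left_mono) auto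
    then show "\<gamma> \<le> \<alpha>" unfolding \<gamma>_def using lns by (subst pos_divide_le_eq) auto
  qed
  define \<phi> where "\<phi> p = \<psi>2 (T p)" for p
  have "\<forall>\<^sub>F p in nhds 0. p \<in> cball 0 s \<and> T p \<in> cball 0 (1/2)"
    by (intro eventually_conj eventually_cball \<psi>(1) via_T) auto
  then obtain s3 where s3: "0 < s3" "\<And>p. p \<in> cball 0 s3 \<Longrightarrow> p \<in> cball 0 s \<and> T p \<in> cball 0 (1/2)"
    by (rule eventually_cballE) blast
  have \<phi>C: "C1_holder_on \<gamma> (cball 0 s3) \<phi>"
  proof -
    have "C1_holder_on \<alpha> (cball 0 s3) T"
      by (rule C1_holder_on_subset[OF TC]) (use s3 in blast)
    then have "C1_holder_on \<gamma> (cball 0 s3) T"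
      by (rule C1_holder_on_exponent_mono[OF _ bounded_cball \<gamma>])
    then show ?thesis unfolding \<phi>_def[abs_def]
      by (rule C1_holder_on_compose[OF _ \<psi>2(1)[unfolded \<gamma>_eq]]) (use s3 \<gamma> in auto)
  qed
  have \<phi>d: "(\<phi> has_derivative fst) (at 0)"
    using has_derivative_compose[OF Td, of \<psi>2 fst] \<psi>2(2) T0 by (simp add: \<phi>_def[abs_def])
  have "\<forall>\<^sub>F p in nhds 0. \<phi> (F p) = lam * \<phi> p"
    using via_F[OF via_T[OF \<psi>2(3)]] via_F[OF eventually_cball[OF s'(1)]] GF
  proof eventually_elim
    case (elim p)
    \<comment> \<open>The relation for \<open>H\<close> is used at \<open>T (F p)\<close>, which
      \<open>H\<close> takes back to \<open>T p\<close>; the expansion by 1 / lam thus becomes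
      multiplication by lam under \<open>F\<close>.\<close>
    have "Ti (T (F p)) = F p" using TiT elim(2) by blast
    then have "H (T (F p)) = T p" using elim(3) by (simp add: H_def)
    then have "\<phi> p = 1 / lam * \<phi> (F p)" using elim(1) by (simp add: \<phi>_def)
    then show ?case using lam by simp
  qed
  with s3(1) \<phi>C \<phi>d show ?thesis unfolding \<gamma>_def by (rule that)
qed

section \<open>Saddles in the plane\<close>

definition to_pair :: "real^2 \<Rightarrow> plane" where
  "to_pair x = (x $ 1, x $ 2)"

definition of_pair :: "plane \<Rightarrow> real^2" where
  "of_pair p = vector [fst p, snd p]"

lemma of_pair_to_pair [simp]: "of_pair (to_pair x) = x"
  and to_pair_of_pair [simp]: "to_pair (of_pair p) = p"
  by (simp_all add: to_pair_def of_pair_def vec_eq_iff forall_2)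

lemma bounded_linear_to_pair: "bounded_linear to_pair"
  unfolding to_pair_def[abs_def]
  by (intro bounded_linear_Pair bounded_linear_vec_nth)

lemma bounded_linear_of_pair: "bounded_linear of_pair"
  unfolding linear_conv_bounded_linear[symmetric]
  by (intro linearI) (simp_all add: of_pair_def vec_eq_iff forall_2)

lemma to_pair_0 [simp]: "to_pair 0 = 0" and of_pair_0 [simp]: "of_pair 0 = 0"
  using bounded_linear_to_pair bounded_linear_of_pair
  by (auto simp: bounded_linear.linear linear_0)

lemma diag2_mult: "diag2 a b *v x = of_pair (a * fst (to_pair x), b * snd (to_pair x))"
  by (simp add: diag2_def of_pair_def to_pair_def vec_eq_iff forall_2 matrix_vector_mult_def sum_2)

theorem theorem3:
  fixes lambda1 lambda2 \<alpha> \<sigma> \<beta> :: real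
    and F :: "real^2 \<Rightarrow> real^2"
  assumes "0 < \<bar>lambda1\<bar>" and "\<bar>lambda1\<bar> < 1" and "1 < \<bar>lambda2\<bar>"
    and "0 < \<alpha>" and "\<alpha> \<le> 1"
    and "C1_diffeo_on UNIV F" and "surj F" and "C1_holder_on \<alpha> UNIV F"
    and "F 0 = 0"
    and "(F has_derivative (\<lambda>x. diag2 lambda1 lambda2 *v x)) (at 0)"
    and "\<sigma> = ln \<bar>lambda2\<bar> / ln \<bar>lambda1\<bar>"
    and "\<beta> = (if \<bar>lambda1 * lambda2\<bar> \<le> 1 then - \<sigma> * inverse (1 - \<sigma>) * \<alpha>
               else inverse (1 - \<sigma>) * \<alpha>)"
  shows "\<exists>U. \<exists>\<Phi> :: real^2 \<Rightarrow> real^2.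
           (\<exists>r>0. U = cball 0 r) \<and>
           C1_diffeo_on U \<Phi> \<and>
           C1_holder_on \<beta> U \<Phi> \<and>
           C1_holder_on \<beta> (\<Phi> ` U) (inv_into U \<Phi>) \<and>
           (\<forall>\<^sub>F x in nhds 0. \<Phi> (F x) = diag2 lambda1 lambda2 *v \<Phi> x)"
proof -
  note lam = assms(1,2) and mu = assms(3) and \<alpha> = assms(4,5)
  define P where "P p = to_pair (F (of_pair p))" for p
  have FP: "F x = of_pair (P (to_pair x))" for x by (simp add: P_def)
  note der_to = bounded_linear_imp_has_derivative[OF bounded_linear_to_pair]
    and der_of = bounded_linear_imp_has_derivative[OF bounded_linear_of_pair]
  have PC: "C1_holder_on \<alpha> (cball 0 1) P"
    unfolding P_def[abs_def]
    by (intro C1_holder_on_linear_compose[OF bounded_linear_to_pair]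
        C1_holder_on_compose[OF C1_holder_on_linear[OF bounded_linear_of_pair] assms(8)] \<alpha>) auto
  have P0: "P 0 = 0" by (simp add: P_def assms(9))
  have Pd: "(P has_derivative (\<lambda>v. (lambda1 * fst v, lambda2 * snd v))) (at 0)"
  proof -
    have "((\<lambda>p. F (of_pair p)) has_derivative (\<lambda>v. diag2 lambda1 lambda2 *v of_pair v)) (at 0)"
      using has_derivative_compose[OF der_of, of F "\<lambda>x. diag2 lambda1 lambda2 *v x"] assms(10) by simp
    from has_derivative_compose[OF this der_to] show ?thesis
      by (simp add: P_def[abs_def] diag2_mult)
  qed
  define D' where "D' v = (1 / lambda1 * fst v, 1 / lambda2 * snd v)" for v :: plane
  have D': "bounded_linear D'"
    unfolding D'_def[abs_def]
    by (intro bounded_linear_Pair bounded_linear_const_mult bounded_linear_fst bounded_linear_snd)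
  have D'P: "D' (lambda1 * fst v, lambda2 * snd v) = v" for v
    using lam mu by (simp add: D'_def)
  obtain s t where s: "0 < s" "inj_on P (cball 0 s)"
    "C1_holder_on \<alpha> (P ` cball 0 s) (inv_into (cball 0 s) P)"
    "0 < t" "cball 0 t \<subseteq> P ` cball 0 s" "(inv_into (cball 0 s) P has_derivative D') (at 0)"
    using C1_holder_inverse[OF zero_less_one \<alpha>(1) PC P0 Pd D' D'P] by metis
  \<comment> \<open>A local inverse of class C^{1,alpha}, used from here on as a germ at 0.\<close>
  define Q where "Q = inv_into (cball 0 s) P"
  have QC: "C1_holder_on \<alpha> (cball 0 t) Q"
    unfolding Q_def using s(3,5) by (rule C1_holder_on_subset)
  have Qd: "(Q has_derivative (\<lambda>v. (1 / lambda1 * fst v, 1 / lambda2 * snd v))) (at 0)"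
    using s(6) unfolding Q_def D'_def[abs_def] .
  have QP: "Q (P p) = p" if "p \<in> cball 0 s" for p
    unfolding Q_def using s(2) that by (rule inv_into_f_f)
  have Q0: "Q 0 = 0" using QP[of 0] P0 s(1) by simp
  have evPQ: "\<forall>\<^sub>F p in nhds 0. P (Q p) = p"
    using eventually_cball[OF s(4)]
  proof eventually_elim
    case (elim p)
    then show ?case unfolding Q_def using s(5) by (intro f_inv_into_f) auto
  qed
  have evQP: "\<forall>\<^sub>F p in nhds 0. Q (P p) = p"
    using eventually_cball[OF s(1)] by eventually_elim (rule QP)
  obtain s1 \<phi>1 where \<phi>1: "0 < s1"
    "C1_holder_on (\<alpha> * ln \<bar>lambda2\<bar> / (ln \<bar>lambda2\<bar> - ln \<bar>lambda1\<bar>)) (cball 0 s1) \<phi>1"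
    "(\<phi>1 has_derivative fst) (at 0)" "\<forall>\<^sub>F p in nhds 0. \<phi>1 (P p) = lambda1 * \<phi>1 p"
    by (rule saddle_contracted_coordinate[OF lam mu \<alpha> zero_less_one s(4) PC P0 Pd QC Q0 Qd evPQ evQP])
  have swap0: "prod.swap (0 :: plane) = 0" by (simp add: zero_prod_def)
  have ev_swap: "\<forall>\<^sub>F p in nhds 0. R (prod.swap p)" if "eventually R (nhds (0 :: plane))" for R
    using eventually_nhds_image[OF swap_has_derivative, of R] that swap0 by simp
  define Ps where "Ps p = prod.swap (P (prod.swap p))" for p
  define Qs where "Qs p = prod.swap (Q (prod.swap p))" for p
  have lam': "0 < \<bar>1 / lambda2\<bar>" "\<bar>1 / lambda2\<bar> < 1" "1 < \<bar>1 / lambda1\<bar>" using lam mu by auto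
  \<comment> \<open>Passing to the inverse and exchanging the axes makes 1 / lambda2 the contracting
    multiplier in the first place, so the same theorem yields the other coordinate, with
    \<open>Qs\<close> as the map and \<open>Ps\<close> as its inverse.\<close>
  obtain s2 \<phi>2 where \<phi>2: "0 < s2"
    "C1_holder_on (\<alpha> * ln \<bar>1 / lambda1\<bar> / (ln \<bar>1 / lambda1\<bar> - ln \<bar>1 / lambda2\<bar>)) (cball 0 s2) \<phi>2"
    "(\<phi>2 has_derivative fst) (at 0)" "\<forall>\<^sub>F p in nhds 0. \<phi>2 (Qs p) = 1 / lambda2 * \<phi>2 p"
  proof (rule saddle_contracted_coordinate[OF lam' \<alpha> s(4) zero_less_one, of Qs Ps])
    show "C1_holder_on \<alpha> (cball 0 t) Qs" "C1_holder_on \<alpha> (cball 0 1) Ps"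
      unfolding Qs_def[abs_def] Ps_def[abs_def] by (rule C1_holder_on_swap_conj QC PC \<alpha>)+
    show "Qs 0 = 0" "Ps 0 = 0" by (simp_all add: Qs_def Ps_def Q0 P0 swap0)
    show "(Qs has_derivative (\<lambda>v. (1 / lambda2 * fst v, 1 / lambda1 * snd v))) (at 0)"
      unfolding Qs_def[abs_def] by (rule swap_conj_has_derivative[OF Qd])
    have "(Ps has_derivative (\<lambda>v. (lambda2 * fst v, lambda1 * snd v))) (at 0)"
      unfolding Ps_def[abs_def] by (rule swap_conj_has_derivative[OF Pd])
    then show "(Ps has_derivative (\<lambda>v. (1 / (1 / lambda2) * fst v, 1 / (1 / lambda1) * snd v))) (at 0)"
      by simp
    show "\<forall>\<^sub>F p in nhds 0. Qs (Ps p) = p"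
      using ev_swap[OF evQP] by (rule eventually_mono) (simp add: Ps_def Qs_def)
    show "\<forall>\<^sub>F p in nhds 0. Ps (Qs p) = p"
      using ev_swap[OF evPQ] by (rule eventually_mono) (simp add: Ps_def Qs_def)
  qed
  define \<gamma>1 \<gamma>2 where "\<gamma>1 = \<alpha> * ln \<bar>lambda2\<bar> / (ln \<bar>lambda2\<bar> - ln \<bar>lambda1\<bar>)"
    and "\<gamma>2 = \<alpha> * ln \<bar>1 / lambda1\<bar> / (ln \<bar>1 / lambda1\<bar> - ln \<bar>1 / lambda2\<bar>)"
  \<comment> \<open>With m = ln |lambda2| and l = - ln |lambda1| the exponents are \<alpha> m / (m +
    l) and \<alpha> l / (m + l), and |lambda1 lambda2| \<le> 1 means m \<le> l. Either case of
    \<beta> is therefore the minimum of \<open>\<gamma>1\<close> and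
    \<open>\<gamma>2\<close>.\<close>
  have \<beta>: "0 < \<beta>" "\<beta> \<le> \<gamma>1" "\<beta> \<le> \<gamma>2"
  proof -
    define m l where "m = ln \<bar>lambda2\<bar>" and "l = - ln \<bar>lambda1\<bar>"
    have ml: "0 < m" "0 < l" unfolding m_def l_def using lam mu by auto
    have \<sigma>: "\<sigma> = - (m / l)" unfolding assms(11) m_def l_def by simp
    have 1: "1 - \<sigma> = (l + m) / l" unfolding \<sigma> using ml by (simp add: field_simps)
    have g1: "\<gamma>1 = \<alpha> * m / (m + l)" unfolding \<gamma>1_def m_def l_def by simp
    have g2: "\<gamma>2 = \<alpha> * l / (m + l)"
      unfolding \<gamma>2_def m_def l_def using lam mu by (simp add: ln_div add.commute)
    have e1: "- \<sigma> * inverse (1 - \<sigma>) * \<alpha> = \<gamma>1"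
      unfolding 1 g1 using ml by (simp add: \<sigma> field_simps)
    have e2: "inverse (1 - \<sigma>) * \<alpha> = \<gamma>2"
      unfolding 1 g2 using ml by (simp add: field_simps)
    have iff: "\<bar>lambda1 * lambda2\<bar> \<le> 1 \<longleftrightarrow> m \<le> l"
    proof -
      have "\<bar>lambda1 * lambda2\<bar> \<le> 1 \<longleftrightarrow> ln \<bar>lambda1 * lambda2\<bar> \<le> 0"
        using lam mu by (subst ln_le_zero_iff) auto
      also have "ln \<bar>lambda1 * lambda2\<bar> = m - l"
        unfolding m_def l_def abs_mult using lam mu by (simp add: ln_mult)
      finally show ?thesis by simp
    qed
    have pos: "0 < \<gamma>1" "0 < \<gamma>2" unfolding g1 g2 using ml \<alpha> by auto
    have "\<gamma>1 \<le> \<gamma>2 \<longleftrightarrow> m \<le> l"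
      unfolding g1 g2 using ml \<alpha> by (simp add: divide_le_cancel)
    then show "0 < \<beta>" "\<beta> \<le> \<gamma>1" "\<beta> \<le> \<gamma>2"
      unfolding assms(12) e1 e2 using iff pos by auto
  qed
  define \<phi> where "\<phi> p = (\<phi>1 p, \<phi>2 (prod.swap p))" for p
  define s0 where "s0 = min s1 s2"
  have s0: "0 < s0" "s0 \<le> s1" "s0 \<le> s2" unfolding s0_def using \<phi>1(1) \<phi>2(1) by auto
  have \<phi>C: "C1_holder_on \<beta> (cball 0 s0) \<phi>"
  proof -
    have "C1_holder_on \<gamma>1 (cball 0 s0) \<phi>1"
      unfolding \<gamma>1_def using \<phi>1(2) by (rule C1_holder_on_subset) (use s0 in auto)
    then have 1: "C1_holder_on \<beta> (cball 0 s0) \<phi>1"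
      by (rule C1_holder_on_exponent_mono[OF _ bounded_cball \<beta>(1,2)])
    have "C1_holder_on \<gamma>2 (cball 0 s0) \<phi>2"
      unfolding \<gamma>2_def using \<phi>2(2) by (rule C1_holder_on_subset) (use s0 in auto)
    then have 2: "C1_holder_on \<beta> (cball 0 s0) \<phi>2"
      by (rule C1_holder_on_exponent_mono[OF _ bounded_cball \<beta>(1,3)])
    have "C1_holder_on \<beta> (cball 0 s0) (\<lambda>p. \<phi>2 (prod.swap p))"
      by (rule C1_holder_on_compose[OF C1_holder_on_linear[OF bounded_linear_swap] 2])
        (use \<beta>(1) in \<open>auto simp: norm_swap\<close>)
    then show ?thesis unfolding \<phi>_def[abs_def] by (rule C1_holder_on_Pair[OF 1 _ \<beta>(1)])
  qed
  have \<phi>d: "(\<phi> has_derivative (\<lambda>v. v)) (at 0)"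
  proof -
    have "((\<lambda>p. \<phi>2 (prod.swap p)) has_derivative (\<lambda>v. fst (prod.swap v))) (at 0)"
      using has_derivative_compose[OF swap_has_derivative, of \<phi>2 fst 0 UNIV] \<phi>2(3) swap0 by simp
    from has_derivative_Pair[OF \<phi>1(3) this] show ?thesis by (simp add: \<phi>_def[abs_def])
  qed
  have \<phi>conj: "\<forall>\<^sub>F p in nhds 0. \<phi> (P p) = (lambda1 * fst (\<phi> p), lambda2 * snd (\<phi> p))"
  proof -
    \<comment> \<open>The relation for \<open>\<phi>2\<close> is read at
      \<open>prod.swap (P p)\<close>, where \<open>Qs\<close> undoes \<open>P\<close>; solved for
      the value there, it has the multiplier lambda2.\<close>
    have "\<forall>\<^sub>F p in nhds 0. \<phi>2 (Qs (prod.swap (P p))) = 1 / lambda2 * \<phi>2 (prod.swap (P p))"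
      using eventually_nhds_image[OF Pd, of "\<lambda>p. \<phi>2 (Qs (prod.swap p)) = 1 / lambda2 * \<phi>2 (prod.swap p)"]
        ev_swap[OF \<phi>2(4)] P0 by simp
    with \<phi>1(4) evQP show ?thesis
    proof eventually_elim
      case (elim p)
      then have "\<phi>2 (prod.swap p) = 1 / lambda2 * \<phi>2 (prod.swap (P p))" by (simp add: Qs_def)
      then show ?case using elim(1) mu by (auto simp: \<phi>_def)
    qed
  qed
  define \<Phi> where "\<Phi> x = of_pair (\<phi> (to_pair x))" for x
  have "\<forall>\<^sub>F x in nhds 0. to_pair x \<in> cball 0 s0"
    using eventually_nhds_image[OF der_to[of "at 0"], of "\<lambda>p. p \<in> cball 0 s0"] eventually_cball[OF s0(1)]
    by (simp only: to_pair_0)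
  then obtain \<rho> where \<rho>: "0 < \<rho>" "\<And>x. x \<in> cball 0 \<rho> \<Longrightarrow> to_pair x \<in> cball 0 s0"
    by (rule eventually_cballE) blast
  have \<Phi>C: "C1_holder_on \<beta> (cball 0 \<rho>) \<Phi>"
    unfolding \<Phi>_def[abs_def]
    by (intro C1_holder_on_linear_compose[OF bounded_linear_of_pair]
        C1_holder_on_compose[OF C1_holder_on_linear[OF bounded_linear_to_pair] \<phi>C] \<rho> \<beta>(1)) auto
  have \<Phi>d: "(\<Phi> has_derivative (\<lambda>v. v)) (at 0)"
  proof -
    have "((\<lambda>x. \<phi> (to_pair x)) has_derivative (\<lambda>v. to_pair v)) (at 0)"
      using has_derivative_compose[OF der_to, of \<phi> "\<lambda>v. v" 0 UNIV] \<phi>d by simp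
    from has_derivative_compose[OF this der_of] show ?thesis by (simp add: \<Phi>_def[abs_def])
  qed
  have \<Phi>conj: "\<forall>\<^sub>F x in nhds 0. \<Phi> (F x) = diag2 lambda1 lambda2 *v \<Phi> x"
  proof -
    have "\<forall>\<^sub>F x in nhds 0. \<phi> (P (to_pair x))
        = (lambda1 * fst (\<phi> (to_pair x)), lambda2 * snd (\<phi> (to_pair x)))"
      using eventually_nhds_image[OF der_to[of "at 0"],
          of "\<lambda>p. \<phi> (P p) = (lambda1 * fst (\<phi> p), lambda2 * snd (\<phi> p))"] \<phi>conj
      by (simp only: to_pair_0)
    then show ?thesis
      by (rule eventually_mono) (simp add: \<Phi>_def FP diag2_mult)
  qed
  \<comment> \<open>The conjugacy at the fixed point 0, with both multipliers different from 1,
    forces the value 0.\<close>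
  have \<Phi>0: "\<Phi> 0 = 0"
  proof -
    have "lambda1 * fst (\<phi> 0) = fst (\<phi> 0)" "lambda2 * snd (\<phi> 0) = snd (\<phi> 0)"
      using eventually_nhds_x_imp_x[OF \<phi>conj] P0 by (metis fst_conv snd_conv)+
    then have "\<phi> 0 = 0" using lam mu by (auto simp: prod_eq_iff)
    then show ?thesis by (simp add: \<Phi>_def)
  qed
  \<comment> \<open>The derivative of \<open>\<Phi>\<close> at 0 is the identity, so
    \<open>\<Phi>\<close> restricted to a small disk is injective with inverse of the same class on
    the whole image.\<close>
  obtain r where r: "0 < r" "r \<le> \<rho>" "inj_on \<Phi> (cball 0 r)"
    "C1_holder_on \<beta> (\<Phi> ` cball 0 r) (inv_into (cball 0 r) \<Phi>)"
    using C1_holder_inverse[OF \<rho>(1) \<beta>(1) \<Phi>C \<Phi>0 \<Phi>d bounded_linear_ident] by metis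
  have "C1_holder_on \<beta> (cball 0 r) \<Phi>"
    using r(2) by (intro C1_holder_on_subset[OF \<Phi>C]) auto
  then show ?thesis
    using r \<Phi>conj C1_holder_on_imp_C1_on unfolding C1_diffeo_on_def by blast
qed

end
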